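(* Let $\Omega\subset\mathbb{R}^n$, $n\ge 2$, be a bounded Lipschitz domain and let $k>0$. Then the domain $\mathcal{D}(\Lambda)=L^{\infty}(\Omega)\setminus L_k(\Omega)$ of the Neumann-to-Dirichlet operator $\Lambda(q)$ associated with the Helmholtz equation is an open set (in $L^\infty(\Omega)$).
   Context: All functions are real-valued. For $q\in L^\infty(\Omega)$ and $g\in L^2(\partial\Omega)$ consider the Neumann problem $\Delta u+k^2qu=0$ in $\Omega$, $\partial_\nu u=g$ on $\partial\Omega$ ($\nu$ the unit exterior normal), understood weakly: $u\in H^1(\Omega)$ and $\int_\Omega(\nabla u\cdot\nabla v-k^2quv)\,\mathrm{d}x=\int_{\partial\Omega}gv\,\mathrm{d}s$ for all $v\in H^1(\Omega)$. $L_k(\Omega)$ denotes the set of all $q\in L^\infty(\Omega)$ for which $k$ is a resonance frequency, i.e. for which the problem with $g=0$ has a non-trivial solution $u\in H^1(\Omega)$. For $q\in\mathcal{D}(\Lambda):=L^\infty(\Omega)\setminus L_k(\Omega)$ the Neumann problem is uniquely solvable and the Neumann-to-Dirichlet operator is $\Lambda(q):L^2(\partial\Omega)\to L^2(\partial\Omega)$, $g\mapsto u|_{\partial\Omega}$. *)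

theory Defs
  imports "HOL-Analysis.Analysis" "HOL-Probability.Essential_Supremum"
begin

section \<open>Bounded Lipschitz domains\<close>

text \<open>
  Near each boundary point, \<open>\<Omega>\<close> is the strict epigraph of a Lipschitz function \<open>\<gamma>\<close>
  over the hyperplane orthogonal to a unit vector \<open>e\<close>; choosing \<open>e\<close> replaces the usual
  rotation of the coordinate axes.
\<close>

definition bounded_Lipschitz_domain :: "'a::euclidean_space set \<Rightarrow> bool" where
  "bounded_Lipschitz_domain \<Omega> \<longleftrightarrow>
     open \<Omega> \<and> connected \<Omega> \<and> \<Omega> \<noteq> {} \<and> bounded \<Omega> \<and>
     (\<forall>x\<in>frontier \<Omega>. \<exists>r>0. \<exists>e L. \<exists>\<gamma>::'a \<Rightarrow> real.
        norm e = 1 \<and> L-lipschitz_on {z. z \<bullet> e = 0} \<gamma> \<and>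
        \<Omega> \<inter> ball x r = {y \<in> ball x r. y \<bullet> e > \<gamma> (y - (y \<bullet> e) *\<^sub>R e)})"


section \<open>The Banach space of essentially bounded functions, as a metric space\<close>

definition Linf_fun :: "'a measure \<Rightarrow> ('a \<Rightarrow> real) set" where
  "Linf_fun M = {f \<in> borel_measurable M. esssup M (\<lambda>x. ereal \<bar>f x\<bar>) < \<infinity>}"

definition Linf_norm :: "'a measure \<Rightarrow> ('a \<Rightarrow> real) \<Rightarrow> real" where
  "Linf_norm M f = real_of_ereal (esssup M (\<lambda>x. ereal \<bar>f x\<bar>))"

definition ae_eq :: "'a measure \<Rightarrow> (('a \<Rightarrow> real) \<times> ('a \<Rightarrow> real)) set" where
  "ae_eq M = {(f, g). f \<in> Linf_fun M \<and> g \<in> Linf_fun M \<and> (AE x in M. f x = g x)}"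

definition Linf :: "'a measure \<Rightarrow> ('a \<Rightarrow> real) set set" where
  "Linf M = Linf_fun M // ae_eq M"

definition repr :: "('a \<Rightarrow> real) set \<Rightarrow> 'a \<Rightarrow> real" where
  "repr Q = (SOME q. q \<in> Q)"

definition Linf_dist :: "'a measure \<Rightarrow> ('a \<Rightarrow> real) set \<Rightarrow> ('a \<Rightarrow> real) set \<Rightarrow> real" where
  "Linf_dist M P Q = Linf_norm M (\<lambda>x. repr P x - repr Q x)"

definition Linf_topology :: "'a measure \<Rightarrow> ('a \<Rightarrow> real) set topology" where
  "Linf_topology M = Metric_space.mtopology (Linf M) (Linf_dist M)"

lemma equiv_ae_eq: "equiv (Linf_fun M) (ae_eq M)"
  unfolding equiv_def ae_eq_def refl_on_def sym_def trans_def by auto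

lemma repr_Linf:
  assumes "Q \<in> Linf M"
  shows "repr Q \<in> Q" "repr Q \<in> Linf_fun M"
proof -
  from assms equiv_ae_eq[of M] have "Q \<noteq> {}" "Q \<subseteq> Linf_fun M"
    unfolding Linf_def by (auto dest: in_quotient_imp_non_empty in_quotient_imp_subset)
  then show "repr Q \<in> Q"
    unfolding repr_def by (simp add: some_in_eq)
  with \<open>Q \<subseteq> Linf_fun M\<close> show "repr Q \<in> Linf_fun M"
    by blast
qed

lemma Linf_eq_iff:
  assumes "P \<in> Linf M" "Q \<in> Linf M"
  shows "P = Q \<longleftrightarrow> (AE x in M. repr P x = repr Q x)"
proof -
  have "P = Q \<longleftrightarrow> (repr P, repr Q) \<in> ae_eq M"
    using quotient_eq_iff[OF equiv_ae_eq] assms repr_Linf unfolding Linf_def by metis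
  then show ?thesis
    using assms repr_Linf(2) by (auto simp: ae_eq_def)
qed

lemma Linf_norm_nonneg: "0 \<le> Linf_norm M f"
proof (cases "emeasure M (space M) = 0")
  case True
  then show ?thesis
    by (cases "(\<lambda>x. ereal \<bar>f x\<bar>) \<in> borel_measurable M")
       (simp_all add: Linf_norm_def esssup_zero_space esssup_non_measurable top_ereal_def)
next
  case False
  have "esssup M (\<lambda>x. ereal 0) \<le> esssup M (\<lambda>x. ereal \<bar>f x\<bar>)"
    by (intro esssup_mono) auto
  then show ?thesis
    using False esssup_const[of M "ereal 0"]
    by (simp add: Linf_norm_def real_of_ereal_pos zero_ereal_def)
qed

lemma Linf_norm_le:
  assumes "f \<in> borel_measurable M" "0 \<le> c" "AE x in M. \<bar>f x\<bar> \<le> c"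
  shows "f \<in> Linf_fun M" "Linf_norm M f \<le> c"
proof -
  have *: "esssup M (\<lambda>x. ereal \<bar>f x\<bar>) \<le> ereal c"
    using assms by (intro esssup_I) auto
  then show "f \<in> Linf_fun M"
    using assms(1) by (auto simp: Linf_fun_def intro: le_less_trans)
  show "Linf_norm M f \<le> c"
    using * assms(2) by (cases "esssup M (\<lambda>x. ereal \<bar>f x\<bar>)") (auto simp: Linf_norm_def)
qed

lemma Linf_norm_AE:
  assumes "f \<in> Linf_fun M"
  shows "AE x in M. \<bar>f x\<bar> \<le> Linf_norm M f"
proof (cases "esssup M (\<lambda>x. ereal \<bar>f x\<bar>)")
  case (real r)
  then show ?thesis
    using esssup_AE[of "\<lambda>x. ereal \<bar>f x\<bar>" M] by (simp add: Linf_norm_def)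
next
  case PInf
  then show ?thesis using assms by (simp add: Linf_fun_def)
next
  case MInf
  then show ?thesis using esssup_AE[of "\<lambda>x. ereal \<bar>f x\<bar>" M]
    by (auto elim: eventually_mono)
qed

lemma Linf_fun_diff:
  assumes "f \<in> Linf_fun M" "g \<in> Linf_fun M"
  shows "(\<lambda>x. f x - g x) \<in> Linf_fun M"
proof (rule Linf_norm_le)
  show "(\<lambda>x. f x - g x) \<in> borel_measurable M"
    using assms by (auto simp: Linf_fun_def)
  show "0 \<le> Linf_norm M f + Linf_norm M g"
    by (simp add: Linf_norm_nonneg)
  show "AE x in M. \<bar>f x - g x\<bar> \<le> Linf_norm M f + Linf_norm M g"
    using Linf_norm_AE[OF assms(1)] Linf_norm_AE[OF assms(2)] by eventually_elim linarith
qed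

lemma Metric_space_Linf: "Metric_space (Linf M) (Linf_dist M)"
proof
  show "0 \<le> Linf_dist M P Q" for P Q
    by (simp add: Linf_dist_def Linf_norm_nonneg)
  show "Linf_dist M P Q = Linf_dist M Q P" for P Q
    by (simp add: Linf_dist_def Linf_norm_def abs_minus_commute)
next
  fix P Q assume PQ: "P \<in> Linf M" "Q \<in> Linf M"
  then have d: "(\<lambda>x. repr P x - repr Q x) \<in> Linf_fun M"
    by (intro Linf_fun_diff repr_Linf(2))
  show "Linf_dist M P Q = 0 \<longleftrightarrow> P = Q"
  proof
    assume "Linf_dist M P Q = 0"
    then show "P = Q"
      using Linf_norm_AE[OF d] PQ by (simp add: Linf_dist_def Linf_eq_iff)
  next
    assume "P = Q"
    then have "Linf_dist M P Q \<le> 0"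
      unfolding Linf_dist_def by (intro Linf_norm_le) auto
    then show "Linf_dist M P Q = 0"
      using Linf_norm_nonneg[of M "\<lambda>x. repr P x - repr Q x"] by (simp add: Linf_dist_def)
  qed
next
  fix P Q R assume PQR: "P \<in> Linf M" "Q \<in> Linf M" "R \<in> Linf M"
  then have d: "(\<lambda>x. repr P x - repr Q x) \<in> Linf_fun M" "(\<lambda>x. repr Q x - repr R x) \<in> Linf_fun M"
      "(\<lambda>x. repr P x - repr R x) \<in> Linf_fun M"
    by (auto intro!: Linf_fun_diff repr_Linf(2))
  show "Linf_dist M P R \<le> Linf_dist M P Q + Linf_dist M Q R"
    unfolding Linf_dist_def
  proof (rule Linf_norm_le)
    show "(\<lambda>x. repr P x - repr R x) \<in> borel_measurable M"
      using d(3) by (simp add: Linf_fun_def)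
    show "AE x in M. \<bar>repr P x - repr R x\<bar> \<le>
        Linf_norm M (\<lambda>x. repr P x - repr Q x) + Linf_norm M (\<lambda>x. repr Q x - repr R x)"
      using Linf_norm_AE[OF d(1)] Linf_norm_AE[OF d(2)] by eventually_elim linarith
  qed (simp add: Linf_norm_nonneg)
qed


section \<open>The Sobolev space $H^1$\<close>

text \<open>
  Elements of $L^2$ and $H^1$ are handled through representatives; equality of such elements
  is equality almost everywhere.
\<close>

definition L2 :: "'a measure \<Rightarrow> ('a \<Rightarrow> 'b::euclidean_space) set" where
  "L2 M = {f \<in> borel_measurable M. integrable M (\<lambda>x. (norm (f x))\<^sup>2)}"

primrec C_k :: "nat \<Rightarrow> ('a::euclidean_space \<Rightarrow> real) \<Rightarrow> bool" where
  "C_k 0 f \<longleftrightarrow> continuous_on UNIV f"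
| "C_k (Suc m) f \<longleftrightarrow> f differentiable_on UNIV \<and>
     (\<forall>i\<in>Basis. C_k m (\<lambda>x. frechet_derivative f (at x) i))"

definition smooth :: "('a::euclidean_space \<Rightarrow> real) \<Rightarrow> bool" where
  "smooth f \<longleftrightarrow> (\<forall>m. C_k m f)"

definition test_functions :: "'a::euclidean_space set \<Rightarrow> ('a \<Rightarrow> real) set" where
  "test_functions \<Omega> = {\<phi>. smooth \<phi> \<and> compact (closure {x. \<phi> x \<noteq> 0}) \<and> closure {x. \<phi> x \<noteq> 0} \<subseteq> \<Omega>}"

definition is_weak_grad :: "'a::euclidean_space set \<Rightarrow> ('a \<Rightarrow> real) \<Rightarrow> ('a \<Rightarrow> 'a) \<Rightarrow> bool" where
  "is_weak_grad \<Omega> u G \<longleftrightarrow>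
     (\<forall>\<phi>\<in>test_functions \<Omega>. \<forall>i\<in>Basis.
        (LINT x|lebesgue_on \<Omega>. u x * frechet_derivative \<phi> (at x) i) =
        - (LINT x|lebesgue_on \<Omega>. (G x \<bullet> i) * \<phi> x))"

definition H1 :: "'a::euclidean_space set \<Rightarrow> ('a \<Rightarrow> real) set" where
  "H1 \<Omega> = {u \<in> L2 (lebesgue_on \<Omega>). \<exists>G\<in>L2 (lebesgue_on \<Omega>). is_weak_grad \<Omega> u G}"

text \<open>The weak gradient is unique up to equality almost everywhere, so any choice will do.\<close>

definition weak_grad :: "'a::euclidean_space set \<Rightarrow> ('a \<Rightarrow> real) \<Rightarrow> 'a \<Rightarrow> 'a" where
  "weak_grad \<Omega> u = (SOME G. G \<in> L2 (lebesgue_on \<Omega>) \<and> is_weak_grad \<Omega> u G)"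

definition H1_norm :: "'a::euclidean_space set \<Rightarrow> ('a \<Rightarrow> real) \<Rightarrow> real" where
  "H1_norm \<Omega> u = sqrt ((LINT x|lebesgue_on \<Omega>. (u x)\<^sup>2) +
                      (LINT x|lebesgue_on \<Omega>. (norm (weak_grad \<Omega> u x))\<^sup>2))"


section \<open>Surface measure and boundary traces\<close>

text \<open>
  The surface measure on \<open>\<partial>\<Omega>\<close> is the $(n-1)$-dimensional Hausdorff measure, normalised so that
  it agrees with the usual area. Boundedness of the covering sets is required explicitly because
  \<open>diameter\<close> is meaningful only for bounded sets. The outer measure below is a metric outer
  measure, hence countably additive on Borel sets, so \<open>measure_of\<close> does not collapse to zero.
\<close>

definition hausdorff_outer :: "nat \<Rightarrow> 'a::euclidean_space set \<Rightarrow> ennreal" where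
  "hausdorff_outer d A =
     (SUP \<delta>\<in>{0::real<..}.
        INF C\<in>{C :: nat \<Rightarrow> 'a set. A \<subseteq> (\<Union>i. C i) \<and> (\<forall>i. bounded (C i) \<and> diameter (C i) \<le> \<delta>)}.
          \<Sum>i. ennreal (unit_ball_vol (real d) * (diameter (C i) / 2) ^ d))"

definition hausdorff_measure :: "nat \<Rightarrow> 'a::euclidean_space measure" where
  "hausdorff_measure d = measure_of UNIV (sets borel) (hausdorff_outer d)"

definition surface_measure :: "'a::euclidean_space set \<Rightarrow> 'a measure" where
  "surface_measure \<Omega> = restrict_space (hausdorff_measure (DIM('a) - 1)) (frontier \<Omega>)"

text \<open>
  On a bounded Lipschitz domain the trace is the continuous extension to $H^1$ of the restriction
  \<open>\<phi> \<mapsto> \<phi>|\<^sub>\<partial>\<^sub>\<Omega>\<close> of smooth functions, with values in $L^2$ of the boundary; it is unique almost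
  everywhere.
\<close>

definition is_trace :: "'a::euclidean_space set \<Rightarrow> ('a \<Rightarrow> real) \<Rightarrow> ('a \<Rightarrow> real) \<Rightarrow> bool" where
  "is_trace \<Omega> v w \<longleftrightarrow> w \<in> L2 (surface_measure \<Omega>) \<and>
     (\<exists>\<phi> :: nat \<Rightarrow> 'a \<Rightarrow> real. (\<forall>j. smooth (\<phi> j)) \<and>
        (\<lambda>j. H1_norm \<Omega> (\<lambda>x. \<phi> j x - v x)) \<longlonglongrightarrow> 0 \<and>
        (\<lambda>j. LINT x|surface_measure \<Omega>. (\<phi> j x - w x)\<^sup>2) \<longlonglongrightarrow> 0)"

definition trace :: "'a::euclidean_space set \<Rightarrow> ('a \<Rightarrow> real) \<Rightarrow> 'a \<Rightarrow> real" where
  "trace \<Omega> v = (SOME w. is_trace \<Omega> v w)"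


section \<open>The Neumann problem and the domain of the Neumann-to-Dirichlet operator\<close>

definition neumann_solution ::
  "real \<Rightarrow> 'a::euclidean_space set \<Rightarrow> ('a \<Rightarrow> real) \<Rightarrow> ('a \<Rightarrow> real) \<Rightarrow> ('a \<Rightarrow> real) \<Rightarrow> bool" where
  "neumann_solution k \<Omega> q g u \<longleftrightarrow> u \<in> H1 \<Omega> \<and>
     (\<forall>v\<in>H1 \<Omega>.
        (LINT x|lebesgue_on \<Omega>. weak_grad \<Omega> u x \<bullet> weak_grad \<Omega> v x - k\<^sup>2 * q x * u x * v x) =
        (LINT x|surface_measure \<Omega>. g x * trace \<Omega> v x))"

definition resonant :: "real \<Rightarrow> 'a::euclidean_space set \<Rightarrow> ('a \<Rightarrow> real) set set" where
  "resonant k \<Omega> = {Q \<in> Linf (lebesgue_on \<Omega>).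
     \<exists>u. neumann_solution k \<Omega> (repr Q) (\<lambda>_. 0) u \<and> \<not> (AE x in lebesgue_on \<Omega>. u x = 0)}"

definition NtD_domain :: "real \<Rightarrow> 'a::euclidean_space set \<Rightarrow> ('a \<Rightarrow> real) set set" where
  "NtD_domain k \<Omega> = Linf (lebesgue_on \<Omega>) - resonant k \<Omega>"

text \<open>
  The operator itself, meaningful for \<open>Q \<in> NtD_domain k \<Omega>\<close> and \<open>g \<in> L2 (surface_measure \<Omega>)\<close>,
  where the solution is unique almost everywhere.
\<close>

definition NtD :: "real \<Rightarrow> 'a::euclidean_space set \<Rightarrow> ('a \<Rightarrow> real) set \<Rightarrow> ('a \<Rightarrow> real) \<Rightarrow> 'a \<Rightarrow> real" where
  "NtD k \<Omega> Q g = trace \<Omega> (SOME u. neumann_solution k \<Omega> (repr Q) g u)"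

end

theory Submission
  imports Defs "HOL-Computational_Algebra.Polynomial" "HOL-Library.Diagonal_Subsequence"
begin

text \<open>
  It suffices to show that a limit, in the $L^\infty$ norm, of resonant coefficients is resonant.
  Let \<open>p n\<close> tend to \<open>q\<close>, and let \<open>u n\<close> be solutions of the homogeneous problem for \<open>p n\<close> with
  $L^2$ norm 1. The boundary integral vanishes for zero Neumann data.
  Testing the equation with \<open>u n\<close> itself bounds the gradients in $L^2$, and Rellich's theorem
  provides a subsequence that is Cauchy in $L^2$. Testing the equations of two members of the sequence
  with their difference \<open>w\<close> gives
  \<open>\<integral>\<bar>\<nabla>w\<bar>\<^sup>2 = k\<^sup>2 \<integral>(p i u i - p j u j) w\<close>, so the gradients are Cauchy in $L^2$ too.
  The limit of the solutions solves the problem for \<open>q\<close> and has norm 1. This is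
  \<open>resonance_limit\<close>.

  The substance is Rellich's theorem on a bounded Lipschitz domain, proved here from the definition of
  a weak gradient. It rests on the inequality (\<open>Rellich_inequality\<close>)
  \<open>\<integral>u\<^sup>2 \<le> \<epsilon> \<integral>\<bar>\<nabla>u\<bar>\<^sup>2 + C \<Sum>\<^sub>E (\<integral>\<^sub>E u)\<^sup>2\<close>
  with a finite family of sets \<open>E\<close> depending only on the domain and \<open>\<epsilon>\<close>: once the countably many numbers
  \<open>\<integral>\<^sub>E u\<close> converge along a diagonal subsequence, the subsequence is Cauchy in $L^2$.

  The inequality is local. Near every point of the closure there are a direction \<open>e\<close> and a constant
  \<open>c > 0\<close> such that from each point \<open>y\<close> of the domain the balls of radius \<open>c t\<close> about \<open>y + t e\<close> stay in
  the domain for small \<open>t\<close> (\<open>Lipschitz_domain_inner_cone\<close>); near the boundary \<open>e\<close> is the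
  graph direction. Comparing \<open>u(y)\<close> with the mean of \<open>u\<close> over a ball near \<open>y + t e\<close> costs
  \<open>O(t\<^sup>2) \<integral>\<bar>\<nabla>u\<bar>\<^sup>2\<close>, because a translation by \<open>h\<close> along segments inside the domain changes \<open>u\<close> by at most
  \<open>\<bar>h\<bar>\<close> times the norm of the gradient (\<open>translation_estimate\<close>). Only finitely many balls occur, and
  shifting them into the domain takes the place of an extension of \<open>u\<close> across the boundary.

  The translation estimate comes from the identity
  \<open>u(y + h) - u(y) = \<integral>\<^sub>0\<^sup>1 \<nabla>u(y + s h) \<bullet> h ds\<close> for almost every \<open>y\<close>, which holds after integration against
  smooth bumps by Fubini's theorem, hence almost everywhere by the fundamental lemma of the
  calculus of variations.
\<close>

section \<open>Smooth bumps on boxes and the fundamental lemma\<close>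

lemma C_k_Suc_imp: "C_k (Suc m) f \<Longrightarrow> C_k m f"
proof (induction m arbitrary: f)
  case 0
  then show ?case
    by (auto intro: differentiable_imp_continuous_on)
next
  case (Suc m)
  then show ?case by auto
qed

lemma frechet_derivative_eqI: "(f has_derivative f') (at x) \<Longrightarrow> frechet_derivative f (at x) = f'"
  by (metis frechet_derivative_at)

lemma C_k_const: "C_k m (\<lambda>x. c)"
  by (induction m arbitrary: c) (auto simp: frechet_derivative_const)

lemma C_k_has_derivative:
  "C_k (Suc m) f \<Longrightarrow> (f has_derivative frechet_derivative f (at x)) (at x)"
  by (auto simp: differentiable_on_def frechet_derivative_works[symmetric])

text \<open>
  Lets the derivative be named instead of being written as \<open>frechet_derivative\<close>; all closure
  properties below go through this rule.
\<close>
lemma C_k_SucI: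
  assumes "\<And>x. (f has_derivative f' x) (at x)" "\<And>i. i \<in> Basis \<Longrightarrow> C_k m (\<lambda>x. f' x i)"
  shows "C_k (Suc m) f"
proof -
  have "frechet_derivative f (at x) = f' x" for x
    using assms(1) by (rule frechet_derivative_eqI)
  moreover have "f differentiable_on UNIV"
    using assms(1) by (auto simp: differentiable_on_def differentiable_def)
  ultimately show ?thesis
    using assms(2) by simp
qed

lemma C_k_add: "C_k m f \<Longrightarrow> C_k m g \<Longrightarrow> C_k m (\<lambda>x. f x + g x)"
proof (induction m arbitrary: f g)
  case 0
  then show ?case by (auto intro: continuous_on_add)
next
  case (Suc m)
  show ?case
  proof (rule C_k_SucI)
    show "((\<lambda>x. f x + g x) has_derivative
        (\<lambda>i. frechet_derivative f (at x) i + frechet_derivative g (at x) i)) (at x)" for x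
      by (intro has_derivative_add C_k_has_derivative[of m] Suc)
  qed (use Suc in auto)
qed

lemma C_k_mult: "C_k m f \<Longrightarrow> C_k m g \<Longrightarrow> C_k m (\<lambda>x. f x * g x)"
proof (induction m arbitrary: f g)
  case 0
  then show ?case by (auto intro: continuous_on_mult)
next
  case (Suc m)
  show ?case
  proof (rule C_k_SucI)
    show "((\<lambda>x. f x * g x) has_derivative
        (\<lambda>i. f x * frechet_derivative g (at x) i + frechet_derivative f (at x) i * g x)) (at x)" for x
      by (intro has_derivative_mult C_k_has_derivative[of m] Suc)
    show "C_k m (\<lambda>x. f x * frechet_derivative g (at x) i + frechet_derivative f (at x) i * g x)"
      if "i \<in> Basis" for i
      using Suc.prems that C_k_Suc_imp[OF Suc.prems(1)] C_k_Suc_imp[OF Suc.prems(2)]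
      by (intro C_k_add Suc.IH) auto
  qed
qed

lemma C_k_prod: "(\<And>i. i \<in> I \<Longrightarrow> C_k m (f i)) \<Longrightarrow> C_k m (\<lambda>x. \<Prod>i\<in>I. f i x)"
  by (induction I rule: infinite_finite_induct) (auto intro: C_k_const C_k_mult)

text \<open>
  The functions \<open>P(1/s) exp(-1/s)\<close>, continued by zero to \<open>s \<le> 0\<close>. Allowing an arbitrary polynomial
  \<open>P\<close> makes the family closed under differentiation, so that smoothness of \<open>exp(-1/s)\<close> becomes a
  plain induction on the order.
\<close>
definition flat :: "real poly \<Rightarrow> real \<Rightarrow> real" where
  "flat P s = (if s > 0 then poly P (inverse s) * exp (- inverse s) else 0)"

lemma poly_exp_decay: "((\<lambda>y::real. poly P y * exp (- y)) \<longlongrightarrow> 0) at_top"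
proof -
  have "((\<lambda>y. \<Sum>i\<le>degree P. coeff P i * (y ^ i / exp y)) \<longlongrightarrow> (\<Sum>i\<le>degree P. coeff P i * 0)) at_top"
    by (intro tendsto_intros tendsto_power_div_exp_0)
  then show ?thesis
    by (simp add: poly_altdef exp_minus field_simps sum_divide_distrib)
qed

text \<open>
  Away from 0 this is the product rule, \<open>d/ds (1/s) = -1/s\<^sup>2\<close> being the source of the factor
  $X^2$. At 0 the difference quotient is again of the form polynomial in \<open>1/s\<close> times \<open>exp(-1/s)\<close>.
\<close>
lemma flat_has_derivative:
  "(flat P has_real_derivative flat ([:0, 0, 1:] * (P - pderiv P)) s) (at s)"
proof (rule linorder_cases[of s 0])
  assume s: "s < 0"
  have "((\<lambda>_. 0) has_real_derivative 0) (at s)"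
    by simp
  then have "(flat P has_real_derivative 0) (at s)"
    by (rule has_field_derivative_transform_within_open[of _ _ _ "{..<0}"]) (use s in \<open>auto simp: flat_def\<close>)
  then show ?thesis using s by (simp add: flat_def)
next
  assume s: "s = 0"
  have "((\<lambda>h. poly (pCons 0 P) (inverse h) * exp (- inverse h)) \<longlongrightarrow> 0) (at_right 0)"
    by (rule filterlim_compose[OF poly_exp_decay filterlim_inverse_at_top_right])
  moreover have "\<forall>\<^sub>F h in at_right 0. poly (pCons 0 P) (inverse h) * exp (- inverse h) = flat P h / h"
    by (auto simp: eventually_at_filter flat_def field_simps)
  ultimately have "((\<lambda>h. flat P h / h) \<longlongrightarrow> 0) (at_right 0)"
    by (rule Lim_transform_eventually)
  moreover have "((\<lambda>h. flat P h / h) \<longlongrightarrow> 0) (at_left 0)"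
    by (rule tendsto_eventually) (auto simp: eventually_at_filter flat_def)
  ultimately have "((\<lambda>h. flat P h / h) \<longlongrightarrow> 0) (at 0)"
    by (simp add: filterlim_at_split)
  then show ?thesis
    using s by (simp add: DERIV_def flat_def)
next
  assume s: "s > 0"
  have "((\<lambda>s. poly P (inverse s) * exp (- inverse s)) has_real_derivative
      flat ([:0, 0, 1:] * (P - pderiv P)) s) (at s)"
    using s by (auto intro!: derivative_eq_intros poly_DERIV[THEN DERIV_chain2]
       simp: flat_def field_simps power2_eq_square)
  then show ?thesis
    by (rule has_field_derivative_transform_within_open[of _ _ _ "{0<..}"]) (use s in \<open>auto simp: flat_def\<close>)
qed

lemma C_k_flat: "C_k m (\<lambda>x. flat P (a \<bullet> x + b))"
proof (induction m arbitrary: P)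
  case 0
  have "continuous_on UNIV (flat P)"
    using flat_has_derivative by (meson DERIV_continuous_on has_field_derivative_at_within)
  then show ?case by (auto intro!: continuous_on_compose2[of UNIV "flat P"] continuous_intros)
next
  case (Suc m)
  define Q where "Q = [:0, 0, 1:] * (P - pderiv P)"
  show ?case
  proof (rule C_k_SucI)
    show "((\<lambda>x. flat P (a \<bullet> x + b)) has_derivative (\<lambda>i. flat Q (a \<bullet> x + b) * (a \<bullet> i))) (at x)" for x
      unfolding Q_def
      using has_derivative_compose[of "\<lambda>x. a \<bullet> x + b" "\<lambda>i. a \<bullet> i" x UNIV "flat P",
          OF _ flat_has_derivative[unfolded has_field_derivative_def]]
      by (force intro!: derivative_eq_intros)
    show "C_k m (\<lambda>x. flat Q (a \<bullet> x + b) * (a \<bullet> i))" for i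
      by (intro C_k_mult Suc C_k_const)
  qed
qed

text \<open>
  The arguments of \<open>flat\<close> are \<open>c (x \<bullet> i - a \<bullet> i)\<close> and \<open>c (b \<bullet> i - x \<bullet> i)\<close>, written in the affine form
  that \<open>C_k_flat\<close> handles. As \<open>exp(-1/(c s))\<close> tends to 1 for \<open>s > 0\<close>, large \<open>c\<close> make the bump
  approximate the indicator of the open box.
\<close>
definition box_bump :: "'a::euclidean_space \<Rightarrow> 'a \<Rightarrow> real \<Rightarrow> 'a \<Rightarrow> real" where
  "box_bump a b c x = (\<Prod>i\<in>Basis. flat 1 ((c *\<^sub>R i) \<bullet> x + - c * (a \<bullet> i)) * flat 1 ((- c *\<^sub>R i) \<bullet> x + c * (b \<bullet> i)))"

lemma smooth_box_bump: "smooth (box_bump a b c)"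
  unfolding smooth_def box_bump_def[abs_def] by (intro allI C_k_prod C_k_mult C_k_flat)

lemma flat_one_bounds: "0 \<le> flat 1 s" "flat 1 s \<le> 1" "s \<le> 0 \<Longrightarrow> flat 1 s = 0"
  by (auto simp: flat_def)

lemma box_bump_nonneg: "0 \<le> box_bump a b c x"
  unfolding box_bump_def by (intro prod_nonneg mult_nonneg_nonneg ballI flat_one_bounds)

lemma box_bump_le_1: "box_bump a b c x \<le> 1"
  unfolding box_bump_def by (intro prod_le_1 conjI mult_nonneg_nonneg mult_le_one flat_one_bounds)

lemma box_bump_outside:
  assumes "0 < c" "x \<notin> box a b"
  shows "box_bump a b c x = 0"
proof -
  from assms(2) obtain i where i: "i \<in> Basis" "x \<bullet> i \<le> a \<bullet> i \<or> b \<bullet> i \<le> x \<bullet> i"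
    by (auto simp: mem_box not_less)
  then have "(c *\<^sub>R i) \<bullet> x + - c * (a \<bullet> i) \<le> 0 \<or> (- c *\<^sub>R i) \<bullet> x + c * (b \<bullet> i) \<le> 0"
    using assms(1) by (auto simp: inner_commute algebra_simps)
  then have "flat 1 ((c *\<^sub>R i) \<bullet> x + - c * (a \<bullet> i)) * flat 1 ((- c *\<^sub>R i) \<bullet> x + c * (b \<bullet> i)) = 0"
    using flat_one_bounds(3) by (metis mult_eq_0_iff)
  then show ?thesis
    unfolding box_bump_def using i(1) by (intro prod_zero) auto
qed

lemma box_bump_test:
  assumes "0 < c" "cbox a b \<subseteq> \<Omega>"
  shows "box_bump a b c \<in> test_functions \<Omega>"
proof -
  have *: "closure {x. box_bump a b c x \<noteq> 0} \<subseteq> cbox a b"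
    using box_bump_outside[OF assms(1)] box_subset_cbox[of a b]
    by (intro closure_minimal) auto
  moreover have "compact (closure {x. box_bump a b c x \<noteq> 0})"
    using * bounded_subset[OF bounded_cbox] compact_eq_bounded_closed by blast
  ultimately show ?thesis
    using assms smooth_box_bump by (auto simp: test_functions_def)
qed

lemma flat_one_tendsto:
  assumes "s > 0"
  shows "(\<lambda>n. flat 1 (real (Suc n) * s)) \<longlonglongrightarrow> 1"
proof -
  have "(\<lambda>n. exp (- (inverse (real (Suc n)) * inverse s))) \<longlonglongrightarrow> exp (- (0 * inverse s))"
    by (intro tendsto_intros LIMSEQ_inverse_real_of_nat)
  then show ?thesis
    using assms by (simp add: flat_def inverse_mult_distrib)
qed

lemma box_bump_tendsto: "(\<lambda>n. box_bump a b (real (Suc n)) x) \<longlonglongrightarrow> indicator (box a b) x"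
proof (cases "x \<in> box a b")
  case True
  have eq: "box_bump a b (real (Suc n)) x =
     (\<Prod>i\<in>Basis. flat 1 (real (Suc n) * (x \<bullet> i - a \<bullet> i)) * flat 1 (real (Suc n) * (b \<bullet> i - x \<bullet> i)))" for n
    unfolding box_bump_def by (intro prod.cong refl arg_cong2[where f="(*)"] arg_cong[where f="flat 1"])
      (auto simp: inner_commute algebra_simps)
  have "(\<lambda>n. box_bump a b (real (Suc n)) x) \<longlonglongrightarrow> (\<Prod>i\<in>(Basis::'a set). 1 * 1)"
    unfolding eq using True by (intro tendsto_prod tendsto_mult flat_one_tendsto) (auto simp: mem_box)
  then show ?thesis using True by simp
next
  case False
  then show ?thesis by (simp add: box_bump_outside)
qed

text \<open>
  Bumps approximate the indicator of a box, so the integral of \<open>f\<close> over every box in \<open>\<Omega>\<close> vanishes;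
  by Lebesgue differentiation along shrinking boxes \<open>f\<close> is zero almost everywhere.
\<close>
lemma fundamental_lemma:
  fixes f :: "'a::euclidean_space \<Rightarrow> real"
  assumes "open \<Omega>" and f: "integrable lborel f"
    and zero: "\<And>a b c. cbox a b \<subseteq> \<Omega> \<Longrightarrow> 0 < c \<Longrightarrow> (LINT x|lborel. f x * box_bump a b c x) = 0"
  shows "AE x in lborel. x \<in> \<Omega> \<longrightarrow> f x = 0"
proof -
  have box0: "integral (cbox a b) f = 0" if ab: "cbox a b \<subseteq> \<Omega>" for a b
  proof -
    have [measurable]: "f \<in> borel_measurable lborel"
      using f by simp
    have "continuous_on UNIV (box_bump a b c)" for c :: real
      using smooth_box_bump[of a b c] by (metis C_k.simps(1) smooth_def)
    then have [measurable]: "box_bump a b c \<in> borel_measurable lborel" for c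
      by (simp add: borel_measurable_continuous_onI)
    have "(\<lambda>n. LINT x|lborel. f x * box_bump a b (real (Suc n)) x)
        \<longlonglongrightarrow> (LINT x|lborel. f x * indicator (box a b) x)"
    proof (rule integral_dominated_convergence)
      show "integrable lborel (\<lambda>x. norm (f x))"
        using f by simp
      show "AE x in lborel. (\<lambda>n. f x * box_bump a b (real (Suc n)) x) \<longlonglongrightarrow> f x * indicator (box a b) x"
        by (intro AE_I2 tendsto_mult tendsto_const box_bump_tendsto)
      show "AE x in lborel. norm (f x * box_bump a b (real (Suc n)) x) \<le> norm (f x)" for n
        by (simp add: abs_mult box_bump_nonneg box_bump_le_1 mult_left_le)
    qed auto
    then have "(LINT x|lborel. f x * indicator (box a b) x) = 0"
      using zero[OF ab] by (simp add: LIMSEQ_const_iff)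
    moreover have "set_integrable lborel (box a b) f"
      unfolding set_integrable_def using f by (intro integrable_mult_indicator) auto
    ultimately have "integral (box a b) f = 0"
      by (simp add: set_borel_integral_eq_integral(2)[symmetric] set_lebesgue_integral_def mult.commute)
    then show ?thesis
      by (simp add: integral_open_interval)
  qed
  have "f integrable_on cbox a b" for a b
    by (intro set_borel_integral_eq_integral(1), unfold set_integrable_def, intro integrable_mult_indicator)
      (use f in auto)
  from integrable_ccontinuous_explicit[OF this] obtain N where N: "negligible N"
    and conv: "\<And>x e. \<lbrakk>x \<notin> N; 0 < e\<rbrakk> \<Longrightarrow> \<exists>d>0. \<forall>h. 0 < h \<and> h < d \<longrightarrow>
        norm (integral (cbox x (x + h *\<^sub>R One)) f /\<^sub>R h ^ DIM('a) - f x) < e"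
    by metis
  have "f x = 0" if x: "x \<in> \<Omega>" "x \<notin> N" for x
  proof (rule ccontr)
    assume "f x \<noteq> 0"
    then obtain d where d: "d > 0" "\<And>h. 0 < h \<Longrightarrow> h < d \<Longrightarrow>
        norm (integral (cbox x (x + h *\<^sub>R One)) f /\<^sub>R h ^ DIM('a) - f x) < norm (f x)"
      using conv[OF x(2), of "norm (f x)"] by auto
    obtain r where r: "r > 0" "cball x r \<subseteq> \<Omega>"
      using \<open>open \<Omega>\<close> x(1) open_contains_cball by blast
    define h where "h = min (d / 2) (r / DIM('a))"
    have h: "0 < h" "h < d" "h * DIM('a) \<le> r"
      using d(1) r(1) by (auto simp: h_def min_def field_simps)
    have "cbox x (x + h *\<^sub>R One) \<subseteq> cball x r"
    proof
      fix y assume y: "y \<in> cbox x (x + h *\<^sub>R One)"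
      have "norm (y - x) \<le> (\<Sum>i\<in>Basis. \<bar>(y - x) \<bullet> i\<bar>)"
        by (rule norm_le_l1)
      also have "\<dots> \<le> (\<Sum>i\<in>(Basis::'a set). h)"
        using y by (intro sum_mono) (fastforce simp: mem_box inner_diff_left inner_add_left)
      finally show "y \<in> cball x r"
        using h(3) by (simp add: dist_norm norm_minus_commute mult.commute)
    qed
    then show False
      using box0[of x "x + h *\<^sub>R One"] r(2) d(2)[OF h(1,2)] by auto
  qed
  moreover have "AE x in lborel. x \<notin> N"
    using AE_not_in[of N lebesgue] N by (simp add: negligible_iff_null_sets AE_completion_iff)
  ultimately show ?thesis
    by (auto elim: eventually_mono)
qed

section \<open>Square-integrable functions\<close>

lemma L2_I:
  assumes "f \<in> borel_measurable M" "g \<in> borel_measurable M" "integrable M g"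
    "AE x in M. (norm (f x))\<^sup>2 \<le> g x"
  shows "f \<in> L2 M"
proof -
  have "integrable M (\<lambda>x. (norm (f x))\<^sup>2)"
    using assms by (intro Bochner_Integration.integrable_bound[OF assms(3)]) (auto elim!: eventually_mono)
  with assms(1) show ?thesis by (simp add: L2_def)
qed

lemma norm_add_square_le:
  fixes a b :: "'b::real_normed_vector"
  shows "(norm (a + b))\<^sup>2 \<le> 2 * (norm a)\<^sup>2 + 2 * (norm b)\<^sup>2"
proof -
  have "(norm (a + b))\<^sup>2 \<le> (norm a + norm b)\<^sup>2"
    by (intro power_mono norm_triangle_ineq norm_ge_zero)
  also have "\<dots> \<le> 2 * (norm a)\<^sup>2 + 2 * (norm b)\<^sup>2"
    using sum_squares_bound[of "norm a" "norm b"] by (simp add: power2_sum)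
  finally show ?thesis .
qed

lemma norm_diff_square_le:
  fixes a b :: "'b::real_normed_vector"
  shows "(norm (a - b))\<^sup>2 \<le> 2 * (norm a)\<^sup>2 + 2 * (norm b)\<^sup>2"
  using norm_add_square_le[of a "- b"] by simp

lemma L2_integrable_norm: "f \<in> L2 M \<Longrightarrow> integrable M (\<lambda>x. (norm (f x))\<^sup>2)"
  by (simp add: L2_def)

lemma L2_scaleR:
  assumes "f \<in> L2 M" "(c :: 'a \<Rightarrow> real) \<in> borel_measurable M" "AE x in M. \<bar>c x\<bar> \<le> K"
  shows "(\<lambda>x. c x *\<^sub>R f x) \<in> L2 M"
proof (rule L2_I)
  show "AE x in M. (norm (c x *\<^sub>R f x))\<^sup>2 \<le> K\<^sup>2 * (norm (f x))\<^sup>2"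
    using assms(3)
  proof eventually_elim
    case (elim x)
    then have "\<bar>c x\<bar>\<^sup>2 \<le> K\<^sup>2"
      by (intro power_mono) auto
    then show ?case
      by (simp add: power_mult_distrib mult_right_mono)
  qed
qed (use assms in \<open>auto simp: L2_def\<close>)

lemma L2_diff:
  assumes "f \<in> L2 M" "g \<in> L2 M"
  shows "(\<lambda>x. f x - g x) \<in> L2 M"
  by (rule L2_I[of _ _ "\<lambda>x. 2 * (norm (f x))\<^sup>2 + 2 * (norm (g x))\<^sup>2"])
    (use assms norm_diff_square_le in \<open>auto simp: L2_def\<close>)

lemma L2_integrable_inner:
  assumes "f \<in> L2 M" "g \<in> L2 M"
  shows "integrable M (\<lambda>x. f x \<bullet> g x)"
proof (rule Bochner_Integration.integrable_bound)
  show "integrable M (\<lambda>x. (norm (f x))\<^sup>2 + (norm (g x))\<^sup>2)"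
    using assms by (auto simp: L2_def)
  show "AE x in M. norm (f x \<bullet> g x) \<le> norm ((norm (f x))\<^sup>2 + (norm (g x))\<^sup>2)"
  proof (rule AE_I2)
    fix x
    have "\<bar>f x \<bullet> g x\<bar> \<le> norm (f x) * norm (g x)"
      by (rule Cauchy_Schwarz_ineq2)
    also have "\<dots> \<le> (norm (f x))\<^sup>2 + (norm (g x))\<^sup>2"
      using sum_squares_bound[of "norm (f x)" "norm (g x)"] mult_nonneg_nonneg[OF norm_ge_zero norm_ge_zero, of "f x" "g x"]
      by linarith
    finally show "norm (f x \<bullet> g x) \<le> norm ((norm (f x))\<^sup>2 + (norm (g x))\<^sup>2)"
      by simp
  qed
qed (use assms in \<open>auto simp: L2_def\<close>)

lemma L2_scaleR_le:
  assumes "f \<in> L2 M" "(c :: 'a \<Rightarrow> real) \<in> borel_measurable M" "AE x in M. \<bar>c x\<bar> \<le> K"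
  shows "(LINT x|M. (norm (c x *\<^sub>R f x))\<^sup>2) \<le> K\<^sup>2 * (LINT x|M. (norm (f x))\<^sup>2)"
proof -
  have "(LINT x|M. (norm (c x *\<^sub>R f x))\<^sup>2) \<le> (LINT x|M. K\<^sup>2 * (norm (f x))\<^sup>2)"
  proof (rule integral_mono_AE)
    show "AE x in M. (norm (c x *\<^sub>R f x))\<^sup>2 \<le> K\<^sup>2 * (norm (f x))\<^sup>2"
      using assms(3)
    proof eventually_elim
      case (elim x)
      then have "\<bar>c x\<bar>\<^sup>2 \<le> K\<^sup>2"
        by (intro power_mono) auto
      then show ?case
        by (simp add: power_mult_distrib mult_right_mono)
    qed
  qed (use assms L2_integrable_norm[OF L2_scaleR[OF assms]] in \<open>auto simp: L2_def\<close>)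
  then show ?thesis by simp
qed

lemma L2_diff_le:
  assumes "f \<in> L2 M" "g \<in> L2 M"
  shows "(LINT x|M. (norm (f x - g x))\<^sup>2) \<le> 2 * (LINT x|M. (norm (f x))\<^sup>2) + 2 * (LINT x|M. (norm (g x))\<^sup>2)"
proof -
  have "(LINT x|M. (norm (f x - g x))\<^sup>2) \<le> (LINT x|M. 2 * (norm (f x))\<^sup>2 + 2 * (norm (g x))\<^sup>2)"
    using assms L2_integrable_norm[OF L2_diff[OF assms]]
    by (intro integral_mono norm_diff_square_le) (auto simp: L2_def)
  also have "\<dots> = 2 * (LINT x|M. (norm (f x))\<^sup>2) + 2 * (LINT x|M. (norm (g x))\<^sup>2)"
    using assms by (simp add: L2_def)
  finally show ?thesis .
qed

text \<open>
  The usual discriminant argument: \<open>\<integral>\<bar>f - t g\<bar>\<^sup>2\<close> is a nonnegative quadratic polynomial in \<open>t\<close>.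
\<close>
lemma L2_Cauchy_Schwarz:
  assumes f: "f \<in> L2 M" and g: "g \<in> L2 M"
  shows "(LINT x|M. f x \<bullet> g x)\<^sup>2 \<le> (LINT x|M. (norm (f x))\<^sup>2) * (LINT x|M. (norm (g x))\<^sup>2)"
    (is "?C\<^sup>2 \<le> ?A * ?B")
proof -
  have quad: "0 \<le> ?A - 2 * t * ?C + t\<^sup>2 * ?B" for t
  proof -
    have "0 \<le> (LINT x|M. (norm (f x - t *\<^sub>R g x))\<^sup>2)"
      by simp
    also have "(LINT x|M. (norm (f x - t *\<^sub>R g x))\<^sup>2) =
        (LINT x|M. (norm (f x))\<^sup>2 - (2 * t) * (f x \<bullet> g x) + t\<^sup>2 * (norm (g x))\<^sup>2)"
      by (intro Bochner_Integration.integral_cong refl)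
        (simp only: power2_norm_eq_inner,
          simp add: inner_diff_left inner_diff_right inner_commute algebra_simps power2_eq_square)
    also have "\<dots> = ?A - 2 * t * ?C + t\<^sup>2 * ?B"
      using L2_integrable_norm[OF f] L2_integrable_norm[OF g] L2_integrable_inner[OF f g] by simp
    finally show ?thesis .
  qed
  have B: "0 \<le> ?B" by simp
  show ?thesis
  proof (cases "?B = 0")
    case True
    have "?C = 0"
    proof (rule ccontr)
      assume "?C \<noteq> 0"
      then show False
        using quad[of "(?A + 1) / (2 * ?C)"] True by (simp add: field_simps)
    qed
    then show ?thesis using True by simp
  next
    case False
    then have "?B > 0" using B by linarith
    then have "(?C / ?B)\<^sup>2 * ?B = ?C\<^sup>2 / ?B" "2 * (?C / ?B) * ?C = 2 * (?C\<^sup>2 / ?B)"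
      by (simp_all add: power2_eq_square)
    with quad[of "?C / ?B"] have "?C\<^sup>2 / ?B \<le> ?A"
      by linarith
    then show ?thesis
      using \<open>?B > 0\<close> by (simp only: pos_divide_le_eq)
  qed
qed

lemma L2_inner_tendsto:
  assumes f: "\<And>n. f n \<in> L2 M" and F: "F \<in> L2 M" and g: "g \<in> L2 M"
    and lim: "(\<lambda>n. LINT x|M. (norm (f n x - F x))\<^sup>2) \<longlonglongrightarrow> 0"
  shows "(\<lambda>n. LINT x|M. f n x \<bullet> g x) \<longlonglongrightarrow> (LINT x|M. F x \<bullet> g x)"
proof -
  define B where "B = (LINT x|M. (norm (g x))\<^sup>2)"
  have "(\<lambda>n. sqrt ((LINT x|M. (norm (f n x - F x))\<^sup>2) * B)) \<longlonglongrightarrow> sqrt (0 * B)"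
    by (intro tendsto_intros lim)
  then have null: "(\<lambda>n. sqrt ((LINT x|M. (norm (f n x - F x))\<^sup>2) * B)) \<longlonglongrightarrow> 0"
    by simp
  have le: "norm ((LINT x|M. f n x \<bullet> g x) - (LINT x|M. F x \<bullet> g x))
      \<le> sqrt ((LINT x|M. (norm (f n x - F x))\<^sup>2) * B)" for n
  proof -
    have "(LINT x|M. f n x \<bullet> g x) - (LINT x|M. F x \<bullet> g x) = (LINT x|M. (f n x - F x) \<bullet> g x)"
      using L2_integrable_inner[OF f g] L2_integrable_inner[OF F g] by (simp add: inner_diff_left)
    then show ?thesis
      using L2_Cauchy_Schwarz[OF L2_diff[OF f F] g, of n] unfolding B_def
      by (intro real_le_rsqrt) simp
  qed
  have "(\<lambda>n. (LINT x|M. f n x \<bullet> g x) - (LINT x|M. F x \<bullet> g x)) \<longlonglongrightarrow> 0"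
    by (rule Lim_null_comparison[OF _ null]) (rule always_eventually, rule allI, rule le)
  then show ?thesis by (rule LIM_zero_cancel)
qed

text \<open>
  Along a subsequence with \<open>\<integral>\<bar>f (s (n+1)) - f (s n)\<bar>\<^sup>2 < 4\<^sup>-\<^sup>n\<close> the series
  \<open>\<Sum> 2\<^sup>n \<bar>f (s (n+1)) - f (s n)\<bar>\<^sup>2\<close> has finite integral, hence is finite almost everywhere. Its terms
  are then bounded, so the increments decay geometrically and the subsequence converges pointwise.
  Fatou's lemma turns this into convergence in $L^2$ of the whole sequence.
\<close>
lemma L2_complete:
  fixes f :: "nat \<Rightarrow> 'a \<Rightarrow> 'b::euclidean_space"
  assumes f: "\<And>n. f n \<in> L2 M"
    and Cauchy: "\<And>e. e > 0 \<Longrightarrow> \<exists>N. \<forall>i\<ge>N. \<forall>j\<ge>N. (LINT x|M. (norm (f i x - f j x))\<^sup>2) < e"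
  obtains F where "F \<in> L2 M" "(\<lambda>n. LINT x|M. (norm (f n x - F x))\<^sup>2) \<longlonglongrightarrow> 0"
proof -
  have [measurable]: "f n \<in> borel_measurable M" for n
    using f by (simp add: L2_def)
  have nn: "(\<integral>\<^sup>+x. ennreal ((norm (f i x - f j x))\<^sup>2) \<partial>M) = ennreal (LINT x|M. (norm (f i x - f j x))\<^sup>2)" for i j
    using L2_integrable_norm[OF L2_diff[OF f f]] by (intro nn_integral_eq_integral) auto
  have "\<forall>n. \<exists>N. \<forall>i\<ge>N. \<forall>j\<ge>N. (LINT x|M. (norm (f i x - f j x))\<^sup>2) < (1/4) ^ n"
    by (intro allI Cauchy) simp
  then obtain N where N: "\<And>n i j. N n \<le> i \<Longrightarrow> N n \<le> j \<Longrightarrow> (LINT x|M. (norm (f i x - f j x))\<^sup>2) < (1/4) ^ n"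
    by (auto dest!: choice)
  \<comment> \<open>Partial sums make the indices monotone, so that \<open>s n\<close> lies beyond \<open>N m\<close> for all \<open>m \<le> n\<close>.\<close>
  define s where "s n = (\<Sum>k\<le>n. N k)" for n
  have s: "N m \<le> s n" if "m \<le> n" for m n
    unfolding s_def using that by (intro member_le_sum) auto
  define d where "d n x = f (s (Suc n)) x - f (s n) x" for n x
  have [measurable]: "d n \<in> borel_measurable M" for n
    by (simp add: d_def[abs_def])
  have "(\<integral>\<^sup>+x. (\<Sum>n. ennreal (2 ^ n) * ennreal ((norm (d n x))\<^sup>2)) \<partial>M)
      = (\<Sum>n. ennreal (2 ^ n) * (\<integral>\<^sup>+x. ennreal ((norm (d n x))\<^sup>2) \<partial>M))"
    by (subst nn_integral_suminf) (auto simp: nn_integral_cmult)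
  also have "\<dots> \<le> (\<Sum>n. ennreal ((1/2) ^ n))"
  proof (intro suminf_le)
    fix n
    have "ennreal (2 ^ n) * (\<integral>\<^sup>+x. ennreal ((norm (d n x))\<^sup>2) \<partial>M) \<le> ennreal (2 ^ n) * ennreal ((1/4) ^ n)"
      unfolding d_def nn using N[OF s[of n "Suc n"] s[of n n]] by (intro mult_left_mono ennreal_leI) auto
    also have "\<dots> = ennreal ((1/2) ^ n)"
      by (simp add: ennreal_mult[symmetric] power_mult_distrib[symmetric])
    finally show "ennreal (2 ^ n) * (\<integral>\<^sup>+x. ennreal ((norm (d n x))\<^sup>2) \<partial>M) \<le> ennreal ((1/2) ^ n)" .
  qed (rule summableI)+
  also have "\<dots> = ennreal (\<Sum>n. (1/2) ^ n)"
    by (intro suminf_ennreal2 summable_geometric) auto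
  also have "\<dots> < \<infinity>"
    by simp
  finally have "AE x in M. (\<Sum>n. ennreal (2 ^ n) * ennreal ((norm (d n x))\<^sup>2)) \<noteq> \<infinity>"
    by (intro nn_integral_noteq_infinite) auto
  then have conv: "AE x in M. (\<lambda>n. f (s n) x) \<longlonglongrightarrow> lim (\<lambda>n. f (s n) x)"
  proof eventually_elim
    case (elim x)
    then obtain K where K: "(\<Sum>n. ennreal (2 ^ n) * ennreal ((norm (d n x))\<^sup>2)) = ennreal K" "0 \<le> K"
      by (cases "\<Sum>n. ennreal (2 ^ n) * ennreal ((norm (d n x))\<^sup>2)") auto
    have bound: "norm (d n x) \<le> sqrt K * (1 / sqrt 2) ^ n" for n
    proof -
      have "ennreal (2 ^ n * (norm (d n x))\<^sup>2) \<le> ennreal K"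
        unfolding K(1)[symmetric] using sum_le_suminf[OF summableI, of "{n}" "\<lambda>n. ennreal (2 ^ n) * ennreal ((norm (d n x))\<^sup>2)"]
        by (simp add: ennreal_mult)
      then have "2 ^ n * (norm (d n x))\<^sup>2 \<le> K"
        using K(2) by simp
      then have "(norm (d n x))\<^sup>2 \<le> K / 2 ^ n"
        by (simp add: field_simps)
      then have "norm (d n x) \<le> sqrt (K / 2 ^ n)"
        by (rule real_le_rsqrt)
      then show ?thesis
        by (simp add: real_sqrt_divide real_sqrt_power power_divide)
    qed
    have "summable (\<lambda>n. sqrt K * (1 / sqrt 2) ^ n)"
      by (intro summable_mult summable_geometric) auto
    then have "summable (\<lambda>n. d n x)"
      by (rule summable_comparison_test') (use bound in auto)
    then have "convergent (\<lambda>n. \<Sum>i<n. d i x)"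
      by (simp add: summable_iff_convergent)
    then have "convergent (\<lambda>n. f (s n) x - f (s 0) x)"
      using sum_lessThan_telescope[of "\<lambda>n. f (s n) x"] by (simp add: d_def)
    then have "convergent (\<lambda>n. f (s n) x)"
      by (simp add: convergent_diff_const_right_iff)
    then show ?case
      by (simp add: convergent_LIMSEQ_iff)
  qed
  define F where "F x = lim (\<lambda>n. f (s n) x)" for x
  have [measurable]: "F \<in> borel_measurable M"
    unfolding F_def[abs_def] by measurable
  have le: "(\<integral>\<^sup>+x. ennreal ((norm (f i x - F x))\<^sup>2) \<partial>M) \<le> ennreal ((1/4) ^ n)" if "N n \<le> i" for i n
  proof -
    have "(\<integral>\<^sup>+x. ennreal ((norm (f i x - F x))\<^sup>2) \<partial>M)
        = (\<integral>\<^sup>+x. liminf (\<lambda>k. ennreal ((norm (f i x - f (s k) x))\<^sup>2)) \<partial>M)"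
    proof (rule nn_integral_cong_AE, use conv in eventually_elim)
      case (elim x)
      then have "(\<lambda>k. ennreal ((norm (f i x - f (s k) x))\<^sup>2)) \<longlonglongrightarrow> ennreal ((norm (f i x - F x))\<^sup>2)"
        unfolding F_def by (intro tendsto_intros tendsto_ennrealI)
      from lim_imp_Liminf[OF trivial_limit_sequentially this] show ?case
        by simp
    qed
    also have "\<dots> \<le> liminf (\<lambda>k. \<integral>\<^sup>+x. ennreal ((norm (f i x - f (s k) x))\<^sup>2) \<partial>M)"
      by (rule nn_integral_liminf) simp
    also have "\<dots> \<le> liminf (\<lambda>k::nat. ennreal ((1/4) ^ n))"
    proof (rule Liminf_mono)
      show "\<forall>\<^sub>F k in sequentially. (\<integral>\<^sup>+x. ennreal ((norm (f i x - f (s k) x))\<^sup>2) \<partial>M) \<le> ennreal ((1/4) ^ n)"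
        using eventually_ge_at_top[of n]
      proof eventually_elim
        case (elim k)
        then show ?case
          unfolding nn using N[OF that s[OF elim]] by (intro ennreal_leI) simp
      qed
    qed
    also have "\<dots> = ennreal ((1/4) ^ n)"
      by (simp add: Liminf_const)
    finally show ?thesis .
  qed
  have diff: "(\<lambda>x. f i x - F x) \<in> L2 M" if "N n \<le> i" for i n
  proof -
    have "integrable M (\<lambda>x. (norm (f i x - F x))\<^sup>2)"
      using le_less_trans[OF le[OF that] ennreal_less_top] by (intro integrableI_bounded) auto
    then show ?thesis by (simp add: L2_def)
  qed
  show ?thesis
  proof (rule that)
    have "(\<lambda>x. f (N 0) x - F x) \<in> L2 M"
      by (rule diff) (rule order_refl)
    from L2_diff[OF f[of "N 0"] this] show "F \<in> L2 M"
      by simp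
    show "(\<lambda>n. LINT x|M. (norm (f n x - F x))\<^sup>2) \<longlonglongrightarrow> 0"
    proof (rule LIMSEQ_I)
      fix e :: real assume "e > 0"
      then have "\<exists>n. (1/4) ^ n < e"
        by (intro real_arch_pow_inv) simp_all
      then obtain n where n: "(1/4) ^ n < e"
        by blast
      have "norm ((LINT x|M. (norm (f i x - F x))\<^sup>2) - 0) < e" if "N n \<le> i" for i
      proof -
        have "ennreal (LINT x|M. (norm (f i x - F x))\<^sup>2) \<le> ennreal ((1/4) ^ n)"
          using le[OF that] L2_integrable_norm[OF diff[OF that]]
          by (simp add: nn_integral_eq_integral)
        then show ?thesis using n by simp
      qed
      then show "\<exists>no. \<forall>i\<ge>no. norm ((LINT x|M. (norm (f i x - F x))\<^sup>2) - 0) < e"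
        by blast
    qed
  qed
qed

section \<open>Increments of weakly differentiable functions\<close>

lemma lborel_translate_eq: "distr lborel borel (\<lambda>x. x + c) = (lborel :: 'a::euclidean_space measure)"
proof -
  have "(\<lambda>x. x + c) = (+) c"
    by (auto simp: add.commute)
  then show ?thesis
    by (simp add: lborel_distr_plus)
qed

lemma nn_integral_lborel_translate:
  fixes f :: "'a::euclidean_space \<Rightarrow> ennreal"
  assumes [measurable]: "f \<in> borel_measurable borel"
  shows "(\<integral>\<^sup>+x. f (x + c) \<partial>lborel) = (\<integral>\<^sup>+x. f x \<partial>lborel)"
proof -
  have "(\<integral>\<^sup>+x. f x \<partial>lborel) = (\<integral>\<^sup>+x. f x \<partial>distr lborel borel (\<lambda>x. x + c))"
    by (simp add: lborel_translate_eq)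
  also have "\<dots> = (\<integral>\<^sup>+x. f (x + c) \<partial>lborel)"
    by (rule nn_integral_distr) auto
  finally show ?thesis ..
qed

lemma integral_lborel_translate:
  fixes f :: "'a::euclidean_space \<Rightarrow> 'b::euclidean_space"
  assumes [measurable]: "f \<in> borel_measurable borel"
  shows "(LINT x|lborel. f (x + c)) = (LINT x|lborel. f x)"
proof -
  have "(LINT x|lborel. f x) = (LINT x|distr lborel borel (\<lambda>x. x + c). f x)"
    by (simp add: lborel_translate_eq)
  also have "\<dots> = (LINT x|lborel. f (x + c))"
    by (rule integral_distr) auto
  finally show ?thesis ..
qed

lemma integrable_lborel_translate:
  fixes f :: "'a::euclidean_space \<Rightarrow> 'b::euclidean_space"
  assumes f: "integrable lborel f"
  shows "integrable lborel (\<lambda>x. f (x + c))"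
proof -
  have "integrable (distr lborel borel (\<lambda>x. x + c)) f"
    using f by (simp add: lborel_translate_eq)
  then show ?thesis
    by (rule integrable_distr[rotated]) auto
qed

lemma bounded_of_compact_support:
  fixes f :: "'a::topological_space \<Rightarrow> real"
  assumes "continuous_on UNIV f" "compact S" "\<And>x. x \<notin> S \<Longrightarrow> f x = 0"
  obtains K where "0 \<le> K" "\<And>x. \<bar>f x\<bar> \<le> K"
proof -
  have "bounded (f ` S)"
    using assms by (intro compact_imp_bounded compact_continuous_image) (auto intro: continuous_on_subset)
  then obtain K where K: "\<And>y. y \<in> f ` S \<Longrightarrow> norm y \<le> K"
    by (auto simp: bounded_iff)
  have "\<bar>f x\<bar> \<le> max K 0" for x
    using K assms(3) by (cases "x \<in> S") (force simp: max_def)+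
  then show ?thesis
    by (intro that[of "max K 0"]) auto
qed

lemma test_function_has_derivative:
  "\<phi> \<in> test_functions \<Omega> \<Longrightarrow> (\<phi> has_derivative frechet_derivative \<phi> (at x)) (at x)"
  by (rule C_k_has_derivative[of 0]) (simp add: test_functions_def smooth_def)

lemma test_function_continuous: "\<phi> \<in> test_functions \<Omega> \<Longrightarrow> continuous_on UNIV \<phi>"
  by (metis (no_types, lifting) C_k.simps(1) mem_Collect_eq smooth_def test_functions_def)

lemma frechet_derivative_sum_Basis:
  fixes \<phi> :: "'a::euclidean_space \<Rightarrow> real"
  assumes "\<phi> \<in> test_functions \<Omega>"
  shows "frechet_derivative \<phi> (at x) h = (\<Sum>i\<in>Basis. (h \<bullet> i) * frechet_derivative \<phi> (at x) i)"
proof -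
  have lin: "linear (frechet_derivative \<phi> (at x))"
    using test_function_has_derivative[OF assms] by (rule has_derivative_linear)
  have "frechet_derivative \<phi> (at x) h = frechet_derivative \<phi> (at x) (\<Sum>i\<in>Basis. (h \<bullet> i) *\<^sub>R i)"
    by (simp add: euclidean_representation)
  then show ?thesis
    by (simp add: linear_sum[OF lin] linear_scale[OF lin])
qed

lemma test_function_derivative_continuous:
  assumes "\<phi> \<in> test_functions \<Omega>"
  shows "continuous_on UNIV (\<lambda>x. frechet_derivative \<phi> (at x) h)"
proof -
  have "C_k (Suc 0) \<phi>"
    using assms by (simp only: test_functions_def smooth_def mem_Collect_eq)
  then have "continuous_on UNIV (\<lambda>x. frechet_derivative \<phi> (at x) i)" if "i \<in> Basis" for i
    using that by simp
  then show ?thesis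
    unfolding frechet_derivative_sum_Basis[OF assms, of _ h] by (intro continuous_intros)
qed

text \<open>
  \<open>\<phi>\<close> vanishes on the complement of its support, which is open.
\<close>
lemma test_function_derivative_outside:
  assumes "\<phi> \<in> test_functions \<Omega>" "x \<notin> closure {x. \<phi> x \<noteq> 0}"
  shows "frechet_derivative \<phi> (at x) = (\<lambda>_. 0)"
proof (rule frechet_derivative_eqI)
  show "(\<phi> has_derivative (\<lambda>_. 0)) (at x)"
    by (rule has_derivative_transform_within_open[of "\<lambda>_. 0" _ _ _ "- closure {x. \<phi> x \<noteq> 0}"])
      (use assms(2) closure_subset[of "{x. \<phi> x \<noteq> 0}"] in auto)
qed

lemma test_function_compact: "\<phi> \<in> test_functions \<Omega> \<Longrightarrow> compact (closure {x. \<phi> x \<noteq> 0})"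
  by (simp add: test_functions_def)

lemma test_function_bounded:
  assumes "\<phi> \<in> test_functions \<Omega>"
  obtains K where "0 \<le> K" "\<And>x. \<bar>\<phi> x\<bar> \<le> K"
  by (rule bounded_of_compact_support[OF test_function_continuous[OF assms] test_function_compact[OF assms]])
    (use closure_subset[of "{x. \<phi> x \<noteq> 0}"] in auto)

lemma test_function_derivative_bounded:
  assumes "\<phi> \<in> test_functions \<Omega>"
  obtains K where "0 \<le> K" "\<And>x. \<bar>frechet_derivative \<phi> (at x) h\<bar> \<le> K"
  by (rule bounded_of_compact_support[OF test_function_derivative_continuous[OF assms] test_function_compact[OF assms]])
    (use test_function_derivative_outside[OF assms] in auto)

text \<open>
  A function of $H^1$ with its gradient, both replaced by Borel versions that vanish off \<open>\<Omega>\<close>. On these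
  the Lebesgue measure of the whole space can be used, whose translation invariance and product
  structure the arguments of this section need; Borel measurability makes \<open>(s, y) \<mapsto> G (y + s h)\<close>
  jointly measurable.
\<close>
definition H1_pair :: "'a::euclidean_space set \<Rightarrow> ('a \<Rightarrow> real) \<Rightarrow> ('a \<Rightarrow> 'a) \<Rightarrow> bool" where
  "H1_pair \<Omega> u G \<longleftrightarrow> u \<in> L2 lborel \<and> G \<in> L2 lborel \<and> (\<forall>x. x \<notin> \<Omega> \<longrightarrow> u x = 0 \<and> G x = 0) \<and>
     (\<forall>\<phi>\<in>test_functions \<Omega>. \<forall>i\<in>Basis.
        (LINT x|lborel. u x * frechet_derivative \<phi> (at x) i) = - (LINT x|lborel. (G x \<bullet> i) * \<phi> x))"

lemma L2_integrable_of_bounded_support: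
  fixes f :: "'a::euclidean_space \<Rightarrow> 'b::euclidean_space"
  assumes f: "f \<in> L2 lborel" and "bounded \<Omega>" "\<And>x. x \<notin> \<Omega> \<Longrightarrow> f x = 0"
  shows "integrable lborel f"
proof -
  obtain a where a: "\<Omega> \<subseteq> cbox (- a) a"
    using assms(2) bounded_subset_cbox_symmetric by blast
  have "integrable lborel (\<lambda>x. indicator (cbox (- a) a) x + (norm (f x))\<^sup>2)"
    using f by (intro Bochner_Integration.integrable_add integrable_real_indicator)
      (auto simp: L2_def intro: emeasure_bounded_finite[unfolded infinity_ennreal_def])
  then show ?thesis
  proof (rule Bochner_Integration.integrable_bound)
    show "AE x in lborel. norm (f x) \<le> norm (indicator (cbox (- a) a) x + (norm (f x))\<^sup>2)"
    proof (rule AE_I2)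
      fix x
      have "2 * norm (f x) \<le> 1 + (norm (f x))\<^sup>2"
        using sum_squares_bound[of 1 "norm (f x)"] by simp
      then have "norm (f x) \<le> 1 + (norm (f x))\<^sup>2"
        using norm_ge_zero[of "f x"] by linarith
      then show "norm (f x) \<le> norm (indicator (cbox (- a) a) x + (norm (f x))\<^sup>2)"
        using a assms(3)[of x] by (cases "x \<in> \<Omega>") (auto simp: indicator_def)
    qed
  qed (use f in \<open>simp add: L2_def\<close>)
qed

lemma integrable_mult_bounded:
  fixes f g :: "'a \<Rightarrow> real"
  assumes "integrable M f" "g \<in> borel_measurable M" "\<And>x. \<bar>g x\<bar> \<le> K"
  shows "integrable M (\<lambda>x. f x * g x)"
proof (rule Bochner_Integration.integrable_bound)
  show "integrable M (\<lambda>x. K * \<bar>f x\<bar>)"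
    using assms(1) by simp
  show "AE x in M. norm (f x * g x) \<le> norm (K * \<bar>f x\<bar>)"
  proof (rule AE_I2)
    fix x
    have "\<bar>g x\<bar> * \<bar>f x\<bar> \<le> K * \<bar>f x\<bar>"
      using assms(3) by (intro mult_right_mono) auto
    then show "norm (f x * g x) \<le> norm (K * \<bar>f x\<bar>)"
      using abs_ge_self[of "K * \<bar>f x\<bar>"] by (simp add: abs_mult mult.commute)
  qed
qed (use assms in auto)

lemma H1_pair_directional:
  assumes "H1_pair \<Omega> u G" "bounded \<Omega>" and \<phi>: "\<phi> \<in> test_functions \<Omega>"
  shows "(LINT x|lborel. u x * frechet_derivative \<phi> (at x) h) = - (LINT x|lborel. (G x \<bullet> h) * \<phi> x)"
proof -
  have u: "integrable lborel u" and G: "integrable lborel G"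
    using assms(1,2) by (auto simp: H1_pair_def intro!: L2_integrable_of_bounded_support)
  have d: "integrable lborel (\<lambda>x. u x * frechet_derivative \<phi> (at x) i)" for i
    by (rule test_function_derivative_bounded[OF \<phi>, of i])
      (auto intro!: integrable_mult_bounded u borel_measurable_continuous_onI test_function_derivative_continuous[OF \<phi>]
        simp del: measurable_lborel1 simp: measurable_lborel1)
  have g: "integrable lborel (\<lambda>x. (G x \<bullet> i) * \<phi> x)" for i
    by (rule test_function_bounded[OF \<phi>])
      (auto intro!: integrable_mult_bounded integrable_inner_left G borel_measurable_continuous_onI test_function_continuous[OF \<phi>])
  have "(LINT x|lborel. u x * frechet_derivative \<phi> (at x) h)
      = (LINT x|lborel. (\<Sum>i\<in>Basis. (h \<bullet> i) * (u x * frechet_derivative \<phi> (at x) i)))"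
    unfolding frechet_derivative_sum_Basis[OF \<phi>, of _ h] by (simp add: sum_distrib_left mult_ac)
  also have "\<dots> = (\<Sum>i\<in>Basis. (h \<bullet> i) * (LINT x|lborel. u x * frechet_derivative \<phi> (at x) i))"
    using d by simp
  also have "\<dots> = (\<Sum>i\<in>Basis. (h \<bullet> i) * - (LINT x|lborel. (G x \<bullet> i) * \<phi> x))"
    using assms(1) \<phi> by (intro sum.cong refl) (simp add: H1_pair_def)
  also have "\<dots> = - (LINT x|lborel. (\<Sum>i\<in>Basis. (h \<bullet> i) * ((G x \<bullet> i) * \<phi> x)))"
    using g by (simp add: sum_negf)
  also have "(\<lambda>x. \<Sum>i\<in>Basis. (h \<bullet> i) * ((G x \<bullet> i) * \<phi> x)) = (\<lambda>x. (G x \<bullet> h) * \<phi> x)"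
    by (simp add: euclidean_inner[of "G _" h] sum_distrib_left sum_distrib_right mult_ac)
  finally show ?thesis .
qed

lemma box_bump_translate: "box_bump a b c (x - v) = box_bump (a + v) (b + v) c x"
  unfolding box_bump_def by (simp add: inner_diff_right inner_add_left inner_commute algebra_simps)

text \<open>
  The form of Tonelli's criterion used for integrands that live on \<open>{0..1} \<times> UNIV\<close>.
\<close>
lemma integrable_unit_interval_pair:
  fixes f :: "real \<times> 'a::euclidean_space \<Rightarrow> real"
  assumes [measurable]: "f \<in> borel_measurable (lborel \<Otimes>\<^sub>M lborel)"
    and bound: "\<And>s. s \<in> {0..1} \<Longrightarrow> (\<integral>\<^sup>+x. ennreal (norm (f (s, x))) \<partial>lborel) \<le> ennreal C"
    and zero: "\<And>s x. s \<notin> {0..1} \<Longrightarrow> f (s, x) = 0"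
  shows "integrable (lborel \<Otimes>\<^sub>M lborel) f"
proof (rule integrableI_bounded)
  have "(\<integral>\<^sup>+p. ennreal (norm (f p)) \<partial>(lborel \<Otimes>\<^sub>M lborel))
      = (\<integral>\<^sup>+s. (\<integral>\<^sup>+x. ennreal (norm (f (s, x))) \<partial>lborel) \<partial>lborel)"
    by (subst lborel.nn_integral_fst[symmetric]) auto
  also have "\<dots> \<le> (\<integral>\<^sup>+s. ennreal C * indicator {0..1::real} s \<partial>lborel)"
  proof (rule nn_integral_mono)
    fix s :: real
    show "(\<integral>\<^sup>+x. ennreal (norm (f (s, x))) \<partial>lborel) \<le> ennreal C * indicator {0..1::real} s"
      using bound[of s] zero[of s] by (cases "s \<in> {0..1}") auto
  qed
  also have "\<dots> = ennreal C"
    by (simp add: nn_integral_cmult)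
  also have "\<dots> < \<infinity>"
    by simp
  finally show "(\<integral>\<^sup>+p. ennreal (norm (f p)) \<partial>(lborel \<Otimes>\<^sub>M lborel)) < \<infinity>" .
qed simp

lemma integrable_pair_shifted_gradient:
  fixes G :: "'a::euclidean_space \<Rightarrow> 'a"
  assumes G: "integrable lborel G"
  shows "integrable (lborel \<Otimes>\<^sub>M lborel) (\<lambda>(s, y). indicator {0..1} s * (G (y + s *\<^sub>R h) \<bullet> h))"
proof (rule integrable_unit_interval_pair)
  have [measurable]: "G \<in> borel_measurable borel"
    using G by (auto dest!: borel_measurable_integrable)
  show "(\<lambda>(s, y). indicator {0..1} s * (G (y + s *\<^sub>R h) \<bullet> h)) \<in> borel_measurable (lborel \<Otimes>\<^sub>M lborel)"
    by measurable
  fix s :: real assume s: "s \<in> {0..1}"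
  have "(\<integral>\<^sup>+y. ennreal (norm (indicator {0..1} s * (G (y + s *\<^sub>R h) \<bullet> h))) \<partial>lborel)
      = (\<integral>\<^sup>+y. ennreal \<bar>G (y + s *\<^sub>R h) \<bullet> h\<bar> \<partial>lborel)"
    using s by simp
  also have "\<dots> = (\<integral>\<^sup>+y. ennreal \<bar>G y \<bullet> h\<bar> \<partial>lborel)"
    by (rule nn_integral_lborel_translate[where f="\<lambda>y. ennreal \<bar>G y \<bullet> h\<bar>"]) simp
  also have "\<dots> = ennreal (LINT y|lborel. \<bar>G y \<bullet> h\<bar>)"
    using G by (intro nn_integral_eq_integral) auto
  finally show "(\<integral>\<^sup>+y. ennreal (norm (case (s, y) of (s, y) \<Rightarrow> indicator {0..1} s * (G (y + s *\<^sub>R h) \<bullet> h))) \<partial>lborel)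
    \<le> ennreal (LINT y|lborel. \<bar>G y \<bullet> h\<bar>)"
    by simp
qed auto

text \<open>
  The weak form of \<open>u(y + h) - u(y) = \<integral>\<^sub>0\<^sup>1 G(y + s h) \<bullet> h ds\<close>. Moving the translation onto the bump
  \<open>\<phi>\<close> turns the increment of \<open>u\<close> into \<open>\<phi>(x - h) - \<phi>(x)\<close>, which the fundamental theorem of calculus
  writes as an integral over \<open>s\<close> of directional derivatives of translated bumps. The translated bumps are
  test functions on \<open>\<Omega>\<close>, because the support of \<open>\<phi>\<close> stays in \<open>\<Omega>\<close> along the whole segment, so the weak
  derivative applies for every \<open>s\<close>.
\<close>
lemma weak_increment_formula:
  fixes u :: "'a::euclidean_space \<Rightarrow> real"
  assumes pair: "H1_pair \<Omega> u G" and "bounded \<Omega>" and c: "0 < c"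
    and shift: "\<And>y s. y \<in> cbox a b \<Longrightarrow> s \<in> {0..1} \<Longrightarrow> y + s *\<^sub>R h \<in> \<Omega>"
  shows "(LINT y|lborel. (u (y + h) - u y - (LINT s|lborel. indicator {0..1} s * (G (y + s *\<^sub>R h) \<bullet> h)))
    * box_bump a b c y) = 0"
proof -
  define \<phi> where "\<phi> = box_bump a b c"
  define I :: "real \<Rightarrow> real" where "I = indicator {0..1}"
  define D where "D x = frechet_derivative \<phi> (at x) h" for x
  have [measurable]: "I \<in> borel_measurable borel"
    unfolding I_def by simp
  have u: "integrable lborel u" and G: "integrable lborel G"
    using pair \<open>bounded \<Omega>\<close> by (auto simp: H1_pair_def intro!: L2_integrable_of_bounded_support)
  have [measurable]: "u \<in> borel_measurable borel" "G \<in> borel_measurable borel"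
    using u G by (auto dest!: borel_measurable_integrable)
  have \<phi>: "\<phi> \<in> test_functions UNIV"
    unfolding \<phi>_def using c by (intro box_bump_test) auto
  have [measurable]: "\<phi> \<in> borel_measurable borel"
    using test_function_continuous[OF \<phi>] by (rule borel_measurable_continuous_onI)
  have D_cont: "continuous_on UNIV D"
    unfolding D_def using test_function_derivative_continuous[OF \<phi>] .
  then have [measurable]: "D \<in> borel_measurable borel"
    by (rule borel_measurable_continuous_onI)
  obtain K where K: "0 \<le> K" "\<And>x. \<bar>D x\<bar> \<le> K"
    using test_function_derivative_bounded[OF \<phi>, of h] unfolding D_def by blast
  have \<phi>1: "\<bar>\<phi> x\<bar> \<le> 1" for x
    unfolding \<phi>_def using box_bump_nonneg[of a b c x] box_bump_le_1[of a b c x] by linarith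
  have chain: "((\<lambda>x. \<phi> (x - v)) has_derivative frechet_derivative \<phi> (at (x - v))) (at x)" for x v
  proof -
    have "((\<lambda>x. x - v) has_derivative (\<lambda>x. x)) (at x)"
      by (auto intro!: derivative_eq_intros)
    from has_derivative_compose[OF this test_function_has_derivative[OF \<phi>]] show ?thesis
      by simp
  qed
  have FTC: "(LINT s|lborel. I s * D (x - s *\<^sub>R h)) = \<phi> x - \<phi> (x - h)" for x
  proof -
    have "((\<lambda>s. - \<phi> (x - s *\<^sub>R h)) has_real_derivative D (x - s *\<^sub>R h)) (at s)" for s
    proof -
      have "((\<lambda>s. - \<phi> (x - s *\<^sub>R h)) has_derivative
          (\<lambda>t. - frechet_derivative \<phi> (at (x - s *\<^sub>R h)) (- t *\<^sub>R h))) (at s)"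
        by (intro has_derivative_minus has_derivative_compose[OF _ test_function_has_derivative[OF \<phi>]])
          (auto intro!: derivative_eq_intros)
      moreover have "linear (frechet_derivative \<phi> (at (x - s *\<^sub>R h)))"
        using test_function_has_derivative[OF \<phi>] by (rule has_derivative_linear)
      then have "(\<lambda>t. - frechet_derivative \<phi> (at (x - s *\<^sub>R h)) (- t *\<^sub>R h)) = (*) (D (x - s *\<^sub>R h))"
        by (auto simp: D_def linear_scale linear_neg)
      ultimately show ?thesis
        by (simp add: has_field_derivative_def)
    qed
    moreover have "isCont (\<lambda>s. D (x - s *\<^sub>R h)) s" for s
      using D_cont by (intro continuous_at_compose[unfolded o_def, of s "\<lambda>s. x - s *\<^sub>R h" D] continuous_intros)
        (auto simp: continuous_on_eq_continuous_at)
    ultimately have "(LINT s|lborel. D (x - s *\<^sub>R h) * indicator {0..1} s) = - \<phi> (x - 1 *\<^sub>R h) - - \<phi> (x - 0 *\<^sub>R h)"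
      by (intro integral_FTC_Icc_real) auto
    then show ?thesis
      by (simp add: I_def mult.commute)
  qed
  have weak: "(LINT x|lborel. u x * D (x - s *\<^sub>R h)) = - (LINT y|lborel. (G (y + s *\<^sub>R h) \<bullet> h) * \<phi> y)"
    if s: "s \<in> {0..1}" for s
  proof -
    have eq: "(\<lambda>x. \<phi> (x - s *\<^sub>R h)) = box_bump (a + s *\<^sub>R h) (b + s *\<^sub>R h) c"
      unfolding \<phi>_def by (auto simp: box_bump_translate)
    have "cbox (a + s *\<^sub>R h) (b + s *\<^sub>R h) \<subseteq> \<Omega>"
    proof
      fix x assume "x \<in> cbox (a + s *\<^sub>R h) (b + s *\<^sub>R h)"
      then have "x - s *\<^sub>R h \<in> cbox a b"
        by (auto simp: mem_box inner_diff_left inner_add_left le_diff_eq diff_le_eq)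
      from shift[OF this s] show "x \<in> \<Omega>" by simp
    qed
    then have test: "(\<lambda>x. \<phi> (x - s *\<^sub>R h)) \<in> test_functions \<Omega>"
      unfolding eq using c by (intro box_bump_test)
    have "(LINT x|lborel. u x * D (x - s *\<^sub>R h)) = - (LINT x|lborel. (G x \<bullet> h) * \<phi> (x - s *\<^sub>R h))"
      using H1_pair_directional[OF pair \<open>bounded \<Omega>\<close> test, of h] frechet_derivative_eqI[OF chain]
      by (simp add: D_def)
    also have "(LINT x|lborel. (G x \<bullet> h) * \<phi> (x - s *\<^sub>R h)) = (LINT y|lborel. (G (y + s *\<^sub>R h) \<bullet> h) * \<phi> y)"
      by (subst integral_lborel_translate[where c="s *\<^sub>R h", symmetric]) auto
    finally show ?thesis .
  qed
  have int1: "integrable (lborel \<Otimes>\<^sub>M lborel) (\<lambda>(s, x). I s * (u x * D (x - s *\<^sub>R h)))"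
  proof (rule integrable_unit_interval_pair)
    show "(\<lambda>(s, x). I s * (u x * D (x - s *\<^sub>R h))) \<in> borel_measurable (lborel \<Otimes>\<^sub>M lborel)"
      by measurable
    fix s :: real assume s: "s \<in> {0..1}"
    have "(\<integral>\<^sup>+x. ennreal (norm (I s * (u x * D (x - s *\<^sub>R h)))) \<partial>lborel) \<le> (\<integral>\<^sup>+x. ennreal (K * \<bar>u x\<bar>) \<partial>lborel)"
      using s K(2) by (intro nn_integral_mono ennreal_leI) (simp add: I_def abs_mult mult.commute[of "\<bar>u _\<bar>"] mult_right_mono)
    also have "\<dots> = ennreal (LINT x|lborel. K * \<bar>u x\<bar>)"
      using u K(1) by (intro nn_integral_eq_integral) auto
    finally show "(\<integral>\<^sup>+x. ennreal (norm (case (s, x) of (s, x) \<Rightarrow> I s * (u x * D (x - s *\<^sub>R h)))) \<partial>lborel)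
      \<le> ennreal (LINT x|lborel. K * \<bar>u x\<bar>)"
      by simp
  qed (auto simp: I_def)
  have intG: "integrable (lborel \<Otimes>\<^sub>M lborel) (\<lambda>(s, y). I s * (G (y + s *\<^sub>R h) \<bullet> h))"
    unfolding I_def by (rule integrable_pair_shifted_gradient[OF G])
  have int2: "integrable (lborel \<Otimes>\<^sub>M lborel) (\<lambda>(s, y). I s * ((G (y + s *\<^sub>R h) \<bullet> h) * \<phi> y))"
  proof -
    have "integrable (lborel \<Otimes>\<^sub>M lborel) (\<lambda>p. (case p of (s, y) \<Rightarrow> I s * (G (y + s *\<^sub>R h) \<bullet> h)) * \<phi> (snd p))"
      by (rule integrable_mult_bounded[OF intG, of _ 1]) (use \<phi>1 in auto)
    then show ?thesis
      by (simp add: case_prod_unfold mult.assoc)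
  qed
  define V where "V y = (LINT s|lborel. I s * (G (y + s *\<^sub>R h) \<bullet> h))" for y
  have V: "integrable lborel V"
    unfolding V_def using lborel_pair.integrable_snd[OF intG] .
  have u\<phi>: "integrable lborel (\<lambda>y. u y * \<phi> (y + v))" for v
    by (rule integrable_mult_bounded[OF u, of _ 1]) (use \<phi>1 in auto)
  have u\<phi>': "integrable lborel (\<lambda>y. u (y + h) * \<phi> y)"
    by (rule integrable_mult_bounded[OF integrable_lborel_translate[OF u], of _ 1]) (use \<phi>1 in auto)
  have V\<phi>: "integrable lborel (\<lambda>y. V y * \<phi> y)"
    by (rule integrable_mult_bounded[OF V, of _ 1]) (use \<phi>1 in auto)
  have "(LINT y|lborel. u y * \<phi> y) - (LINT y|lborel. u (y + h) * \<phi> y)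
      = (LINT y|lborel. u y * \<phi> y) - (LINT x|lborel. u x * \<phi> (x - h))"
    by (subst (2) integral_lborel_translate[where c=h, symmetric]) auto
  also have "\<dots> = (LINT x|lborel. u x * (\<phi> x - \<phi> (x - h)))"
    using u\<phi>[of 0] u\<phi>[of "- h"] by (simp add: right_diff_distrib)
  also have "\<dots> = (LINT x|lborel. LINT s|lborel. I s * (u x * D (x - s *\<^sub>R h)))"
    by (simp add: FTC[symmetric] mult.left_commute[of _ "u _"])
  also have "\<dots> = (LINT s|lborel. LINT x|lborel. I s * (u x * D (x - s *\<^sub>R h)))"
    by (rule lborel_pair.Fubini_integral[OF int1])
  also have "\<dots> = (LINT s|lborel. - (LINT y|lborel. I s * ((G (y + s *\<^sub>R h) \<bullet> h) * \<phi> y)))"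
    by (rule Bochner_Integration.integral_cong[OF refl]) (use weak in \<open>auto simp: I_def indicator_def\<close>)
  also have "\<dots> = - (LINT y|lborel. LINT s|lborel. I s * ((G (y + s *\<^sub>R h) \<bullet> h) * \<phi> y))"
    using lborel_pair.Fubini_integral[OF int2] by simp
  also have "(LINT y|lborel. LINT s|lborel. I s * ((G (y + s *\<^sub>R h) \<bullet> h) * \<phi> y)) = (LINT y|lborel. V y * \<phi> y)"
    unfolding V_def by (simp add: mult.assoc[symmetric])
  finally have "(LINT y|lborel. u (y + h) * \<phi> y) - (LINT y|lborel. u y * \<phi> y) - (LINT y|lborel. V y * \<phi> y) = 0"
    by simp
  then have "(LINT y|lborel. (u (y + h) - u y - V y) * \<phi> y) = 0"
    using u\<phi>[of 0] u\<phi>' V\<phi> by (simp add: left_diff_distrib)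
  then show ?thesis
    by (simp add: V_def \<phi>_def I_def)
qed

lemma set_integral_square_le:
  fixes f :: "'a \<Rightarrow> real"
  assumes [measurable]: "f \<in> borel_measurable M" "A \<in> sets M"
  shows "ennreal ((LINT x|M. indicator A x * f x)\<^sup>2) \<le> emeasure M A * (\<integral>\<^sup>+x. indicator A x * ennreal ((f x)\<^sup>2) \<partial>M)"
proof (cases "integrable M (\<lambda>x. indicator A x * f x)")
  case True
  let ?I = "LINT x|M. indicator A x * f x"
  have "ennreal \<bar>?I\<bar> \<le> (\<integral>\<^sup>+x. ennreal \<bar>indicator A x * f x\<bar> \<partial>M)"
    using integral_norm_bound_ennreal[OF True] by simp
  also have "\<dots> = (\<integral>\<^sup>+x. indicator A x * ennreal \<bar>indicator A x * f x\<bar> \<partial>M)"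
    by (intro nn_integral_cong) (auto simp: indicator_def)
  finally have "(ennreal \<bar>?I\<bar>)\<^sup>2 \<le> (\<integral>\<^sup>+x. indicator A x * ennreal \<bar>indicator A x * f x\<bar> \<partial>M)\<^sup>2"
    by (intro power_mono) auto
  also have "\<dots> \<le> (\<integral>\<^sup>+x. (indicator A x)\<^sup>2 \<partial>M) * (\<integral>\<^sup>+x. (ennreal \<bar>indicator A x * f x\<bar>)\<^sup>2 \<partial>M)"
    by (rule Cauchy_Schwarz_nn_integral) auto
  also have "(\<integral>\<^sup>+x. (indicator A x)\<^sup>2 \<partial>M) = (\<integral>\<^sup>+x. indicator A x \<partial>M)"
    by (intro nn_integral_cong) (auto simp: indicator_def)
  also have "\<dots> = emeasure M A"
    by simp
  also have "(\<integral>\<^sup>+x. (ennreal \<bar>indicator A x * f x\<bar>)\<^sup>2 \<partial>M) = (\<integral>\<^sup>+x. indicator A x * ennreal ((f x)\<^sup>2) \<partial>M)"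
    by (intro nn_integral_cong) (auto simp: indicator_def ennreal_power)
  finally show ?thesis
    by (simp add: ennreal_power)
next
  case False
  then show ?thesis by (simp add: not_integrable_integral_eq)
qed

text \<open>
  By the fundamental lemma the increment formula holds almost everywhere in \<open>P\<close>. The rest is
  Cauchy-Schwarz on the unit interval, Tonelli, and translation invariance.
\<close>
lemma translation_estimate:
  fixes u :: "'a::euclidean_space \<Rightarrow> real"
  assumes pair: "H1_pair \<Omega> u G" and "bounded \<Omega>" and "open P"
    and shift: "\<And>y s. y \<in> P \<Longrightarrow> s \<in> {0..1} \<Longrightarrow> y + s *\<^sub>R h \<in> \<Omega>"
  shows "(\<integral>\<^sup>+y. indicator P y * ennreal ((u (y + h) - u y)\<^sup>2) \<partial>lborel)
    \<le> ennreal ((norm h)\<^sup>2) * (\<integral>\<^sup>+y. ennreal ((norm (G y))\<^sup>2) \<partial>lborel)"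
proof -
  have u: "integrable lborel u" and G: "integrable lborel G"
    using pair \<open>bounded \<Omega>\<close> by (auto simp: H1_pair_def intro!: L2_integrable_of_bounded_support)
  have [measurable]: "u \<in> borel_measurable borel" "G \<in> borel_measurable borel"
    using u G by (auto dest!: borel_measurable_integrable)
  define V where "V y = (LINT s|lborel. indicator {0..1} s * (G (y + s *\<^sub>R h) \<bullet> h))" for y
  have V: "integrable lborel V"
    unfolding V_def using lborel_pair.integrable_snd[OF integrable_pair_shifted_gradient[OF G]] .
  have "AE y in lborel. y \<in> P \<longrightarrow> u (y + h) - u y - V y = 0"
  proof (rule fundamental_lemma[OF \<open>open P\<close>])
    show "integrable lborel (\<lambda>y. u (y + h) - u y - V y)"
      using u V integrable_lborel_translate[OF u] by auto
    show "(LINT y|lborel. (u (y + h) - u y - V y) * box_bump a b c y) = 0" if "cbox a b \<subseteq> P" "0 < c" for a b c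
      unfolding V_def using that shift by (intro weak_increment_formula[OF pair \<open>bounded \<Omega>\<close>]) auto
  qed
  then have "(\<integral>\<^sup>+y. indicator P y * ennreal ((u (y + h) - u y)\<^sup>2) \<partial>lborel) \<le> (\<integral>\<^sup>+y. ennreal ((V y)\<^sup>2) \<partial>lborel)"
    by (intro nn_integral_mono_AE) (auto simp: indicator_def elim!: eventually_mono)
  also have "\<dots> \<le> (\<integral>\<^sup>+y. (\<integral>\<^sup>+s. indicator {0..1} s * ennreal ((G (y + s *\<^sub>R h) \<bullet> h)\<^sup>2) \<partial>lborel) \<partial>lborel)"
  proof (rule nn_integral_mono)
    fix y
    show "ennreal ((V y)\<^sup>2) \<le> (\<integral>\<^sup>+s. indicator {0..1} s * ennreal ((G (y + s *\<^sub>R h) \<bullet> h)\<^sup>2) \<partial>lborel)"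
      unfolding V_def using set_integral_square_le[of "\<lambda>s. G (y + s *\<^sub>R h) \<bullet> h" lborel "{0..1}"] by simp
  qed
  also have "\<dots> = (\<integral>\<^sup>+s. (\<integral>\<^sup>+y. indicator {0..1} s * ennreal ((G (y + s *\<^sub>R h) \<bullet> h)\<^sup>2) \<partial>lborel) \<partial>lborel)"
    by (rule lborel_pair.Fubini') measurable
  also have "\<dots> = (\<integral>\<^sup>+s. indicator {0..1::real} s * (\<integral>\<^sup>+y. ennreal ((G y \<bullet> h)\<^sup>2) \<partial>lborel) \<partial>lborel)"
    using nn_integral_lborel_translate[of "\<lambda>y. ennreal ((G y \<bullet> h)\<^sup>2)"]
    by (intro nn_integral_cong) (simp add: nn_integral_cmult)
  also have "\<dots> = (\<integral>\<^sup>+y. ennreal ((G y \<bullet> h)\<^sup>2) \<partial>lborel)"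
    by (simp add: nn_integral_multc)
  also have "\<dots> \<le> (\<integral>\<^sup>+y. ennreal ((norm h)\<^sup>2) * ennreal ((norm (G y))\<^sup>2) \<partial>lborel)"
  proof (rule nn_integral_mono)
    fix y
    have "\<bar>G y \<bullet> h\<bar>\<^sup>2 \<le> (norm (G y) * norm h)\<^sup>2"
      by (intro power_mono Cauchy_Schwarz_ineq2) simp
    then show "ennreal ((G y \<bullet> h)\<^sup>2) \<le> ennreal ((norm h)\<^sup>2) * ennreal ((norm (G y))\<^sup>2)"
      by (simp add: ennreal_mult[symmetric] power_mult_distrib mult.commute)
  qed
  also have "\<dots> = ennreal ((norm h)\<^sup>2) * (\<integral>\<^sup>+y. ennreal ((norm (G y))\<^sup>2) \<partial>lborel)"
    by (rule nn_integral_cmult) simp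
  finally show ?thesis .
qed

section \<open>Cones inside a Lipschitz domain\<close>

text \<open>
  At an interior point \<open>e = 0\<close> will do. Near a boundary point moving by \<open>t\<close> in the graph direction gains
  height \<open>t\<close>, whereas a further displacement \<open>w\<close> with \<open>\<bar>w\<bar> < c t\<close> loses at most \<open>c t\<close> in height and
  raises the graph by at most \<open>L c t\<close>; with \<open>c = 1 / (1 + L)\<close> the losses stay below the gain.
\<close>
lemma Lipschitz_domain_inner_cone:
  fixes \<Omega> :: "'a::euclidean_space set"
  assumes "bounded_Lipschitz_domain \<Omega>" "x \<in> closure \<Omega>"
  obtains r e c T where "0 < r" "0 < c" "0 < (T::real)"
    "\<And>y t. y \<in> \<Omega> \<inter> ball x r \<Longrightarrow> 0 < t \<Longrightarrow> t \<le> T \<Longrightarrow> ball (y + t *\<^sub>R e) (c * t) \<subseteq> \<Omega>"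
proof (cases "x \<in> \<Omega>")
  case True
  moreover have "open \<Omega>"
    using assms(1) by (simp add: bounded_Lipschitz_domain_def)
  ultimately obtain r where r: "0 < r" "ball x r \<subseteq> \<Omega>"
    using open_contains_ball by blast
  show ?thesis
  proof (rule that[of "r / 2" 1 "r / 2" 0])
    fix y t assume y: "y \<in> \<Omega> \<inter> ball x (r / 2)" and t: "t \<le> r / 2"
    have "ball y t \<subseteq> ball x r"
      using y t by (auto simp: subset_eq) (smt (verit) dist_triangle field_sum_of_halves)
    then show "ball (y + t *\<^sub>R 0) (1 * t) \<subseteq> \<Omega>"
      using r(2) by simp
  qed (use r in auto)
next
  case False
  then have "x \<in> frontier \<Omega>"
    using assms by (simp add: bounded_Lipschitz_domain_def frontier_def interior_open)
  then obtain r e L \<gamma> where r: "0 < r" and e: "norm e = 1"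
    and lip: "L-lipschitz_on {z. z \<bullet> e = 0} \<gamma>"
    and graph: "\<Omega> \<inter> ball x r = {y \<in> ball x r. y \<bullet> e > \<gamma> (y - (y \<bullet> e) *\<^sub>R e)}"
    using assms(1) unfolding bounded_Lipschitz_domain_def by blast
  have L: "0 \<le> L"
    using lip by (rule lipschitz_on_nonneg)
  have ee: "e \<bullet> e = 1"
    using e by (simp add: norm_eq_1)
  define c where "c = 1 / (1 + L)"
  have c: "0 < c" "c \<le> 1" "L * c + c = 1"
    using L by (auto simp: c_def field_simps)
  define p where "p z = z - (z \<bullet> e) *\<^sub>R e" for z
  have p0: "p z \<bullet> e = 0" for z
    by (simp add: p_def inner_diff_left ee)
  have p_le: "norm (p z) \<le> norm z" for z
  proof -
    have "z \<bullet> z = p z \<bullet> p z + (z \<bullet> e)\<^sup>2"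
      by (simp add: p_def inner_diff_left inner_diff_right ee inner_commute power2_eq_square)
    then have "(norm (p z))\<^sup>2 \<le> (norm z)\<^sup>2"
      by (simp add: power2_norm_eq_inner)
    then show ?thesis
      by (rule power2_le_imp_le) simp
  qed
  show ?thesis
  proof (rule that[of "r / 2" c "r / 4" e])
    fix y t assume y: "y \<in> \<Omega> \<inter> ball x (r / 2)" and t: "0 < t" "t \<le> r / 4"
    show "ball (y + t *\<^sub>R e) (c * t) \<subseteq> \<Omega>"
    proof
      fix z assume "z \<in> ball (y + t *\<^sub>R e) (c * t)"
      then have w: "norm (z - (y + t *\<^sub>R e)) < c * t"
        by (simp add: dist_norm norm_minus_commute)
      define w where "w = z - (y + t *\<^sub>R e)"
      have z: "z = y + t *\<^sub>R e + w"
        by (simp add: w_def)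
      have nw: "norm w < c * t"
        using w by (simp add: w_def)
      have ct: "c * t \<le> t"
        using c t by (simp add: mult_le_cancel_right1)
      have "dist x z \<le> dist x y + norm (t *\<^sub>R e) + norm w"
        unfolding z dist_norm
        using norm_triangle_ineq4[of "x - y" "t *\<^sub>R e + w"] norm_triangle_ineq[of "t *\<^sub>R e" w]
        by (simp add: algebra_simps)
      moreover have "dist x y < r / 2" "norm (t *\<^sub>R e) = t"
        using y t(1) e by auto
      ultimately have "dist x z < r"
        using t(2) nw ct by linarith
      then have zr: "z \<in> ball x r"
        by simp
      have "y \<in> \<Omega> \<inter> ball x r"
        using y r by auto
      then have gy: "\<gamma> (p y) < y \<bullet> e"
        unfolding graph p_def by simp
      have "p z - p y = p w"
        by (simp add: p_def z inner_add_left ee algebra_simps)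
      then have "\<bar>\<gamma> (p z) - \<gamma> (p y)\<bar> \<le> L * norm (p w)"
        using lipschitz_onD[OF lip, of "p z" "p y"] p0 by (simp add: dist_norm dist_real_def)
      also have "\<dots> \<le> L * (c * t)"
        using p_le[of w] nw L by (intro mult_left_mono) auto
      finally have gz: "\<gamma> (p z) \<le> \<gamma> (p y) + L * (c * t)"
        by linarith
      have "\<bar>w \<bullet> e\<bar> \<le> norm w"
        using Cauchy_Schwarz_ineq2[of w e] e by simp
      then have "z \<bullet> e \<ge> y \<bullet> e + t - c * t"
        using nw by (simp add: z inner_add_left ee)
      moreover have "L * (c * t) + c * t = t"
        using c(3) by (simp add: distrib_right[symmetric] mult.assoc[symmetric])
      ultimately have "\<gamma> (p z) < z \<bullet> e"
        using gz gy by linarith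
      then show "z \<in> \<Omega>"
        using zr graph by (auto simp: p_def)
    qed
  qed (use r c in auto)
qed

lemma H1_pair_measurable:
  assumes "H1_pair \<Omega> u G"
  shows "u \<in> borel_measurable borel" "G \<in> borel_measurable borel"
  using assms by (auto simp: H1_pair_def L2_def)

text \<open>
  Cover \<open>P\<close> by finitely many balls of radius \<open>\<rho> = c t / 2\<close>. If \<open>y\<close> lies in the ball about \<open>z\<close>, then
  every point of the shifted ball \<open>B z\<close> about \<open>z + t e\<close> is \<open>y + h\<close> with \<open>h\<close> in the fixed ball \<open>H\<close> of
  radius \<open>2 \<rho> = c t\<close> about \<open>t e\<close>. Hence \<open>u(y)\<close> differs from the mean of \<open>u\<close> over \<open>B z\<close> by an average of
  increments \<open>u(y + h) - u(y)\<close> with \<open>h\<close> in \<open>H\<close>. Integrating the squared increments over all of \<open>H\<close> gives a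
  bound that is the same for every \<open>z\<close> whose ball contains \<open>y\<close>. The power of 2 is the ratio of the volumes of \<open>H\<close> and \<open>B z\<close>. Increments
  with \<open>h\<close> in \<open>H\<close> satisfy the translation estimate, since the segment from \<open>y\<close> to \<open>y + h\<close> runs inside the
  cone at \<open>y\<close>.
\<close>
lemma patch_inequality:
  fixes e :: "'a::euclidean_space"
  assumes \<Omega>: "bounded \<Omega>" and P: "open P" "P \<subseteq> \<Omega>" and ct: "0 < c" "0 < t"
    and cone: "\<And>y s. y \<in> P \<Longrightarrow> 0 < s \<Longrightarrow> s \<le> t \<Longrightarrow> ball (y + s *\<^sub>R e) (c * s) \<subseteq> \<Omega>"
  obtains F C where "finite F" "0 \<le> (C::real)" "\<And>E. E \<in> F \<Longrightarrow> E \<in> sets borel \<and> bounded E"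
    "\<And>u G. H1_pair \<Omega> u G \<Longrightarrow> (\<integral>\<^sup>+y. indicator P y * ennreal ((u y)\<^sup>2) \<partial>lborel)
      \<le> ennreal (2 * 2 ^ DIM('a) * (t * (norm e + c))\<^sup>2) * (\<integral>\<^sup>+y. ennreal ((norm (G y))\<^sup>2) \<partial>lborel)
        + ennreal (C * (\<Sum>E\<in>F. (LINT x|lborel. indicator E x * u x)\<^sup>2))"
proof -
  define \<rho> where "\<rho> = c * t / 2"
  have \<rho>: "0 < \<rho>" "2 * \<rho> = c * t"
    using ct by (auto simp: \<rho>_def)
  have bP: "bounded P"
    using \<Omega> P(2) by (rule bounded_subset)
  then have "compact (closure P)"
    by (simp add: compact_closure)
  moreover have "closure P \<subseteq> (\<Union>z\<in>UNIV. ball z \<rho>)"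
    using \<rho>(1) centre_in_ball by blast
  ultimately obtain Z where Z: "finite Z" "closure P \<subseteq> (\<Union>z\<in>Z. ball z \<rho>)"
    using compactE_image[of "closure P" UNIV "\<lambda>z. ball z \<rho>"] by auto
  define B where "B z = ball (z + t *\<^sub>R e) \<rho>" for z
  define H where "H = ball (t *\<^sub>R e) (c * t)"
  define m where "m = unit_ball_vol (real DIM('a)) * \<rho> ^ DIM('a)"
  have m: "0 < m"
    using \<rho>(1) by (simp add: m_def)
  have mB: "emeasure lborel (B z) = ennreal m" for z
    using \<rho>(1) by (simp add: B_def m_def emeasure_ball)
  have mH: "emeasure lborel H = ennreal (2 ^ DIM('a) * m)"
    unfolding H_def \<rho>(2)[symmetric] using \<rho>(1) by (simp add: m_def emeasure_ball power_mult_distrib mult_ac)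
  have [measurable]: "B z \<in> sets borel" "H \<in> sets borel" "P \<in> sets borel" for z
    using P(1) by (auto simp: B_def H_def)
  define C where "C = 2 * measure lborel P / m\<^sup>2"
  show ?thesis
  proof (rule that[of "B ` Z" C])
    show "finite (B ` Z)" "0 \<le> C"
      using Z(1) by (auto simp: C_def)
    show "E \<in> sets borel \<and> bounded E" if "E \<in> B ` Z" for E
      using that by (auto simp: B_def)
    fix u G assume pair: "H1_pair \<Omega> u G"
    note [measurable] = H1_pair_measurable[OF pair]
    have u: "integrable lborel u"
      using pair \<Omega> by (auto simp: H1_pair_def intro!: L2_integrable_of_bounded_support)
    define S where "S = (\<Sum>E\<in>B ` Z. (LINT x|lborel. indicator E x * u x)\<^sup>2)"
    have S: "0 \<le> S"
      unfolding S_def by (intro sum_nonneg) simp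
    \<comment> \<open>\<open>A / m\<close> below is the mean of \<open>u\<close> over \<open>B z\<close>; the sum \<open>S\<close> dominates its square, whichever \<open>z\<close> was chosen.\<close>
    have pointwise: "ennreal ((u y)\<^sup>2) \<le>
        ennreal (2 / m) * (\<integral>\<^sup>+h. indicator H h * ennreal ((u (y + h) - u y)\<^sup>2) \<partial>lborel) + ennreal (2 / m\<^sup>2 * S)"
      if y: "y \<in> P" for y
    proof -
      obtain z where z: "z \<in> Z" "y \<in> ball z \<rho>"
        using y closure_subset[of P] Z(2) by blast
      define A where "A = (LINT x|lborel. indicator (B z) x * u x)"
      have AS: "A\<^sup>2 \<le> S"
        unfolding S_def A_def using Z(1) z(1) by (intro member_le_sum) auto
      have iu: "integrable lborel (\<lambda>x. indicator (B z) x * u x)"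
        using integrable_mult_indicator[OF _ u, of "B z"] by simp
      have ic: "integrable lborel (\<lambda>x. indicator (B z) x * u y)"
        by (intro integrable_mult_left integrable_real_indicator) (auto simp: mB)
      have "(LINT x|lborel. indicator (B z) x * (u x - u y)) = A - m * u y"
        using iu ic mB[of z] m by (simp add: right_diff_distrib A_def measure_def)
      then have "ennreal ((A - m * u y)\<^sup>2) \<le> ennreal m * (\<integral>\<^sup>+x. indicator (B z) x * ennreal ((u x - u y)\<^sup>2) \<partial>lborel)"
        using set_integral_square_le[of "\<lambda>x. u x - u y" lborel "B z"] by (simp add: mB)
      also have "(\<integral>\<^sup>+x. indicator (B z) x * ennreal ((u x - u y)\<^sup>2) \<partial>lborel)
          = (\<integral>\<^sup>+h. indicator (B z) (h + y) * ennreal ((u (h + y) - u y)\<^sup>2) \<partial>lborel)"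
        by (rule nn_integral_lborel_translate[where f="\<lambda>x. indicator (B z) x * ennreal ((u x - u y)\<^sup>2)", symmetric]) simp
      also have "\<dots> \<le> (\<integral>\<^sup>+h. indicator H h * ennreal ((u (y + h) - u y)\<^sup>2) \<partial>lborel)"
      proof (rule nn_integral_mono)
        fix h
        have "h \<in> H" if "h + y \<in> B z"
        proof -
          have "norm (h - t *\<^sub>R e) \<le> norm ((h + y) - (z + t *\<^sub>R e)) + norm (z - y)"
            using norm_triangle_ineq[of "(h + y) - (z + t *\<^sub>R e)" "z - y"] by (simp add: algebra_simps)
          also have "\<dots> < \<rho> + \<rho>"
            using that z(2) by (intro add_strict_mono) (simp_all add: B_def dist_norm norm_minus_commute)
          finally show ?thesis
            using \<rho>(2) by (simp add: H_def dist_norm norm_minus_commute)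
        qed
        then show "indicator (B z) (h + y) * ennreal ((u (h + y) - u y)\<^sup>2) \<le> indicator H h * ennreal ((u (y + h) - u y)\<^sup>2)"
          by (auto simp: indicator_def add.commute)
      qed
      finally have CS: "ennreal ((A - m * u y)\<^sup>2) \<le> ennreal m * (\<integral>\<^sup>+h. indicator H h * ennreal ((u (y + h) - u y)\<^sup>2) \<partial>lborel)"
        by (simp add: mult_left_mono)
      have "(u y)\<^sup>2 = ((A / m) - (A - m * u y) / m)\<^sup>2"
        using m by (simp add: diff_divide_distrib)
      also have "\<dots> \<le> 2 * (A / m)\<^sup>2 + 2 * ((A - m * u y) / m)\<^sup>2"
        using norm_diff_square_le[of "A / m" "(A - m * u y) / m"] unfolding real_norm_def power2_abs .
      also have "\<dots> \<le> 2 / m\<^sup>2 * (A - m * u y)\<^sup>2 + 2 / m\<^sup>2 * S"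
        using AS m by (simp add: power_divide divide_right_mono)
      finally have "ennreal ((u y)\<^sup>2) \<le> ennreal (2 / m\<^sup>2 * (A - m * u y)\<^sup>2 + 2 / m\<^sup>2 * S)"
        by (rule ennreal_leI)
      also have "\<dots> = ennreal (2 / m\<^sup>2) * ennreal ((A - m * u y)\<^sup>2) + ennreal (2 / m\<^sup>2 * S)"
        using m S by (simp add: ennreal_plus[symmetric] ennreal_mult[symmetric] del: ennreal_plus)
      also have "\<dots> \<le> ennreal (2 / m\<^sup>2) * (ennreal m * (\<integral>\<^sup>+h. indicator H h * ennreal ((u (y + h) - u y)\<^sup>2) \<partial>lborel)) + ennreal (2 / m\<^sup>2 * S)"
        by (intro add_right_mono mult_left_mono CS) simp
      also have "ennreal (2 / m\<^sup>2) * (ennreal m * (\<integral>\<^sup>+h. indicator H h * ennreal ((u (y + h) - u y)\<^sup>2) \<partial>lborel))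
          = ennreal (2 / m) * (\<integral>\<^sup>+h. indicator H h * ennreal ((u (y + h) - u y)\<^sup>2) \<partial>lborel)"
        using m by (simp add: mult.assoc[symmetric] ennreal_mult[symmetric] power2_eq_square)
      finally show ?thesis .
    qed
    define g where "g = (\<integral>\<^sup>+y. ennreal ((norm (G y))\<^sup>2) \<partial>lborel)"
    have shift: "(\<integral>\<^sup>+y. indicator P y * ennreal ((u (y + h) - u y)\<^sup>2) \<partial>lborel) \<le> ennreal ((t * (norm e + c))\<^sup>2) * g"
      if h: "h \<in> H" for h
    proof -
      have "y + s *\<^sub>R h \<in> \<Omega>" if y: "y \<in> P" and s: "s \<in> {0..1}" for y s
      proof (cases "s = 0")
        case True
        then show ?thesis using y P(2) by auto
      next
        case False
        have "norm (s *\<^sub>R (h - t *\<^sub>R e)) < c * (s * t)"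
          using h s False by (simp add: H_def dist_norm norm_minus_commute mult.left_commute)
        then have "y + s *\<^sub>R h \<in> ball (y + (s * t) *\<^sub>R e) (c * (s * t))"
          by (simp add: dist_norm algebra_simps norm_minus_commute)
        then show ?thesis
          using cone[OF y, of "s * t"] s ct(2) False by (auto simp: mult_le_cancel_right1)
      qed
      then have "(\<integral>\<^sup>+y. indicator P y * ennreal ((u (y + h) - u y)\<^sup>2) \<partial>lborel) \<le> ennreal ((norm h)\<^sup>2) * g"
        unfolding g_def by (intro translation_estimate[OF pair \<Omega> P(1)])
      also have "\<dots> \<le> ennreal ((t * (norm e + c))\<^sup>2) * g"
      proof (intro mult_right_mono ennreal_leI power_mono)
        have "norm h \<le> norm (t *\<^sub>R e) + norm (h - t *\<^sub>R e)"
          using norm_triangle_ineq[of "t *\<^sub>R e" "h - t *\<^sub>R e"] by simp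
        then show "norm h \<le> t * (norm e + c)"
          using h ct(2) by (simp add: H_def dist_norm norm_minus_commute algebra_simps)
      qed auto
      finally show ?thesis .
    qed
    have "(\<integral>\<^sup>+y. indicator P y * ennreal ((u y)\<^sup>2) \<partial>lborel)
      \<le> (\<integral>\<^sup>+y. ennreal (2 / m) * (indicator P y * (\<integral>\<^sup>+h. indicator H h * ennreal ((u (y + h) - u y)\<^sup>2) \<partial>lborel))
          + ennreal (2 / m\<^sup>2 * S) * indicator P y \<partial>lborel)"
      using pointwise by (intro nn_integral_mono) (auto simp: indicator_def)
    also have "\<dots> = ennreal (2 / m) * (\<integral>\<^sup>+y. indicator P y * (\<integral>\<^sup>+h. indicator H h * ennreal ((u (y + h) - u y)\<^sup>2) \<partial>lborel) \<partial>lborel)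
          + ennreal (2 / m\<^sup>2 * S) * emeasure lborel P"
      by (simp add: nn_integral_add nn_integral_cmult)
    also have "(\<integral>\<^sup>+y. indicator P y * (\<integral>\<^sup>+h. indicator H h * ennreal ((u (y + h) - u y)\<^sup>2) \<partial>lborel) \<partial>lborel)
      = (\<integral>\<^sup>+y. (\<integral>\<^sup>+h. indicator H h * (indicator P y * ennreal ((u (y + h) - u y)\<^sup>2)) \<partial>lborel) \<partial>lborel)"
      by (simp add: nn_integral_cmult[symmetric] mult.left_commute)
    also have "\<dots> = (\<integral>\<^sup>+h. (\<integral>\<^sup>+y. indicator H h * (indicator P y * ennreal ((u (y + h) - u y)\<^sup>2)) \<partial>lborel) \<partial>lborel)"
      by (rule lborel_pair.Fubini') measurable
    also have "\<dots> = (\<integral>\<^sup>+h. indicator H h * (\<integral>\<^sup>+y. indicator P y * ennreal ((u (y + h) - u y)\<^sup>2) \<partial>lborel) \<partial>lborel)"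
      by (simp add: nn_integral_cmult)
    also have "\<dots> \<le> (\<integral>\<^sup>+h. (ennreal ((t * (norm e + c))\<^sup>2) * g) * indicator H h \<partial>lborel)"
      using shift by (intro nn_integral_mono) (auto simp: indicator_def)
    also have "\<dots> = (ennreal ((t * (norm e + c))\<^sup>2) * g) * ennreal (2 ^ DIM('a) * m)"
      by (simp add: nn_integral_cmult mH)
    also have "ennreal (2 / m\<^sup>2 * S) * emeasure lborel P = ennreal (C * S)"
    proof -
      have "emeasure lborel P = ennreal (measure lborel P)"
        using emeasure_bounded_finite[OF bP] by (intro emeasure_eq_ennreal_measure) auto
      then show ?thesis
        using S m by (simp add: C_def ennreal_mult[symmetric] mult_ac)
    qed
    also have "ennreal (2 / m) * ((ennreal ((t * (norm e + c))\<^sup>2) * g) * ennreal (2 ^ DIM('a) * m))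
      = ennreal (2 / m * ((t * (norm e + c))\<^sup>2 * (2 ^ DIM('a) * m))) * g"
      using m by (subst (1 2) ennreal_mult) (auto simp: mult_ac)
    also have "2 / m * ((t * (norm e + c))\<^sup>2 * (2 ^ DIM('a) * m)) = 2 * 2 ^ DIM('a) * (t * (norm e + c))\<^sup>2"
      using m by simp
    finally show "(\<integral>\<^sup>+y. indicator P y * ennreal ((u y)\<^sup>2) \<partial>lborel)
      \<le> ennreal (2 * 2 ^ DIM('a) * (t * (norm e + c))\<^sup>2) * (\<integral>\<^sup>+y. ennreal ((norm (G y))\<^sup>2) \<partial>lborel)
        + ennreal (C * (\<Sum>E\<in>B ` Z. (LINT x|lborel. indicator E x * u x)\<^sup>2))"
      by (simp add: g_def S_def mult_left_mono)
  qed
qed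

section \<open>Rellich's inequality and its sequential form\<close>

lemma H1_pair_diff:
  assumes "H1_pair \<Omega> u G" "H1_pair \<Omega> v H" "bounded \<Omega>"
  shows "H1_pair \<Omega> (\<lambda>x. u x - v x) (\<lambda>x. G x - H x)"
proof -
  have int: "integrable lborel (\<lambda>x. w x * frechet_derivative \<phi> (at x) i)" "integrable lborel (\<lambda>x. (K x \<bullet> i) * \<phi> x)"
    if wK: "H1_pair \<Omega> w K" and \<phi>: "\<phi> \<in> test_functions \<Omega>" for w K \<phi> i
  proof -
    have w: "integrable lborel w" and K: "integrable lborel K"
      using wK \<open>bounded \<Omega>\<close> by (auto simp: H1_pair_def intro!: L2_integrable_of_bounded_support)
    obtain A where A: "\<And>x. \<bar>frechet_derivative \<phi> (at x) i\<bar> \<le> A"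
      using test_function_derivative_bounded[OF \<phi>, of i] by blast
    obtain B where B: "\<And>x. \<bar>\<phi> x\<bar> \<le> B"
      using test_function_bounded[OF \<phi>] by blast
    show "integrable lborel (\<lambda>x. w x * frechet_derivative \<phi> (at x) i)"
      by (rule integrable_mult_bounded[OF w _ A])
        (simp add: borel_measurable_continuous_onI[OF test_function_derivative_continuous[OF \<phi>]])
    show "integrable lborel (\<lambda>x. (K x \<bullet> i) * \<phi> x)"
      by (rule integrable_mult_bounded[OF integrable_inner_left[OF K] _ B])
        (simp add: borel_measurable_continuous_onI[OF test_function_continuous[OF \<phi>]])
  qed
  show ?thesis
    unfolding H1_pair_def
  proof (intro conjI allI impI ballI)
    show "(\<lambda>x. u x - v x) \<in> L2 lborel" "(\<lambda>x. G x - H x) \<in> L2 lborel"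
      using assms by (auto simp: H1_pair_def intro: L2_diff)
    show "(LINT x|lborel. (u x - v x) * frechet_derivative \<phi> (at x) i) = - (LINT x|lborel. ((G x - H x) \<bullet> i) * \<phi> x)"
      if "\<phi> \<in> test_functions \<Omega>" "i \<in> Basis" for \<phi> i
      using int[OF assms(1) that(1), of i] int[OF assms(2) that(1), of i] assms(1,2) that
      by (simp add: H1_pair_def left_diff_distrib inner_diff_left)
  qed (use assms in \<open>auto simp: H1_pair_def\<close>)
qed

text \<open>
  The radius does not depend on \<open>\<delta>\<close>: only the length \<open>t\<close> of the cones has to shrink with \<open>\<delta>\<close>. This lets
  the closure be covered before \<open>\<delta>\<close> is fixed.
\<close>
lemma local_Rellich_inequality:
  fixes \<Omega> :: "'a::euclidean_space set"
  assumes \<Omega>: "bounded_Lipschitz_domain \<Omega>" "x \<in> closure \<Omega>"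
  obtains r where "0 < r" "\<And>\<delta>. 0 < \<delta> \<Longrightarrow> \<exists>F C. finite F \<and> 0 \<le> (C::real) \<and> (\<forall>E\<in>F. E \<in> sets borel \<and> bounded E) \<and>
    (\<forall>u G. H1_pair \<Omega> u G \<longrightarrow> (\<integral>\<^sup>+y. indicator (\<Omega> \<inter> ball x r) y * ennreal ((u y)\<^sup>2) \<partial>lborel)
      \<le> ennreal \<delta> * (\<integral>\<^sup>+y. ennreal ((norm (G y))\<^sup>2) \<partial>lborel)
        + ennreal (C * (\<Sum>E\<in>F. (LINT x|lborel. indicator E x * u x)\<^sup>2)))"
proof -
  obtain r e c T where r: "0 < r" and c: "0 < c" and T: "0 < (T::real)"
    and cone: "\<And>y t. y \<in> \<Omega> \<inter> ball x r \<Longrightarrow> 0 < t \<Longrightarrow> t \<le> T \<Longrightarrow> ball (y + t *\<^sub>R e) (c * t) \<subseteq> \<Omega>"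
    by (rule Lipschitz_domain_inner_cone[OF \<Omega>]) (rule that)
  have bounded: "bounded \<Omega>" and op: "open (\<Omega> \<inter> ball x r)"
    using \<Omega> by (simp_all add: bounded_Lipschitz_domain_def open_Int)
  define a where "a = norm e + c"
  have a: "0 < a"
    using c norm_ge_zero[of e] by (simp add: a_def add_nonneg_pos)
  show ?thesis
  proof (rule that[OF r])
    fix \<delta> :: real assume \<delta>: "0 < \<delta>"
    \<comment> \<open>\<open>t\<close> is chosen such that the constant \<open>2 * 2 ^ DIM('a) * (t * a)\<^sup>2\<close> of the patch inequality is at most \<open>\<delta>\<close>.\<close>
    define t where "t = min T (sqrt (\<delta> / (2 * 2 ^ DIM('a))) / a)"
    have t: "0 < t" "t \<le> T"
      using T a \<delta> by (auto simp: t_def)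
    have "t * a \<le> sqrt (\<delta> / (2 * 2 ^ DIM('a))) / a * a"
      using a by (intro mult_right_mono) (auto simp: t_def)
    then have "(t * a)\<^sup>2 \<le> (sqrt (\<delta> / (2 * 2 ^ DIM('a))))\<^sup>2"
      using a t by (intro power_mono) auto
    then have small: "2 * 2 ^ DIM('a) * (t * a)\<^sup>2 \<le> \<delta>"
      using \<delta> by (simp add: field_simps)
    have cone': "ball (y + s *\<^sub>R e) (c * s) \<subseteq> \<Omega>" if "y \<in> \<Omega> \<inter> ball x r" "0 < s" "s \<le> t" for y s
      using cone[OF that(1,2)] that(3) t(2) by linarith
    obtain F C where F: "finite F" "0 \<le> (C::real)" "\<And>E. E \<in> F \<Longrightarrow> E \<in> sets borel \<and> bounded E"
      and *: "\<And>u G. H1_pair \<Omega> u G \<Longrightarrow> (\<integral>\<^sup>+y. indicator (\<Omega> \<inter> ball x r) y * ennreal ((u y)\<^sup>2) \<partial>lborel)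
      \<le> ennreal (2 * 2 ^ DIM('a) * (t * (norm e + c))\<^sup>2) * (\<integral>\<^sup>+y. ennreal ((norm (G y))\<^sup>2) \<partial>lborel)
        + ennreal (C * (\<Sum>E\<in>F. (LINT x|lborel. indicator E x * u x)\<^sup>2))"
      using patch_inequality[OF bounded op Int_lower1 c t(1) cone'] by blast
    have "(\<integral>\<^sup>+y. indicator (\<Omega> \<inter> ball x r) y * ennreal ((u y)\<^sup>2) \<partial>lborel)
      \<le> ennreal \<delta> * (\<integral>\<^sup>+y. ennreal ((norm (G y))\<^sup>2) \<partial>lborel)
        + ennreal (C * (\<Sum>E\<in>F. (LINT x|lborel. indicator E x * u x)\<^sup>2))" if "H1_pair \<Omega> u G" for u G
      using *[OF that] by (rule order_trans) (intro add_right_mono mult_right_mono ennreal_leI small[unfolded a_def], simp)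
    then show "\<exists>F C. finite F \<and> 0 \<le> (C::real) \<and> (\<forall>E\<in>F. E \<in> sets borel \<and> bounded E) \<and>
    (\<forall>u G. H1_pair \<Omega> u G \<longrightarrow> (\<integral>\<^sup>+y. indicator (\<Omega> \<inter> ball x r) y * ennreal ((u y)\<^sup>2) \<partial>lborel)
      \<le> ennreal \<delta> * (\<integral>\<^sup>+y. ennreal ((norm (G y))\<^sup>2) \<partial>lborel)
        + ennreal (C * (\<Sum>E\<in>F. (LINT x|lborel. indicator E x * u x)\<^sup>2)))"
      using F by (intro exI[of _ F] exI[of _ C]) simp
  qed
qed

text \<open>
  Compactness of the closure reduces this to finitely many patches; adding up their inequalities
  multiplies the gradient term by the number of patches, which \<open>\<delta>\<close> compensates.
\<close>
lemma Rellich_inequality: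
  fixes \<Omega> :: "'a::euclidean_space set"
  assumes \<Omega>: "bounded_Lipschitz_domain \<Omega>" and \<epsilon>: "0 < \<epsilon>"
  obtains F C where "finite F" "0 \<le> (C::real)" "\<And>E. E \<in> F \<Longrightarrow> E \<in> sets borel \<and> bounded E"
    "\<And>u G. H1_pair \<Omega> u G \<Longrightarrow> (LINT x|lborel. (u x)\<^sup>2)
      \<le> \<epsilon> * (LINT x|lborel. (norm (G x))\<^sup>2) + C * (\<Sum>E\<in>F. (LINT x|lborel. indicator E x * u x)\<^sup>2)"
proof -
  define S where "S F u = (\<Sum>E\<in>F. (LINT x|lborel. indicator E x * u x)\<^sup>2)" for F and u :: "'a \<Rightarrow> real"
  define good where "good x r \<delta> F C \<longleftrightarrow> finite F \<and> 0 \<le> (C::real) \<and> (\<forall>E\<in>F. E \<in> sets borel \<and> bounded E) \<and>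
    (\<forall>u G. H1_pair \<Omega> u G \<longrightarrow> (\<integral>\<^sup>+y. indicator (\<Omega> \<inter> ball x r) y * ennreal ((u y)\<^sup>2) \<partial>lborel)
      \<le> ennreal \<delta> * (\<integral>\<^sup>+y. ennreal ((norm (G y))\<^sup>2) \<partial>lborel) + ennreal (C * S F u))" for x r \<delta> F C
  have "\<forall>x. \<exists>r. x \<in> closure \<Omega> \<longrightarrow> 0 < r \<and> (\<forall>\<delta>>0. \<exists>F C. good x r \<delta> F C)"
  proof (intro allI)
    fix x
    show "\<exists>r. x \<in> closure \<Omega> \<longrightarrow> 0 < r \<and> (\<forall>\<delta>>0. \<exists>F C. good x r \<delta> F C)"
    proof (cases "x \<in> closure \<Omega>")
      case True
      show ?thesis
        by (rule local_Rellich_inequality[OF \<Omega>(1) True]) (auto simp: good_def S_def)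
    qed simp
  qed
  then obtain r where r: "\<forall>x. x \<in> closure \<Omega> \<longrightarrow> 0 < r x \<and> (\<forall>\<delta>>0. \<exists>F C. good x (r x) \<delta> F C)"
    by (rule choice[THEN exE])
  have bounded: "bounded \<Omega>" and op: "open \<Omega>"
    using \<Omega> by (simp_all add: bounded_Lipschitz_domain_def open_Int)
  have "compact (closure \<Omega>)"
    using bounded by (simp add: compact_closure)
  moreover have "closure \<Omega> \<subseteq> (\<Union>x\<in>closure \<Omega>. ball x (r x))"
    using r centre_in_ball by blast
  ultimately obtain X where X: "X \<subseteq> closure \<Omega>" "finite X" "closure \<Omega> \<subseteq> (\<Union>x\<in>X. ball x (r x))"
    using compactE_image[of "closure \<Omega>" "closure \<Omega>" "\<lambda>x. ball x (r x)"] by auto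
  define \<delta> where "\<delta> = \<epsilon> / (real (card X) + 1)"
  have \<delta>: "0 < \<delta>" "real (card X) * \<delta> \<le> \<epsilon>"
    using \<epsilon> by (auto simp: \<delta>_def field_simps)
  have "\<forall>x. \<exists>p. x \<in> X \<longrightarrow> good x (r x) \<delta> (fst p) (snd p)"
    using r \<delta>(1) X(1) by (auto simp: subset_eq)
  then obtain p where p: "\<forall>x. x \<in> X \<longrightarrow> good x (r x) \<delta> (fst (p x)) (snd (p x))"
    by (rule choice[THEN exE])
  define F where "F x = fst (p x)" for x
  define C where "C x = snd (p x)" for x
  have FC: "good x (r x) \<delta> (F x) (C x)" if "x \<in> X" for x
    using p that by (simp add: F_def C_def)
  have C: "0 \<le> C x" if "x \<in> X" for x
    using FC[OF that] by (simp add: good_def)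
  have fin: "finite (\<Union>x\<in>X. F x)"
    using X(2) FC by (auto simp: good_def)
  show ?thesis
  proof (rule that[OF fin, of "\<Sum>x\<in>X. C x"])
    show "0 \<le> (\<Sum>x\<in>X. C x)"
      by (intro sum_nonneg C)
    show "E \<in> sets borel \<and> bounded E" if "E \<in> (\<Union>x\<in>X. F x)" for E
      using that FC by (auto simp: good_def)
    fix u G assume pair: "H1_pair \<Omega> u G"
    note [measurable] = H1_pair_measurable[OF pair]
    have [measurable]: "\<Omega> \<inter> ball x \<rho> \<in> sets borel" for x \<rho>
      using op by simp
    define g where "g = (LINT x|lborel. (norm (G x))\<^sup>2)"
    have g: "(\<integral>\<^sup>+y. ennreal ((norm (G y))\<^sup>2) \<partial>lborel) = ennreal g" "0 \<le> g"
      using pair by (auto simp: g_def H1_pair_def L2_def intro!: nn_integral_eq_integral)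
    have SF: "S (F x) u \<le> S (\<Union>x\<in>X. F x) u" "0 \<le> S (F x) u" if "x \<in> X" for x
      unfolding S_def using that fin by (auto intro!: sum_mono2 sum_nonneg)
    have "ennreal (LINT x|lborel. (u x)\<^sup>2) = (\<integral>\<^sup>+y. ennreal ((u y)\<^sup>2) \<partial>lborel)"
      using pair by (intro nn_integral_eq_integral[symmetric]) (auto simp: H1_pair_def L2_def)
    also have "\<dots> \<le> (\<integral>\<^sup>+y. (\<Sum>x\<in>X. indicator (\<Omega> \<inter> ball x (r x)) y * ennreal ((u y)\<^sup>2)) \<partial>lborel)"
    proof (rule nn_integral_mono)
      fix y
      show "ennreal ((u y)\<^sup>2) \<le> (\<Sum>x\<in>X. indicator (\<Omega> \<inter> ball x (r x)) y * ennreal ((u y)\<^sup>2))"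
      proof (cases "y \<in> \<Omega>")
        case True
        then obtain x where x: "x \<in> X" "y \<in> ball x (r x)"
          using X(3) closure_subset by blast
        then have "ennreal ((u y)\<^sup>2) = indicator (\<Omega> \<inter> ball x (r x)) y * ennreal ((u y)\<^sup>2)"
          using True by simp
        also have "\<dots> \<le> (\<Sum>x\<in>X. indicator (\<Omega> \<inter> ball x (r x)) y * ennreal ((u y)\<^sup>2))"
          using x(1) X(2) by (intro member_le_sum) auto
        finally show ?thesis .
      next
        case False
        then show ?thesis
          using pair by (simp add: H1_pair_def)
      qed
    qed
    also have "\<dots> = (\<Sum>x\<in>X. \<integral>\<^sup>+y. indicator (\<Omega> \<inter> ball x (r x)) y * ennreal ((u y)\<^sup>2) \<partial>lborel)"
      by (rule nn_integral_sum) simp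
    also have "\<dots> \<le> (\<Sum>x\<in>X. ennreal \<delta> * ennreal g + ennreal (C x * S (F x) u))"
      using FC pair unfolding good_def g(1)[symmetric] by (intro sum_mono) blast
    also have "\<dots> = ennreal (\<Sum>x\<in>X. \<delta> * g + C x * S (F x) u)"
      using \<delta>(1) g(2) C SF(2) by (subst sum_ennreal[symmetric]) (auto simp: ennreal_mult intro!: sum.cong)
    finally have "(LINT x|lborel. (u x)\<^sup>2) \<le> (\<Sum>x\<in>X. \<delta> * g + C x * S (F x) u)"
      using \<delta>(1) g(2) C SF(2) by (subst (asm) ennreal_le_iff) (auto intro!: sum_nonneg)
    also have "\<dots> \<le> (\<Sum>x\<in>X. \<delta> * g + C x * S (\<Union>x\<in>X. F x) u)"
      using C SF(1) by (intro sum_mono add_left_mono mult_left_mono)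
    also have "\<dots> = (real (card X) * \<delta>) * g + (\<Sum>x\<in>X. C x) * S (\<Union>x\<in>X. F x) u"
      by (simp add: sum.distrib sum_distrib_right)
    also have "\<dots> \<le> \<epsilon> * g + (\<Sum>x\<in>X. C x) * S (\<Union>x\<in>X. F x) u"
      using \<delta>(2) g(2) by (intro add_right_mono mult_right_mono)
    finally show "(LINT x|lborel. (u x)\<^sup>2) \<le> \<epsilon> * (LINT x|lborel. (norm (G x))\<^sup>2)
        + (\<Sum>x\<in>X. C x) * (\<Sum>E\<in>(\<Union>x\<in>X. F x). (LINT x|lborel. indicator E x * u x)\<^sup>2)"
      by (simp add: g_def S_def)
  qed
qed

lemma diagonal_convergent_subsequence:
  fixes a :: "nat \<Rightarrow> nat \<Rightarrow> real"
  assumes "\<And>k. bounded (range (a k))"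
  obtains s where "strict_mono s" "\<And>k. convergent (\<lambda>j. a k (s j))"
proof -
  interpret subseqs "\<lambda>k s. convergent (\<lambda>j. a k (s j))"
  proof
    fix k and s :: "nat \<Rightarrow> nat"
    have "bounded (range (\<lambda>j. a k (s j)))"
      using assms[of k] by (rule bounded_subset) auto
    then obtain l r where "strict_mono r" "((\<lambda>j. a k (s j)) \<circ> r) \<longlonglongrightarrow> l"
      using bounded_imp_convergent_subsequence by blast
    then show "\<exists>r'. strict_mono r' \<and> convergent (\<lambda>j. a k ((s \<circ> r') j))"
      by (auto simp: convergent_def o_def)
  qed
  show ?thesis
  proof (rule that[OF subseq_diagseq])
    fix k
    have "convergent (\<lambda>j. a k ((diagseq \<circ> (+) (Suc k)) j))"
    proof (rule diagseq_holds)
      fix r s :: "nat \<Rightarrow> nat" and n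
      assume "strict_mono r" "convergent (\<lambda>j. a n (s j))"
      then show "convergent (\<lambda>j. a n ((s \<circ> r) j))"
        using convergent_subseq_convergent[of "\<lambda>j. a n (s j)" r] by (simp add: o_def)
    qed
    then show "convergent (\<lambda>j. a k (diagseq j))"
      using convergent_ignore_initial_segment[of "\<lambda>j. a k (diagseq j)" "Suc k"] by (simp add: o_def add.commute)
  qed
qed

text \<open>
  Pass to a subsequence along which \<open>\<integral>\<^sub>E u\<close> converges for all sets \<open>E\<close> that the Rellich inequalities
  for \<open>\<epsilon> = 1/(n+1)\<close> use. For the difference of two members the gradient term is at most \<open>4 M \<epsilon>\<close>, and
  for fixed \<open>\<epsilon>\<close> the finite sum tends to zero.
\<close>
lemma Rellich_sequence:
  fixes \<Omega> :: "'a::euclidean_space set"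
  assumes \<Omega>: "bounded_Lipschitz_domain \<Omega>"
    and pair: "\<And>j. H1_pair \<Omega> (u j) (G j)"
    and u: "\<And>j. (LINT x|lborel. (u j x)\<^sup>2) \<le> M" and G: "\<And>j. (LINT x|lborel. (norm (G j x))\<^sup>2) \<le> M"
  obtains s where "strict_mono (s :: nat \<Rightarrow> nat)"
    "\<And>e. 0 < e \<Longrightarrow> \<exists>N. \<forall>i\<ge>N. \<forall>j\<ge>N. (LINT x|lborel. (u (s i) x - u (s j) x)\<^sup>2) < e"
proof -
  have bounded: "bounded \<Omega>"
    using \<Omega> by (simp add: bounded_Lipschitz_domain_def)
  have M: "0 \<le> M"
    using u[of 0] by (rule order_trans[rotated]) simp
  define \<mu> where "\<mu> E w = (LINT x|lborel. indicator E x * w x)" for E and w :: "'a \<Rightarrow> real"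
  define good where "good n F C \<longleftrightarrow> finite F \<and> 0 \<le> (C::real) \<and> (\<forall>E\<in>F. E \<in> sets borel \<and> bounded E) \<and>
    (\<forall>u G. H1_pair \<Omega> u G \<longrightarrow> (LINT x|lborel. (u x)\<^sup>2)
      \<le> 1 / real (Suc n) * (LINT x|lborel. (norm (G x))\<^sup>2) + C * (\<Sum>E\<in>F. (\<mu> E u)\<^sup>2))" for n F C
  have "\<forall>n. \<exists>p. good n (fst p) (snd p)"
  proof
    fix n :: nat
    have "0 < 1 / real (Suc n)"
      by simp
    then have "\<exists>F C. good n F C"
    proof (rule Rellich_inequality[OF \<Omega>])
      fix F C
      assume FC: "finite F" "0 \<le> (C::real)" "\<And>E. E \<in> F \<Longrightarrow> E \<in> sets borel \<and> bounded E"
        "\<And>u G. H1_pair \<Omega> u G \<Longrightarrow> (LINT x|lborel. (u x)\<^sup>2)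
          \<le> 1 / real (Suc n) * (LINT x|lborel. (norm (G x))\<^sup>2) + C * (\<Sum>E\<in>F. (LINT x|lborel. indicator E x * u x)\<^sup>2)"
      have "good n F C"
        unfolding good_def \<mu>_def
        by (intro conjI ballI allI impI FC(1,2,4) FC(3)[THEN conjunct1] FC(3)[THEN conjunct2])
      then show ?thesis
        by (intro exI)
    qed
    then obtain F C where "good n F C"
      by (elim exE)
    then show "\<exists>p. good n (fst p) (snd p)"
      by (intro exI[of _ "(F, C)"]) simp
  qed
  then obtain p where p: "\<forall>n. good n (fst (p n)) (snd (p n))"
    by (rule choice[THEN exE])
  define F where "F n = fst (p n)" for n
  define C where "C n = snd (p n)" for n
  have good: "good n (F n) (C n)" for n
    using p by (simp add: F_def C_def)
  have F: "finite (F n)" "0 \<le> C n" "E \<in> F n \<Longrightarrow> E \<in> sets borel \<and> bounded E" for n E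
    using good[of n] by (simp_all add: good_def)
  have ineq: "(LINT x|lborel. (u x)\<^sup>2)
      \<le> 1 / real (Suc n) * (LINT x|lborel. (norm (G x))\<^sup>2) + C n * (\<Sum>E\<in>F n. (\<mu> E u)\<^sup>2)"
    if "H1_pair \<Omega> u G" for n u G
    using good[of n] that unfolding good_def by blast
  \<comment> \<open>The empty set only ensures that the family can be enumerated by \<open>from_nat_into\<close>.\<close>
  define \<F> where "\<F> = insert {} (\<Union>n. F n)"
  have \<F>: "countable \<F>" "\<F> \<noteq> {}" "\<And>E. E \<in> \<F> \<Longrightarrow> E \<in> sets borel \<and> bounded E"
    using F by (auto simp: \<F>_def intro: countable_finite)
  have "bounded (range (\<lambda>j. \<mu> E (u j)))" if E: "E \<in> \<F>" for E
  proof -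
    have [measurable]: "E \<in> sets borel" and mE: "emeasure lborel E < \<infinity>"
      using \<F>(3)[OF E] emeasure_bounded_finite[of E] by simp_all
    have ind: "(indicator E :: 'a \<Rightarrow> real) \<in> L2 lborel"
    proof -
      have "(\<lambda>x. (norm (indicator E x :: real))\<^sup>2) = indicator E"
        by (auto simp: indicator_def)
      then show ?thesis
        using mE by (simp add: L2_def)
    qed
    have "(\<mu> E (u j))\<^sup>2 \<le> (LINT x|lborel. (norm (indicator E x :: real))\<^sup>2) * M" for j
    proof -
      have "u j \<in> L2 lborel"
        using pair[of j] by (simp add: H1_pair_def)
      from L2_Cauchy_Schwarz[OF ind this] have "(\<mu> E (u j))\<^sup>2 \<le> (LINT x|lborel. (norm (indicator E x :: real))\<^sup>2) * (LINT x|lborel. (u j x)\<^sup>2)"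
        by (simp add: \<mu>_def)
      also have "\<dots> \<le> (LINT x|lborel. (norm (indicator E x :: real))\<^sup>2) * M"
        using u by (intro mult_left_mono) auto
      finally show ?thesis .
    qed
    then have "\<bar>\<mu> E (u j)\<bar> \<le> sqrt ((LINT x|lborel. (norm (indicator E x :: real))\<^sup>2) * M)" for j
      by (intro real_le_rsqrt) simp
    then show ?thesis
      by (auto simp: bounded_iff)
  qed
  then have "bounded (range (\<lambda>j. \<mu> (from_nat_into \<F> k) (u j)))" for k
    using \<F>(2) by (simp add: from_nat_into)
  then obtain s where s: "strict_mono s" and conv: "\<And>k. convergent (\<lambda>j. \<mu> (from_nat_into \<F> k) (u (s j)))"
    using diagonal_convergent_subsequence[of "\<lambda>k j. \<mu> (from_nat_into \<F> k) (u j)"] by blast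
  have convE: "convergent (\<lambda>j. \<mu> E (u (s j)))" if "E \<in> F n" for E n
    using conv from_nat_into_surj[OF \<F>(1), of E] that by (auto simp: \<F>_def)
  have diff: "\<mu> E (\<lambda>x. u i x - u j x) = \<mu> E (u i) - \<mu> E (u j)" if "E \<in> F n" for E n i j
  proof -
    have "integrable lborel (\<lambda>x. indicator E x * u k x)" for k
    proof -
      have "integrable lborel (u k)"
        using pair[of k] bounded by (auto simp: H1_pair_def intro!: L2_integrable_of_bounded_support)
      then show ?thesis
        using integrable_mult_indicator[of E lborel "u k"] F(3)[OF that] by simp
    qed
    then show ?thesis
      by (simp add: \<mu>_def right_diff_distrib)
  qed
  show ?thesis
  proof (rule that[OF s])
    fix e :: real assume e: "0 < e"
    obtain n where n: "8 * M / e < real n"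
      using reals_Archimedean2 by blast
    have nM: "1 / real (Suc n) * (4 * M) < e / 2"
      using n e M by (simp add: field_simps)
    define l where "l E = lim (\<lambda>j. \<mu> E (u (s j)))" for E
    define q where "q j = (\<Sum>E\<in>F n. (\<mu> E (u (s j)) - l E)\<^sup>2)" for j
    have "(\<lambda>j. \<mu> E (u (s j))) \<longlonglongrightarrow> l E" if "E \<in> F n" for E
      using convE[OF that] by (simp add: l_def convergent_LIMSEQ_iff)
    then have "q \<longlonglongrightarrow> (\<Sum>E\<in>F n. (l E - l E)\<^sup>2)"
      unfolding q_def by (intro tendsto_intros)
    then have "q \<longlonglongrightarrow> 0"
      by simp
    define D where "D = e / (8 * (C n + 1))"
    have "0 < D"
      using e F(2)[of n] by (simp add: D_def add_nonneg_pos)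
    with \<open>q \<longlonglongrightarrow> 0\<close> have "\<forall>\<^sub>F j in sequentially. q j < D"
      by (intro order_tendstoD(2)) auto
    then obtain N where N: "\<And>j. N \<le> j \<Longrightarrow> q j < D"
      by (auto simp: eventually_sequentially)
    have "(LINT x|lborel. (u (s i) x - u (s j) x)\<^sup>2) < e" if ij: "N \<le> i" "N \<le> j" for i j
    proof -
      define w where "w x = u (s i) x - u (s j) x" for x
      define K where "K x = G (s i) x - G (s j) x" for x
      have wK: "H1_pair \<Omega> w K"
        unfolding w_def K_def by (intro H1_pair_diff pair bounded)
      have "(LINT x|lborel. (norm (K x))\<^sup>2)
          \<le> 2 * (LINT x|lborel. (norm (G (s i) x))\<^sup>2) + 2 * (LINT x|lborel. (norm (G (s j) x))\<^sup>2)"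
        unfolding K_def using pair by (intro L2_diff_le) (auto simp: H1_pair_def)
      also have "\<dots> \<le> 4 * M"
        using G[of "s i"] G[of "s j"] by linarith
      finally have "1 / real (Suc n) * (LINT x|lborel. (norm (K x))\<^sup>2) \<le> 1 / real (Suc n) * (4 * M)"
        by (intro mult_left_mono) auto
      moreover have "C n * (\<Sum>E\<in>F n. (\<mu> E w)\<^sup>2) \<le> e / 2"
      proof -
        have "(\<Sum>E\<in>F n. (\<mu> E w)\<^sup>2) \<le> (\<Sum>E\<in>F n. 2 * (\<mu> E (u (s i)) - l E)\<^sup>2 + 2 * (\<mu> E (u (s j)) - l E)\<^sup>2)"
        proof (rule sum_mono)
          fix E assume "E \<in> F n"
          then have "\<mu> E w = (\<mu> E (u (s i)) - l E) - (\<mu> E (u (s j)) - l E)"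
            unfolding w_def by (simp add: diff)
          then show "(\<mu> E w)\<^sup>2 \<le> 2 * (\<mu> E (u (s i)) - l E)\<^sup>2 + 2 * (\<mu> E (u (s j)) - l E)\<^sup>2"
            by (simp only: norm_diff_square_le[of "\<mu> E (u (s i)) - l E" "\<mu> E (u (s j)) - l E",
                unfolded real_norm_def power2_abs])
        qed
        also have "\<dots> = 2 * q i + 2 * q j"
          by (simp add: q_def sum.distrib sum_distrib_left)
        also have "\<dots> \<le> e / (2 * (C n + 1))"
        proof -
          have "e / (2 * (C n + 1)) = 4 * (D)"
            using F(2)[of n] by (simp add: D_def field_simps)
          then show ?thesis
            using N[OF ij(1)] N[OF ij(2)] by linarith
        qed
        finally have "C n * (\<Sum>E\<in>F n. (\<mu> E w)\<^sup>2) \<le> C n * (e / (2 * (C n + 1)))"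
          using F(2) by (rule mult_left_mono)
        also have "\<dots> \<le> e / 2"
          using e F(2)[of n] by (simp add: field_simps)
        finally show ?thesis .
      qed
      ultimately have "(LINT x|lborel. (w x)\<^sup>2) < e"
        using ineq[OF wK, of n] nM by linarith
      then show ?thesis
        by (simp add: w_def)
    qed
    then show "\<exists>N. \<forall>i\<ge>N. \<forall>j\<ge>N. (LINT x|lborel. (u (s i) x - u (s j) x)\<^sup>2) < e"
      by blast
  qed
qed

section \<open>Weak gradients on the domain\<close>

lemma measurable_lebesgue_on_of_borel:
  "f \<in> borel_measurable borel \<Longrightarrow> f \<in> borel_measurable (lebesgue_on \<Omega>)"
  by (intro measurable_restrict_space1 measurable_completion) simp

lemma AE_lebesgue_on_iff:
  "open \<Omega> \<Longrightarrow> (AE x in lebesgue_on \<Omega>. P x) \<longleftrightarrow> (AE x in lborel. x \<in> \<Omega> \<longrightarrow> P x)"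
  by (subst AE_restrict_space_iff) (auto simp: AE_completion_iff)

lemma lebesgue_on_borel_integral:
  fixes h :: "'a::euclidean_space \<Rightarrow> 'b::euclidean_space"
  assumes "open \<Omega>" and h: "h \<in> borel_measurable borel" "\<And>x. x \<notin> \<Omega> \<Longrightarrow> h x = 0"
  shows "integrable (lebesgue_on \<Omega>) h \<longleftrightarrow> integrable lborel h"
    "(LINT x|lebesgue_on \<Omega>. h x) = (LINT x|lborel. h x)"
proof -
  have eq: "(\<lambda>x. indicator \<Omega> x *\<^sub>R h x) = h"
    using h(2) by (auto simp: indicator_def)
  have \<Omega>: "\<Omega> \<inter> space lebesgue \<in> sets lebesgue"
    using \<open>open \<Omega>\<close> by simp
  show "integrable (lebesgue_on \<Omega>) h \<longleftrightarrow> integrable lborel h"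
    unfolding integrable_restrict_space[OF \<Omega>] eq using h(1) by (simp add: integrable_completion)
  show "(LINT x|lebesgue_on \<Omega>. h x) = (LINT x|lborel. h x)"
    unfolding integral_restrict_space[OF \<Omega>] eq using h(1) by (simp add: integral_completion)
qed

lemma borel_extension:
  fixes f :: "'a::euclidean_space \<Rightarrow> 'b::euclidean_space"
  assumes "open \<Omega>" and f: "f \<in> borel_measurable (lebesgue_on \<Omega>)"
  obtains g where "g \<in> borel_measurable borel" "\<And>x. x \<notin> \<Omega> \<Longrightarrow> g x = 0"
    "AE x in lebesgue_on \<Omega>. g x = f x"
proof -
  define F where "F x = (if x \<in> \<Omega> then f x else 0)" for x
  have "F \<in> borel_measurable lebesgue"
    unfolding F_def using assms by (simp add: borel_measurable_if)
  then have "(\<lambda>x. F x \<bullet> i) \<in> borel_measurable (completion lborel)" for i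
    by simp
  then have "\<forall>i. \<exists>g. g \<in> borel_measurable lborel \<and> (AE x in lborel. F x \<bullet> i = g x)"
    using completion_ex_borel_measurable_real by blast
  then obtain g where g: "\<forall>i. g i \<in> borel_measurable lborel \<and> (AE x in lborel. F x \<bullet> i = g i x)"
    by (rule choice[THEN exE])
  then have [measurable]: "g i \<in> borel_measurable borel" for i
    by simp
  have [measurable]: "\<Omega> \<in> sets borel"
    using \<open>open \<Omega>\<close> by simp
  define h where "h x = indicator \<Omega> x *\<^sub>R (\<Sum>i\<in>Basis. g i x *\<^sub>R i)" for x
  have "AE x in lborel. \<forall>i\<in>Basis. F x \<bullet> i = g i x"
    using g by (intro AE_finite_allI) auto
  then have "AE x in lborel. x \<in> \<Omega> \<longrightarrow> h x = f x"
  proof eventually_elim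
    case (elim x)
    then have "(\<Sum>i\<in>Basis. g i x *\<^sub>R i) = (\<Sum>i\<in>Basis. (F x \<bullet> i) *\<^sub>R i)"
      by (intro sum.cong) auto
    then show ?case
      by (auto simp: h_def F_def euclidean_representation)
  qed
  then have "AE x in lebesgue_on \<Omega>. h x = f x"
    using \<open>open \<Omega>\<close> by (simp add: AE_lebesgue_on_iff)
  moreover have "h \<in> borel_measurable borel"
    unfolding h_def by measurable
  ultimately show ?thesis
    by (intro that) (auto simp: h_def)
qed

text \<open>
  A relation instead of the function \<open>weak_grad\<close>: it is linear and closed under limits by inspection,
  whereas the chosen gradients are linear only up to null sets.
\<close>
definition H1_grad :: "'a::euclidean_space set \<Rightarrow> ('a \<Rightarrow> real) \<Rightarrow> ('a \<Rightarrow> 'a) \<Rightarrow> bool" where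
  "H1_grad \<Omega> u G \<longleftrightarrow> u \<in> L2 (lebesgue_on \<Omega>) \<and> G \<in> L2 (lebesgue_on \<Omega>) \<and> is_weak_grad \<Omega> u G"

lemma L2_borel_extension:
  fixes f :: "'a::euclidean_space \<Rightarrow> 'b::euclidean_space"
  assumes "open \<Omega>" and f: "f \<in> L2 (lebesgue_on \<Omega>)"
    and g: "g \<in> borel_measurable borel" "\<And>x. x \<notin> \<Omega> \<Longrightarrow> g x = 0" "AE x in lebesgue_on \<Omega>. g x = f x"
  shows "g \<in> L2 lborel"
proof -
  have [measurable]: "f \<in> borel_measurable (lebesgue_on \<Omega>)" "g \<in> borel_measurable (lebesgue_on \<Omega>)"
    using f measurable_lebesgue_on_of_borel[OF g(1)] by (auto simp: L2_def)
  have "integrable (lebesgue_on \<Omega>) (\<lambda>x. (norm (f x))\<^sup>2)"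
    using f by (simp add: L2_def)
  then have "integrable (lebesgue_on \<Omega>) (\<lambda>x. (norm (g x))\<^sup>2)"
    by (rule integrable_cong_AE_imp) (use g(3) in \<open>auto elim!: eventually_mono\<close>)
  then have "integrable lborel (\<lambda>x. (norm (g x))\<^sup>2)"
    using lebesgue_on_borel_integral(1)[OF \<open>open \<Omega>\<close>, of "\<lambda>x. (norm (g x))\<^sup>2"] g(1,2) by simp
  then show ?thesis
    using g(1) by (simp add: L2_def)
qed

text \<open>
  Passing to Borel versions that vanish off \<open>\<Omega>\<close> changes none of the integrals that define a weak
  gradient.
\<close>
lemma H1_grad_pair:
  assumes "open \<Omega>" and H1: "H1_grad \<Omega> u G"
  obtains u' G' where "H1_pair \<Omega> u' G'" "AE x in lebesgue_on \<Omega>. u' x = u x" "AE x in lebesgue_on \<Omega>. G' x = G x"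
proof -
  have u: "u \<in> L2 (lebesgue_on \<Omega>)" and G: "G \<in> L2 (lebesgue_on \<Omega>)" and wg: "is_weak_grad \<Omega> u G"
    using H1 by (auto simp: H1_grad_def)
  have mu: "u \<in> borel_measurable (lebesgue_on \<Omega>)" and mG: "G \<in> borel_measurable (lebesgue_on \<Omega>)"
    using u G by (simp_all add: L2_def)
  obtain u' where u': "u' \<in> borel_measurable borel" "\<And>x. x \<notin> \<Omega> \<Longrightarrow> u' x = 0" "AE x in lebesgue_on \<Omega>. u' x = u x"
    by (rule borel_extension[OF \<open>open \<Omega>\<close> mu]) (rule that)
  obtain G' where G': "G' \<in> borel_measurable borel" "\<And>x. x \<notin> \<Omega> \<Longrightarrow> G' x = 0" "AE x in lebesgue_on \<Omega>. G' x = G x"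
    by (rule borel_extension[OF \<open>open \<Omega>\<close> mG]) (rule that)
  note [measurable] = mu mG u'(1) G'(1) measurable_lebesgue_on_of_borel[OF u'(1)] measurable_lebesgue_on_of_borel[OF G'(1)]
  have "H1_pair \<Omega> u' G'"
    unfolding H1_pair_def
  proof (intro conjI allI impI ballI)
    show "u' \<in> L2 lborel" "G' \<in> L2 lborel"
      using L2_borel_extension[OF \<open>open \<Omega>\<close> u u'] L2_borel_extension[OF \<open>open \<Omega>\<close> G G'] by auto
    fix \<phi> and i :: 'a assume \<phi>: "\<phi> \<in> test_functions \<Omega>" and i: "i \<in> Basis"
    have [measurable]: "\<phi> \<in> borel_measurable borel" "(\<lambda>x. frechet_derivative \<phi> (at x) i) \<in> borel_measurable borel"
      by (intro borel_measurable_continuous_onI test_function_continuous[OF \<phi>] test_function_derivative_continuous[OF \<phi>])+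
    note [measurable] = this[THEN measurable_lebesgue_on_of_borel]
    have "(LINT x|lborel. u' x * frechet_derivative \<phi> (at x) i) = (LINT x|lebesgue_on \<Omega>. u' x * frechet_derivative \<phi> (at x) i)"
      using u'(2) by (intro lebesgue_on_borel_integral(2)[OF \<open>open \<Omega>\<close>, symmetric]) auto
    also have "\<dots> = (LINT x|lebesgue_on \<Omega>. u x * frechet_derivative \<phi> (at x) i)"
      using u'(3) by (intro integral_cong_AE) (auto elim!: eventually_mono)
    also have "\<dots> = - (LINT x|lebesgue_on \<Omega>. (G x \<bullet> i) * \<phi> x)"
      using wg \<phi> i by (simp add: is_weak_grad_def)
    also have "(LINT x|lebesgue_on \<Omega>. (G x \<bullet> i) * \<phi> x) = (LINT x|lebesgue_on \<Omega>. (G' x \<bullet> i) * \<phi> x)"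
      using G'(3) by (intro integral_cong_AE) (auto elim!: eventually_mono)
    also have "\<dots> = (LINT x|lborel. (G' x \<bullet> i) * \<phi> x)"
      using G'(2) by (intro lebesgue_on_borel_integral(2)[OF \<open>open \<Omega>\<close>]) auto
    finally show "(LINT x|lborel. u' x * frechet_derivative \<phi> (at x) i) = - (LINT x|lborel. (G' x \<bullet> i) * \<phi> x)" .
  qed (use u'(2) G'(2) in auto)
  then show ?thesis
    using u'(3) G'(3) by (rule that)
qed

lemma H1_pair_zero_gradient:
  assumes "open \<Omega>" "bounded \<Omega>" and pair: "H1_pair \<Omega> w N" and w: "AE x in lborel. x \<in> \<Omega> \<longrightarrow> w x = 0"
  shows "AE x in lborel. x \<in> \<Omega> \<longrightarrow> N x = 0"
proof -
  have N: "integrable lborel N"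
    using pair \<open>bounded \<Omega>\<close> by (auto simp: H1_pair_def intro!: L2_integrable_of_bounded_support)
  note [measurable] = H1_pair_measurable[OF pair]
  have w0: "AE x in lborel. w x = 0"
    using w by eventually_elim (use pair in \<open>auto simp: H1_pair_def\<close>)
  have "AE x in lborel. x \<in> \<Omega> \<longrightarrow> N x \<bullet> i = 0" if i: "i \<in> Basis" for i
  proof (rule fundamental_lemma[OF \<open>open \<Omega>\<close>])
    show "integrable lborel (\<lambda>x. N x \<bullet> i)"
      using N by simp
    fix a b :: 'a and c :: real assume "cbox a b \<subseteq> \<Omega>" "0 < c"
    then have \<phi>: "box_bump a b c \<in> test_functions \<Omega>"
      by (intro box_bump_test)
    have "(LINT x|lborel. (N x \<bullet> i) * box_bump a b c x) = - (LINT x|lborel. w x * frechet_derivative (box_bump a b c) (at x) i)"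
      using pair \<phi> i by (simp add: H1_pair_def)
    also have "(LINT x|lborel. w x * frechet_derivative (box_bump a b c) (at x) i) = 0"
      using w0 by (intro integral_eq_zero_AE) (auto elim!: eventually_mono)
    finally show "(LINT x|lborel. (N x \<bullet> i) * box_bump a b c x) = 0"
      by simp
  qed
  then have "AE x in lborel. \<forall>i\<in>Basis. x \<in> \<Omega> \<longrightarrow> N x \<bullet> i = 0"
    by (intro AE_finite_allI) auto
  then show ?thesis
    by eventually_elim (auto intro: euclidean_eqI)
qed

text \<open>
  Two gradients of \<open>u\<close> differ by a gradient of zero, and such a gradient vanishes by the fundamental
  lemma. This makes the choice in \<open>weak_grad\<close> immaterial.
\<close>
lemma weak_gradient_unique:
  assumes "open \<Omega>" "bounded \<Omega>" and "H1_grad \<Omega> u G" "H1_grad \<Omega> u H"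
  shows "AE x in lebesgue_on \<Omega>. G x = H x"
proof -
  obtain u1 G1 where 1: "H1_pair \<Omega> u1 G1" "AE x in lebesgue_on \<Omega>. u1 x = u x" "AE x in lebesgue_on \<Omega>. G1 x = G x"
    by (rule H1_grad_pair[OF assms(1,3)]) (rule that)
  obtain u2 G2 where 2: "H1_pair \<Omega> u2 G2" "AE x in lebesgue_on \<Omega>. u2 x = u x" "AE x in lebesgue_on \<Omega>. G2 x = H x"
    by (rule H1_grad_pair[OF assms(1,4)]) (rule that)
  have "AE x in lebesgue_on \<Omega>. u1 x - u2 x = 0"
    using 1(2) 2(2) by eventually_elim simp
  then have "AE x in lebesgue_on \<Omega>. G1 x - G2 x = 0"
    unfolding AE_lebesgue_on_iff[OF \<open>open \<Omega>\<close>]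
    by (rule H1_pair_zero_gradient[OF assms(1,2) H1_pair_diff[OF 1(1) 2(1) assms(2)]])
  with 1(3) 2(3) show ?thesis
    by eventually_elim simp
qed

lemma Rellich_compactness:
  fixes \<Omega> :: "'a::euclidean_space set"
  assumes \<Omega>: "bounded_Lipschitz_domain \<Omega>"
    and H1: "\<And>j. H1_grad \<Omega> (u j) (G j)"
    and u: "\<And>j. (LINT x|lebesgue_on \<Omega>. (u j x)\<^sup>2) \<le> M" and G: "\<And>j. (LINT x|lebesgue_on \<Omega>. (norm (G j x))\<^sup>2) \<le> M"
  obtains s where "strict_mono (s :: nat \<Rightarrow> nat)"
    "\<And>e. 0 < e \<Longrightarrow> \<exists>N. \<forall>i\<ge>N. \<forall>j\<ge>N. (LINT x|lebesgue_on \<Omega>. (u (s i) x - u (s j) x)\<^sup>2) < e"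
proof -
  have op: "open \<Omega>"
    using \<Omega> by (simp add: bounded_Lipschitz_domain_def)
  have "\<forall>j. \<exists>p. H1_pair \<Omega> (fst p) (snd p) \<and> (AE x in lebesgue_on \<Omega>. fst p x = u j x) \<and> (AE x in lebesgue_on \<Omega>. snd p x = G j x)"
  proof
    fix j
    show "\<exists>p. H1_pair \<Omega> (fst p) (snd p) \<and> (AE x in lebesgue_on \<Omega>. fst p x = u j x) \<and> (AE x in lebesgue_on \<Omega>. snd p x = G j x)"
      by (rule H1_grad_pair[OF op H1[of j]]) (auto intro!: exI[of _ "(_, _)"])
  qed
  then obtain p where p: "\<forall>j. H1_pair \<Omega> (fst (p j)) (snd (p j)) \<and> (AE x in lebesgue_on \<Omega>. fst (p j) x = u j x) \<and> (AE x in lebesgue_on \<Omega>. snd (p j) x = G j x)"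
    by (rule choice[THEN exE])
  define u' where "u' j = fst (p j)" for j
  define G' where "G' j = snd (p j)" for j
  have pair: "H1_pair \<Omega> (u' j) (G' j)" and aeu: "AE x in lebesgue_on \<Omega>. u' j x = u j x"
    and aeG: "AE x in lebesgue_on \<Omega>. G' j x = G j x" for j
    using p by (simp_all add: u'_def G'_def)
  have zero: "u' j x = 0" "G' j x = 0" if "x \<notin> \<Omega>" for j x
    using pair[of j] that by (simp_all add: H1_pair_def)
  note [measurable] = H1_pair_measurable[OF pair] H1_pair_measurable[OF pair, THEN measurable_lebesgue_on_of_borel]
  have [measurable]: "u j \<in> borel_measurable (lebesgue_on \<Omega>)" "G j \<in> borel_measurable (lebesgue_on \<Omega>)" for j
    using H1[of j] by (simp_all add: H1_grad_def L2_def)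
  have u': "(LINT x|lborel. (u' j x)\<^sup>2) \<le> M" for j
  proof -
    have "(LINT x|lborel. (u' j x)\<^sup>2) = (LINT x|lebesgue_on \<Omega>. (u' j x)\<^sup>2)"
      by (intro lebesgue_on_borel_integral(2)[OF op, symmetric]) (auto simp: zero)
    also have "\<dots> = (LINT x|lebesgue_on \<Omega>. (u j x)\<^sup>2)"
      using aeu[of j] by (intro integral_cong_AE) (auto elim!: eventually_mono)
    finally show ?thesis
      using u by simp
  qed
  have G': "(LINT x|lborel. (norm (G' j x))\<^sup>2) \<le> M" for j
  proof -
    have "(LINT x|lborel. (norm (G' j x))\<^sup>2) = (LINT x|lebesgue_on \<Omega>. (norm (G' j x))\<^sup>2)"
      by (intro lebesgue_on_borel_integral(2)[OF op, symmetric]) (auto simp: zero)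
    also have "\<dots> = (LINT x|lebesgue_on \<Omega>. (norm (G j x))\<^sup>2)"
      using aeG[of j] by (intro integral_cong_AE) (auto elim!: eventually_mono)
    finally show ?thesis
      using G by simp
  qed
  obtain s where s: "strict_mono (s :: nat \<Rightarrow> nat)"
    and C: "\<And>e. 0 < e \<Longrightarrow> \<exists>N. \<forall>i\<ge>N. \<forall>j\<ge>N. (LINT x|lborel. (u' (s i) x - u' (s j) x)\<^sup>2) < e"
    by (rule Rellich_sequence[OF \<Omega> pair u' G']) (rule that)
  have "(LINT x|lborel. (u' i x - u' j x)\<^sup>2) = (LINT x|lebesgue_on \<Omega>. (u' i x - u' j x)\<^sup>2)" for i j
    by (intro lebesgue_on_borel_integral(2)[OF op, symmetric]) (auto simp: zero)
  moreover have "(LINT x|lebesgue_on \<Omega>. (u' i x - u' j x)\<^sup>2) = (LINT x|lebesgue_on \<Omega>. (u i x - u j x)\<^sup>2)" for i j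
  proof (rule integral_cong_AE)
    show "AE x in lebesgue_on \<Omega>. (u' i x - u' j x)\<^sup>2 = (u i x - u j x)\<^sup>2"
      using aeu[of i] aeu[of j] by eventually_elim simp
  qed auto
  ultimately show ?thesis
    using s C by (intro that[of s]) simp_all
qed

section \<open>Weak solutions of the homogeneous problem\<close>

lemma bounded_borel_L2:
  fixes f :: "'a::euclidean_space \<Rightarrow> real"
  assumes "open \<Omega>" "bounded \<Omega>" "f \<in> borel_measurable borel" "\<And>x. \<bar>f x\<bar> \<le> K"
  shows "f \<in> L2 (lebesgue_on \<Omega>)"
proof -
  interpret finite_measure "lebesgue_on \<Omega>"
    using assms(1,2) by (intro finite_measure_lebesgue_on bounded_set_imp_lmeasurable) auto
  show ?thesis
  proof (rule L2_I)
    show "integrable (lebesgue_on \<Omega>) (\<lambda>x. K\<^sup>2)"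
      by simp
    have "\<bar>f x\<bar>\<^sup>2 \<le> K\<^sup>2" for x
      by (intro power_mono assms(4)) simp
    then show "AE x in lebesgue_on \<Omega>. (norm (f x))\<^sup>2 \<le> K\<^sup>2"
      by simp
  qed (use measurable_lebesgue_on_of_borel[OF assms(3)] in auto)
qed

lemma test_function_L2:
  assumes "open \<Omega>" "bounded \<Omega>" and \<phi>: "\<phi> \<in> test_functions \<Omega>"
  shows "\<phi> \<in> L2 (lebesgue_on \<Omega>)" "(\<lambda>x. frechet_derivative \<phi> (at x) h) \<in> L2 (lebesgue_on \<Omega>)"
proof -
  obtain K where "\<And>x. \<bar>\<phi> x\<bar> \<le> K"
    using test_function_bounded[OF \<phi>] by blast
  then show "\<phi> \<in> L2 (lebesgue_on \<Omega>)"
    by (intro bounded_borel_L2 assms borel_measurable_continuous_onI test_function_continuous[OF \<phi>])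
  obtain K where "\<And>x. \<bar>frechet_derivative \<phi> (at x) h\<bar> \<le> K"
    using test_function_derivative_bounded[OF \<phi>, of h] by blast
  then show "(\<lambda>x. frechet_derivative \<phi> (at x) h) \<in> L2 (lebesgue_on \<Omega>)"
    by (intro bounded_borel_L2 assms borel_measurable_continuous_onI test_function_derivative_continuous[OF \<phi>])
qed

lemma L2_test_vector:
  assumes "open \<Omega>" "bounded \<Omega>" and \<phi>: "\<phi> \<in> test_functions \<Omega>"
  shows "(\<lambda>x. \<phi> x *\<^sub>R i) \<in> L2 (lebesgue_on \<Omega>)"
proof (rule L2_I)
  show "integrable (lebesgue_on \<Omega>) (\<lambda>x. (norm (\<phi> x))\<^sup>2 * (norm i)\<^sup>2)"
    using L2_integrable_norm[OF test_function_L2(1)[OF assms]] by simp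
qed (use test_function_L2(1)[OF assms] in \<open>auto simp: L2_def power_mult_distrib\<close>)

lemma H1_grad_diff:
  assumes "open \<Omega>" "bounded \<Omega>" "H1_grad \<Omega> u G" "H1_grad \<Omega> v H"
  shows "H1_grad \<Omega> (\<lambda>x. u x - v x) (\<lambda>x. G x - H x)"
proof -
  have L2: "u \<in> L2 (lebesgue_on \<Omega>)" "G \<in> L2 (lebesgue_on \<Omega>)" "v \<in> L2 (lebesgue_on \<Omega>)" "H \<in> L2 (lebesgue_on \<Omega>)"
    and w: "is_weak_grad \<Omega> u G" "is_weak_grad \<Omega> v H"
    using assms(3,4) by (simp_all add: H1_grad_def)
  have "is_weak_grad \<Omega> (\<lambda>x. u x - v x) (\<lambda>x. G x - H x)"
    unfolding is_weak_grad_def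
  proof (intro ballI)
    fix \<phi> and i :: 'a assume \<phi>: "\<phi> \<in> test_functions \<Omega>" and i: "i \<in> Basis"
    note T = test_function_L2(2)[OF assms(1,2) \<phi>, of i] L2_test_vector[OF assms(1,2) \<phi>, of i]
    show "(LINT x|lebesgue_on \<Omega>. (u x - v x) * frechet_derivative \<phi> (at x) i) =
        - (LINT x|lebesgue_on \<Omega>. ((G x - H x) \<bullet> i) * \<phi> x)"
      using w \<phi> i L2_integrable_inner[OF L2(1) T(1)] L2_integrable_inner[OF L2(3) T(1)]
        L2_integrable_inner[OF L2(2) T(2)] L2_integrable_inner[OF L2(4) T(2)]
      by (simp add: is_weak_grad_def left_diff_distrib inner_diff_left mult.commute[of "\<phi> _"])
  qed
  then show ?thesis
    using L2 by (simp add: H1_grad_def L2_diff)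
qed

lemma H1_grad_scale:
  assumes "H1_grad \<Omega> u G"
  shows "H1_grad \<Omega> (\<lambda>x. c * u x) (\<lambda>x. c *\<^sub>R G x)"
proof -
  have "(\<lambda>x. c * u x) \<in> L2 (lebesgue_on \<Omega>)" "(\<lambda>x. c *\<^sub>R G x) \<in> L2 (lebesgue_on \<Omega>)"
    using assms L2_scaleR[of u "lebesgue_on \<Omega>" "\<lambda>_. c" "\<bar>c\<bar>"] L2_scaleR[of G "lebesgue_on \<Omega>" "\<lambda>_. c" "\<bar>c\<bar>"]
    by (simp_all add: H1_grad_def)
  moreover have "is_weak_grad \<Omega> (\<lambda>x. c * u x) (\<lambda>x. c *\<^sub>R G x)"
    using assms by (simp add: H1_grad_def is_weak_grad_def mult.assoc)
  ultimately show ?thesis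
    by (simp add: H1_grad_def)
qed

text \<open>
  For a fixed test function both sides of the defining identity are continuous in $L^2$.
\<close>
lemma H1_grad_limit:
  assumes "open \<Omega>" "bounded \<Omega>" and H1: "\<And>n. H1_grad \<Omega> (u n) (G n)"
    and L2: "v \<in> L2 (lebesgue_on \<Omega>)" "H \<in> L2 (lebesgue_on \<Omega>)"
    and lim: "(\<lambda>n. LINT x|lebesgue_on \<Omega>. (norm (u n x - v x))\<^sup>2) \<longlonglongrightarrow> 0"
      "(\<lambda>n. LINT x|lebesgue_on \<Omega>. (norm (G n x - H x))\<^sup>2) \<longlonglongrightarrow> 0"
  shows "H1_grad \<Omega> v H"
proof -
  have L2n: "u n \<in> L2 (lebesgue_on \<Omega>)" "G n \<in> L2 (lebesgue_on \<Omega>)" and w: "is_weak_grad \<Omega> (u n) (G n)" for n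
    using H1[of n] by (simp_all add: H1_grad_def)
  have "is_weak_grad \<Omega> v H"
    unfolding is_weak_grad_def
  proof (intro ballI)
    fix \<phi> and i :: 'a assume \<phi>: "\<phi> \<in> test_functions \<Omega>" and i: "i \<in> Basis"
    have "(\<lambda>n. LINT x|lebesgue_on \<Omega>. u n x * frechet_derivative \<phi> (at x) i)
        \<longlonglongrightarrow> (LINT x|lebesgue_on \<Omega>. v x * frechet_derivative \<phi> (at x) i)"
      using L2_inner_tendsto[OF L2n(1) L2(1) test_function_L2(2)[OF assms(1,2) \<phi>, of i] lim(1)] by simp
    moreover have "(\<lambda>n. - (LINT x|lebesgue_on \<Omega>. (G n x \<bullet> i) * \<phi> x)) \<longlonglongrightarrow> - (LINT x|lebesgue_on \<Omega>. (H x \<bullet> i) * \<phi> x)"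
      using tendsto_minus[OF L2_inner_tendsto[OF L2n(2) L2(2) L2_test_vector[OF assms(1,2) \<phi>, of i] lim(2)]]
      by (simp add: mult.commute[of "\<phi> _"])
    moreover have "(LINT x|lebesgue_on \<Omega>. u n x * frechet_derivative \<phi> (at x) i) =
        - (LINT x|lebesgue_on \<Omega>. (G n x \<bullet> i) * \<phi> x)" for n
      using w \<phi> i by (simp add: is_weak_grad_def)
    ultimately show "(LINT x|lebesgue_on \<Omega>. v x * frechet_derivative \<phi> (at x) i) =
        - (LINT x|lebesgue_on \<Omega>. (H x \<bullet> i) * \<phi> x)"
      by (simp add: LIMSEQ_unique)
  qed
  then show ?thesis
    using L2 by (simp add: H1_grad_def)
qed

text \<open>
  The weak form of the homogeneous Neumann problem, for an arbitrary choice of gradients of the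
  solution and of the test functions.
\<close>
definition H1_solution ::
  "real \<Rightarrow> 'a::euclidean_space set \<Rightarrow> ('a \<Rightarrow> real) \<Rightarrow> ('a \<Rightarrow> real) \<Rightarrow> ('a \<Rightarrow> 'a) \<Rightarrow> bool" where
  "H1_solution k \<Omega> q u G \<longleftrightarrow> H1_grad \<Omega> u G \<and> (\<forall>v H. H1_grad \<Omega> v H \<longrightarrow>
     (LINT x|lebesgue_on \<Omega>. G x \<bullet> H x - k\<^sup>2 * q x * u x * v x) = 0)"

lemma H1_grad_weak_grad:
  assumes "u \<in> H1 \<Omega>"
  shows "H1_grad \<Omega> u (weak_grad \<Omega> u)"
proof -
  have "\<exists>G. G \<in> L2 (lebesgue_on \<Omega>) \<and> is_weak_grad \<Omega> u G"
    using assms by (auto simp: H1_def)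
  then have "weak_grad \<Omega> u \<in> L2 (lebesgue_on \<Omega>) \<and> is_weak_grad \<Omega> u (weak_grad \<Omega> u)"
    unfolding weak_grad_def by (rule someI_ex)
  then show ?thesis
    using assms by (simp add: H1_grad_def H1_def)
qed

lemma H1_grad_H1: "H1_grad \<Omega> u G \<Longrightarrow> u \<in> H1 \<Omega>"
  by (auto simp: H1_grad_def H1_def)

text \<open>
  By uniqueness of weak gradients the bilinear form does not depend on their choice; the boundary term
  is zero for zero data.
\<close>
lemma homogeneous_solution_iff:
  assumes "open \<Omega>" "bounded \<Omega>" and q: "q \<in> borel_measurable (lebesgue_on \<Omega>)"
  shows "neumann_solution k \<Omega> q (\<lambda>_. 0) u \<longleftrightarrow> (\<exists>G. H1_solution k \<Omega> q u G)"
proof -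
  have cong: "(LINT x|lebesgue_on \<Omega>. weak_grad \<Omega> u x \<bullet> weak_grad \<Omega> v x - k\<^sup>2 * q x * u x * v x) =
      (LINT x|lebesgue_on \<Omega>. G x \<bullet> H x - k\<^sup>2 * q x * u x * v x)"
    if G: "H1_grad \<Omega> u G" and H: "H1_grad \<Omega> v H" for v G H
  proof (rule integral_cong_AE)
    note wu = H1_grad_weak_grad[OF H1_grad_H1[OF G]] and wv = H1_grad_weak_grad[OF H1_grad_H1[OF H]]
    have [measurable]: "u \<in> borel_measurable (lebesgue_on \<Omega>)" "v \<in> borel_measurable (lebesgue_on \<Omega>)"
      "G \<in> borel_measurable (lebesgue_on \<Omega>)" "H \<in> borel_measurable (lebesgue_on \<Omega>)"
      "weak_grad \<Omega> u \<in> borel_measurable (lebesgue_on \<Omega>)" "weak_grad \<Omega> v \<in> borel_measurable (lebesgue_on \<Omega>)"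
      using G H wu wv by (simp_all add: H1_grad_def L2_def)
    note [measurable] = q
    show "(\<lambda>x. weak_grad \<Omega> u x \<bullet> weak_grad \<Omega> v x - k\<^sup>2 * q x * u x * v x) \<in> borel_measurable (lebesgue_on \<Omega>)"
      "(\<lambda>x. G x \<bullet> H x - k\<^sup>2 * q x * u x * v x) \<in> borel_measurable (lebesgue_on \<Omega>)"
      by measurable
    show "AE x in lebesgue_on \<Omega>. weak_grad \<Omega> u x \<bullet> weak_grad \<Omega> v x - k\<^sup>2 * q x * u x * v x =
        G x \<bullet> H x - k\<^sup>2 * q x * u x * v x"
      using weak_gradient_unique[OF assms(1,2) wu G] weak_gradient_unique[OF assms(1,2) wv H]
      by eventually_elim simp
  qed
  show ?thesis
  proof
    assume sol: "neumann_solution k \<Omega> q (\<lambda>_. 0) u"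
    then have G: "H1_grad \<Omega> u (weak_grad \<Omega> u)"
      by (intro H1_grad_weak_grad) (simp add: neumann_solution_def)
    have "H1_solution k \<Omega> q u (weak_grad \<Omega> u)"
      unfolding H1_solution_def
    proof (intro conjI G allI impI)
      fix v H assume H: "H1_grad \<Omega> v H"
      show "(LINT x|lebesgue_on \<Omega>. weak_grad \<Omega> u x \<bullet> H x - k\<^sup>2 * q x * u x * v x) = 0"
        using sol H1_grad_H1[OF H] unfolding cong[OF G H, symmetric] by (simp add: neumann_solution_def)
    qed
    then show "\<exists>G. H1_solution k \<Omega> q u G"
      by (rule exI[of _ "weak_grad \<Omega> u"])
  next
    assume "\<exists>G. H1_solution k \<Omega> q u G"
    then obtain G where G: "H1_grad \<Omega> u G" and sol: "\<And>v H. H1_grad \<Omega> v H \<Longrightarrow>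
        (LINT x|lebesgue_on \<Omega>. G x \<bullet> H x - k\<^sup>2 * q x * u x * v x) = 0"
      by (auto simp: H1_solution_def)
    show "neumann_solution k \<Omega> q (\<lambda>_. 0) u"
      unfolding neumann_solution_def
    proof (intro conjI ballI)
      fix v assume "v \<in> H1 \<Omega>"
      then have H: "H1_grad \<Omega> v (weak_grad \<Omega> v)"
        by (rule H1_grad_weak_grad)
      show "(LINT x|lebesgue_on \<Omega>. weak_grad \<Omega> u x \<bullet> weak_grad \<Omega> v x - k\<^sup>2 * q x * u x * v x)
          = (LINT x|surface_measure \<Omega>. 0 * trace \<Omega> v x)"
        unfolding cong[OF G H] using sol[OF H] by simp
    qed (rule H1_grad_H1[OF G])
  qed
qed

lemma H1_solution_scale:
  assumes "H1_solution k \<Omega> q u G"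
  shows "H1_solution k \<Omega> q (\<lambda>x. c * u x) (\<lambda>x. c *\<^sub>R G x)"
  unfolding H1_solution_def
proof (intro conjI allI impI)
  show "H1_grad \<Omega> (\<lambda>x. c * u x) (\<lambda>x. c *\<^sub>R G x)"
    using assms by (intro H1_grad_scale) (simp add: H1_solution_def)
  fix v H assume "H1_grad \<Omega> v H"
  then have "(LINT x|lebesgue_on \<Omega>. G x \<bullet> H x - k\<^sup>2 * q x * u x * v x) = 0"
    using assms by (simp add: H1_solution_def)
  then have "(LINT x|lebesgue_on \<Omega>. c * (G x \<bullet> H x - k\<^sup>2 * q x * u x * v x)) = 0"
    by simp
  then show "(LINT x|lebesgue_on \<Omega>. (c *\<^sub>R G x) \<bullet> H x - k\<^sup>2 * q x * (c * u x) * v x) = 0"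
    by (simp add: right_diff_distrib mult_ac)
qed

lemma normalised_solution:
  assumes sol: "H1_solution k \<Omega> q u G" and nz: "\<not> (AE x in lebesgue_on \<Omega>. u x = 0)"
  obtains v H where "H1_solution k \<Omega> q v H" "(LINT x|lebesgue_on \<Omega>. (v x)\<^sup>2) = 1"
proof -
  have int: "integrable (lebesgue_on \<Omega>) (\<lambda>x. (u x)\<^sup>2)"
    using sol by (simp add: H1_solution_def H1_grad_def L2_def)
  define A where "A = (LINT x|lebesgue_on \<Omega>. (u x)\<^sup>2)"
  have "A \<noteq> 0"
    unfolding A_def using nz by (subst integral_nonneg_eq_0_iff_AE[OF int]) auto
  moreover have "0 \<le> A"
    by (simp add: A_def)
  ultimately have A: "0 < A"
    by simp
  define c where "c = 1 / sqrt A"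
  have "(LINT x|lebesgue_on \<Omega>. (c * u x)\<^sup>2) = c\<^sup>2 * A"
    by (simp add: A_def power_mult_distrib)
  also have "\<dots> = 1"
    using A by (simp add: c_def power_divide)
  finally show ?thesis
    by (rule that[OF H1_solution_scale[OF sol]])
qed

section \<open>Limits of resonant coefficients\<close>

text \<open>
  The compactness argument. With \<open>f n = p n u n\<close>, which is bounded in $L^2$, the equation reads
  \<open>\<integral>G n \<bullet> H = k\<^sup>2 \<integral>f n v\<close>. Tested with \<open>u n\<close> it bounds \<open>G n\<close>, and tested with differences it transfers
  the Cauchy property from the \<open>u n\<close> to the \<open>G n\<close>. Uniform closeness of \<open>p n\<close> to \<open>q\<close> makes \<open>f n\<close> converge
  to \<open>q v\<close> in $L^2$, which suffices to pass to the limit in the equation; the limit is nonzero since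
  the norm 1 survives strong convergence.
\<close>
lemma resonance_limit:
  fixes \<Omega> :: "'a::euclidean_space set"
  assumes \<Omega>: "bounded_Lipschitz_domain \<Omega>"
    and q: "q \<in> borel_measurable (lebesgue_on \<Omega>)" "AE x in lebesgue_on \<Omega>. \<bar>q x\<bar> \<le> K"
    and p: "\<And>n. p n \<in> borel_measurable (lebesgue_on \<Omega>)"
      "\<And>n. AE x in lebesgue_on \<Omega>. \<bar>p n x - q x\<bar> \<le> \<delta> n"
    and \<delta>: "\<delta> \<longlonglongrightarrow> 0" "\<And>n. \<delta> n \<le> 1"
    and sol: "\<And>n. H1_solution k \<Omega> (p n) (u n) (G n)"
    and norm1: "\<And>n. (LINT x|lebesgue_on \<Omega>. (u n x)\<^sup>2) = 1"
  shows "\<exists>v H. H1_solution k \<Omega> q v H \<and> \<not> (AE x in lebesgue_on \<Omega>. v x = 0)"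
proof -
  let ?M = "lebesgue_on \<Omega>"
  have op: "open \<Omega>" and bd: "bounded \<Omega>"
    using \<Omega> by (simp_all add: bounded_Lipschitz_domain_def)
  have H1: "H1_grad \<Omega> (u n) (G n)" and u: "u n \<in> L2 ?M" and G: "G n \<in> L2 ?M" for n
    using sol[of n] by (simp_all add: H1_solution_def H1_grad_def)
  define B where "B = \<bar>K\<bar> + 1"
  have B: "0 < B"
    by (simp add: B_def)
  have pB: "AE x in ?M. \<bar>p n x\<bar> \<le> B" for n
    using p(2)[of n] q(2) by eventually_elim (use \<delta>(2)[of n] in \<open>simp add: B_def\<close>)
  define f where "f n x = p n x * u n x" for n x
  have f: "f n \<in> L2 ?M" for n
    using L2_scaleR[OF u p(1) pB, of n n] by (simp add: f_def[abs_def])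
  have f_le: "(LINT x|?M. (f n x)\<^sup>2) \<le> B\<^sup>2" for n
    using L2_scaleR_le[OF u p(1) pB, of n n] norm1[of n] by (simp add: f_def)
  have energy: "(LINT x|?M. G n x \<bullet> H x) = k\<^sup>2 * (LINT x|?M. f n x * v x)" if vH: "H1_grad \<Omega> v H" for n v H
  proof -
    have v: "v \<in> L2 ?M" and H: "H \<in> L2 ?M"
      using vH by (simp_all add: H1_grad_def)
    have "(LINT x|?M. G n x \<bullet> H x - k\<^sup>2 * (f n x * v x)) = 0"
      using sol[of n] vH by (simp add: H1_solution_def f_def mult.assoc)
    then show ?thesis
      using L2_integrable_inner[OF G H, of n] L2_integrable_inner[OF f v, of n] by simp
  qed
  have G_le: "(LINT x|?M. (norm (G n x))\<^sup>2) \<le> max 1 (k\<^sup>2 * B)" for n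
  proof -
    have "(LINT x|?M. f n x * u n x)\<^sup>2 \<le> (LINT x|?M. (f n x)\<^sup>2) * (LINT x|?M. (u n x)\<^sup>2)"
      using L2_Cauchy_Schwarz[OF f u, of n n] by simp
    also have "\<dots> \<le> B\<^sup>2"
      using f_le norm1 by simp
    finally have "(LINT x|?M. f n x * u n x) \<le> B"
      by (rule power2_le_imp_le) (use B in simp)
    then have "k\<^sup>2 * (LINT x|?M. f n x * u n x) \<le> k\<^sup>2 * B"
      by (intro mult_left_mono) auto
    then show ?thesis
      using energy[OF H1, of n n] by (simp add: power2_norm_eq_inner)
  qed
  have u_le: "(LINT x|?M. (u n x)\<^sup>2) \<le> max 1 (k\<^sup>2 * B)" for n
    using norm1 by simp
  obtain s where s: "strict_mono (s :: nat \<Rightarrow> nat)"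
    and Cu: "\<And>e. 0 < e \<Longrightarrow> \<exists>N. \<forall>i\<ge>N. \<forall>j\<ge>N. (LINT x|?M. (u (s i) x - u (s j) x)\<^sup>2) < e"
    by (rule Rellich_compactness[of \<Omega> u G "max 1 (k\<^sup>2 * B)", OF \<Omega> H1 u_le G_le]) (rule that)
  have CG: "\<exists>N. \<forall>i\<ge>N. \<forall>j\<ge>N. (LINT x|?M. (norm (G (s i) x - G (s j) x))\<^sup>2) < e" if e: "0 < e" for e
  proof -
    define D where "D = k ^ 4 * (4 * B\<^sup>2)"
    have D: "0 \<le> D"
      by (simp add: D_def)
    \<comment> \<open>\<open>D\<close> may vanish, hence the denominator \<open>D + 1\<close>.\<close>
    have "0 < e\<^sup>2 / (D + 1)"
      using e D by (intro divide_pos_pos) auto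
    from Cu[OF this] obtain N where N: "\<And>i j. N \<le> i \<Longrightarrow> N \<le> j \<Longrightarrow>
        (LINT x|?M. (u (s i) x - u (s j) x)\<^sup>2) < e\<^sup>2 / (D + 1)"
      by blast
    have "(LINT x|?M. (norm (G (s i) x - G (s j) x))\<^sup>2) < e" if ij: "N \<le> i" "N \<le> j" for i j
    proof -
      define w where "w x = u (s i) x - u (s j) x" for x
      define W where "W x = G (s i) x - G (s j) x" for x
      have wW: "H1_grad \<Omega> w W"
        unfolding w_def W_def by (intro H1_grad_diff op bd H1)
      then have w: "w \<in> L2 ?M" and W: "W \<in> L2 ?M"
        by (simp_all add: H1_grad_def)
      have fd: "(\<lambda>x. f (s i) x - f (s j) x) \<in> L2 ?M"
        by (intro L2_diff f)
      have "(LINT x|?M. (norm (W x))\<^sup>2) = (LINT x|?M. G (s i) x \<bullet> W x) - (LINT x|?M. G (s j) x \<bullet> W x)"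
        using L2_integrable_inner[OF G W, of "s i"] L2_integrable_inner[OF G W, of "s j"]
        by (simp add: power2_norm_eq_inner W_def inner_diff_left)
      also have "\<dots> = k\<^sup>2 * (LINT x|?M. (f (s i) x - f (s j) x) * w x)"
        using L2_integrable_inner[OF f w, of "s i"] L2_integrable_inner[OF f w, of "s j"]
        by (simp add: energy[OF wW] left_diff_distrib right_diff_distrib)
      finally have "(LINT x|?M. (norm (W x))\<^sup>2)\<^sup>2 = k ^ 4 * (LINT x|?M. (f (s i) x - f (s j) x) * w x)\<^sup>2"
        by (simp add: power_mult_distrib)
      also have "\<dots> \<le> k ^ 4 * ((4 * B\<^sup>2) * (LINT x|?M. (w x)\<^sup>2))"
      proof (rule mult_left_mono)
        have "(LINT x|?M. (f (s i) x - f (s j) x) * w x)\<^sup>2 \<le> (LINT x|?M. (f (s i) x - f (s j) x)\<^sup>2) * (LINT x|?M. (w x)\<^sup>2)"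
          using L2_Cauchy_Schwarz[OF fd w] by simp
        also have "\<dots> \<le> (4 * B\<^sup>2) * (LINT x|?M. (w x)\<^sup>2)"
        proof (rule mult_right_mono)
          show "(LINT x|?M. (f (s i) x - f (s j) x)\<^sup>2) \<le> 4 * B\<^sup>2"
            using L2_diff_le[OF f f, of "s i" "s j"] f_le[of "s i"] f_le[of "s j"] by simp
        qed simp
        finally show "(LINT x|?M. (f (s i) x - f (s j) x) * w x)\<^sup>2 \<le> (4 * B\<^sup>2) * (LINT x|?M. (w x)\<^sup>2)" .
      qed simp
      also have "\<dots> = D * (LINT x|?M. (w x)\<^sup>2)"
        by (simp add: D_def)
      also have "\<dots> \<le> D * (e\<^sup>2 / (D + 1))"
        using N[OF ij] D unfolding w_def by (intro mult_left_mono) auto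
      also have "\<dots> < e\<^sup>2"
        using D e by (simp add: field_simps)
      finally have "(LINT x|?M. (norm (W x))\<^sup>2) < e"
        by (rule power2_less_imp_less) (use e in simp)
      then show ?thesis
        by (simp add: W_def)
    qed
    then show ?thesis by blast
  qed
  obtain v where v: "v \<in> L2 ?M" and lim_v: "(\<lambda>n. LINT x|?M. (norm (u (s n) x - v x))\<^sup>2) \<longlonglongrightarrow> 0"
  proof (rule L2_complete[of "\<lambda>n. u (s n)" ?M])
    show "\<exists>N. \<forall>i\<ge>N. \<forall>j\<ge>N. (LINT x|?M. (norm (u (s i) x - u (s j) x))\<^sup>2) < e" if "0 < e" for e
      using Cu[OF that] by simp
  qed (use u in auto)
  obtain H where H: "H \<in> L2 ?M" and lim_H: "(\<lambda>n. LINT x|?M. (norm (G (s n) x - H x))\<^sup>2) \<longlonglongrightarrow> 0"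
  proof (rule L2_complete[of "\<lambda>n. G (s n)" ?M])
    show "\<exists>N. \<forall>i\<ge>N. \<forall>j\<ge>N. (LINT x|?M. (norm (G (s i) x - G (s j) x))\<^sup>2) < e" if "0 < e" for e
      using CG[OF that] .
  qed (use G in auto)
  have vH: "H1_grad \<Omega> v H"
    by (rule H1_grad_limit[OF op bd H1 v H lim_v lim_H])
  have qv: "(\<lambda>x. q x * v x) \<in> L2 ?M"
    using L2_scaleR[OF v q] by simp
  have lim_f: "(\<lambda>n. LINT x|?M. (norm (f (s n) x - q x * v x))\<^sup>2) \<longlonglongrightarrow> 0"
  proof (rule Lim_null_comparison)
    have "(\<lambda>n. 2 * (\<delta> (s n))\<^sup>2 + 2 * (K\<^sup>2 * (LINT x|?M. (norm (u (s n) x - v x))\<^sup>2))) \<longlonglongrightarrow> 2 * 0\<^sup>2 + 2 * (K\<^sup>2 * 0)"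
      using LIMSEQ_subseq_LIMSEQ[OF \<delta>(1) s] lim_v by (intro tendsto_intros) (simp_all add: o_def)
    then show "(\<lambda>n. 2 * (\<delta> (s n))\<^sup>2 + 2 * (K\<^sup>2 * (LINT x|?M. (norm (u (s n) x - v x))\<^sup>2))) \<longlonglongrightarrow> 0"
      by simp
    have "(LINT x|?M. (norm (f (s n) x - q x * v x))\<^sup>2) \<le>
        2 * (\<delta> (s n))\<^sup>2 + 2 * (K\<^sup>2 * (LINT x|?M. (norm (u (s n) x - v x))\<^sup>2))" for n
    proof -
      have uv: "(\<lambda>x. u (s n) x - v x) \<in> L2 ?M"
        by (intro L2_diff u v)
      have m: "(\<lambda>x. q x - p (s n) x) \<in> borel_measurable ?M" "AE x in ?M. \<bar>q x - p (s n) x\<bar> \<le> \<delta> (s n)"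
        using q(1) p(1)[of "s n"] p(2)[of "s n"] by (auto simp: abs_minus_commute)
      have "(LINT x|?M. (norm (f (s n) x - q x * v x))\<^sup>2) =
          (LINT x|?M. (norm (q x *\<^sub>R (u (s n) x - v x) - (q x - p (s n) x) *\<^sub>R u (s n) x))\<^sup>2)"
        by (simp add: f_def algebra_simps)
      also have "\<dots> \<le> 2 * (LINT x|?M. (norm (q x *\<^sub>R (u (s n) x - v x)))\<^sup>2)
          + 2 * (LINT x|?M. (norm ((q x - p (s n) x) *\<^sub>R u (s n) x))\<^sup>2)"
        by (intro L2_diff_le L2_scaleR[OF uv q] L2_scaleR[OF u m])
      also have "\<dots> \<le> 2 * (\<delta> (s n))\<^sup>2 + 2 * (K\<^sup>2 * (LINT x|?M. (norm (u (s n) x - v x))\<^sup>2))"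
        using L2_scaleR_le[OF uv q] L2_scaleR_le[OF u m, of "s n"] norm1[of "s n"] by simp
      finally show ?thesis .
    qed
    then show "\<forall>\<^sub>F n in sequentially. norm (LINT x|?M. (norm (f (s n) x - q x * v x))\<^sup>2) \<le>
        2 * (\<delta> (s n))\<^sup>2 + 2 * (K\<^sup>2 * (LINT x|?M. (norm (u (s n) x - v x))\<^sup>2))"
      by (intro always_eventually allI) simp
  qed
  have "H1_solution k \<Omega> q v H"
    unfolding H1_solution_def
  proof (intro conjI vH allI impI)
    fix w W assume wW: "H1_grad \<Omega> w W"
    then have w: "w \<in> L2 ?M" and W: "W \<in> L2 ?M"
      by (simp_all add: H1_grad_def)
    have "(\<lambda>n. LINT x|?M. G (s n) x \<bullet> W x) \<longlonglongrightarrow> (LINT x|?M. H x \<bullet> W x)"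
      by (rule L2_inner_tendsto[OF G H W lim_H])
    moreover have "(\<lambda>n. k\<^sup>2 * (LINT x|?M. f (s n) x * w x)) \<longlonglongrightarrow> k\<^sup>2 * (LINT x|?M. (q x * v x) * w x)"
      using L2_inner_tendsto[OF f qv w lim_f] by (intro tendsto_mult_left) simp
    ultimately have "(LINT x|?M. H x \<bullet> W x) = k\<^sup>2 * (LINT x|?M. (q x * v x) * w x)"
      unfolding energy[OF wW] by (rule LIMSEQ_unique)
    then have "(LINT x|?M. H x \<bullet> W x - k\<^sup>2 * ((q x * v x) * w x)) = 0"
      using L2_integrable_inner[OF H W] L2_integrable_inner[OF qv w] by simp
    then show "(LINT x|?M. H x \<bullet> W x - k\<^sup>2 * q x * v x * w x) = 0"
      by (simp add: mult.assoc)
  qed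
  moreover have "\<not> (AE x in ?M. v x = 0)"
  proof
    assume v0: "AE x in ?M. v x = 0"
    have "(LINT x|?M. (norm (u (s n) x - v x))\<^sup>2) = 1" for n
    proof -
      have [measurable]: "u (s n) \<in> borel_measurable ?M" "v \<in> borel_measurable ?M"
        using u[of "s n"] v by (simp_all add: L2_def)
      have "(LINT x|?M. (norm (u (s n) x - v x))\<^sup>2) = (LINT x|?M. (u (s n) x)\<^sup>2)"
        using v0 by (intro integral_cong_AE) (auto elim!: eventually_mono)
      then show ?thesis
        using norm1 by simp
    qed
    then show False
      using lim_v by (simp add: LIMSEQ_const_iff)
  qed
  ultimately show ?thesis
    by blast
qed

text \<open>
  If no ball about \<open>Q\<close> avoided the resonant coefficients, there would be resonant ones within \<open>1/(n+1)\<close>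
  of \<open>Q\<close> for each \<open>n\<close>, and \<open>Q\<close> would itself be resonant.
\<close>
theorem lemma1:
  fixes \<Omega> :: "(real ^ 'n) set" and k :: real
  assumes "CARD('n) \<ge> 2"
    and "bounded_Lipschitz_domain \<Omega>"
    and "k > 0"
  shows "openin (Linf_topology (lebesgue_on \<Omega>)) (NtD_domain k \<Omega>)"
proof -
  let ?M = "lebesgue_on \<Omega>"
  interpret Metric_space "Linf ?M" "Linf_dist ?M"
    by (rule Metric_space_Linf)
  have op: "open \<Omega>" and bd: "bounded \<Omega>"
    using assms(2) by (simp_all add: bounded_Lipschitz_domain_def)
  have meas: "repr Q \<in> borel_measurable ?M" if "Q \<in> Linf ?M" for Q
    using repr_Linf(2)[OF that] by (simp add: Linf_fun_def)
  have "\<exists>r>0. mball Q r \<subseteq> NtD_domain k \<Omega>" if Q: "Q \<in> NtD_domain k \<Omega>" for Q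
  proof (rule ccontr)
    assume no: "\<not> (\<exists>r>0. mball Q r \<subseteq> NtD_domain k \<Omega>)"
    have QL: "Q \<in> Linf ?M"
      using Q by (simp add: NtD_domain_def)
    have "\<forall>n. \<exists>t. fst t \<in> Linf ?M \<and> Linf_dist ?M Q (fst t) < 1 / real (Suc n) \<and>
        H1_solution k \<Omega> (repr (fst t)) (fst (snd t)) (snd (snd t)) \<and> (LINT x|?M. (fst (snd t) x)\<^sup>2) = 1"
    proof
      fix n :: nat
      have "0 < 1 / real (Suc n)"
        by simp
      then obtain P where "P \<in> mball Q (1 / real (Suc n))" and out: "P \<notin> NtD_domain k \<Omega>"
        using no by blast
      then have P: "P \<in> Linf ?M" "Linf_dist ?M Q P < 1 / real (Suc n)"
        by (simp_all only: in_mball)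
      from P(1) out obtain u where u: "neumann_solution k \<Omega> (repr P) (\<lambda>_. 0) u" "\<not> (AE x in ?M. u x = 0)"
        by (auto simp: NtD_domain_def resonant_def)
      obtain G where G: "H1_solution k \<Omega> (repr P) u G"
        using u(1) unfolding homogeneous_solution_iff[OF op bd meas[OF P(1)]] by (elim exE)
      obtain v H where "H1_solution k \<Omega> (repr P) v H" "(LINT x|?M. (v x)\<^sup>2) = 1"
        by (rule normalised_solution[OF G u(2)]) (rule that)
      then show "\<exists>t. fst t \<in> Linf ?M \<and> Linf_dist ?M Q (fst t) < 1 / real (Suc n) \<and>
        H1_solution k \<Omega> (repr (fst t)) (fst (snd t)) (snd (snd t)) \<and> (LINT x|?M. (fst (snd t) x)\<^sup>2) = 1"
        using P by (intro exI[of _ "(P, v, H)"]) simp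
    qed
    then obtain t where t: "\<forall>n. fst (t n) \<in> Linf ?M \<and> Linf_dist ?M Q (fst (t n)) < 1 / real (Suc n) \<and>
        H1_solution k \<Omega> (repr (fst (t n))) (fst (snd (t n))) (snd (snd (t n))) \<and> (LINT x|?M. (fst (snd (t n)) x)\<^sup>2) = 1"
      by (rule choice[THEN exE])
    have "\<exists>v H. H1_solution k \<Omega> (repr Q) v H \<and> \<not> (AE x in ?M. v x = 0)"
    proof (rule resonance_limit[OF assms(2)])
      show "repr Q \<in> borel_measurable ?M" "AE x in ?M. \<bar>repr Q x\<bar> \<le> Linf_norm ?M (repr Q)"
        by (rule meas[OF QL], rule Linf_norm_AE[OF repr_Linf(2)[OF QL]])
      show "repr (fst (t n)) \<in> borel_measurable ?M" for n
        using t by (intro meas) simp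
      show "AE x in ?M. \<bar>repr (fst (t n)) x - repr Q x\<bar> \<le> 1 / real (Suc n)" for n
      proof -
        have "AE x in ?M. \<bar>repr Q x - repr (fst (t n)) x\<bar> \<le> Linf_dist ?M Q (fst (t n))"
          unfolding Linf_dist_def using t by (intro Linf_norm_AE Linf_fun_diff repr_Linf(2) QL) simp
        moreover have "Linf_dist ?M Q (fst (t n)) < 1 / real (Suc n)"
          using t by blast
        ultimately show ?thesis
          by (elim eventually_mono) linarith
      qed
      show "(\<lambda>n. 1 / real (Suc n)) \<longlonglongrightarrow> 0"
        using LIMSEQ_inverse_real_of_nat by (simp add: inverse_eq_divide)
      show "1 / real (Suc n) \<le> 1" for n
        by simp
      show "H1_solution k \<Omega> (repr (fst (t n))) (fst (snd (t n))) (snd (snd (t n)))"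
        "(LINT x|?M. (fst (snd (t n)) x)\<^sup>2) = 1" for n
        using t by auto
    qed
    then obtain v H where H: "H1_solution k \<Omega> (repr Q) v H" and v: "\<not> (AE x in ?M. v x = 0)"
      by (elim exE conjE)
    have "neumann_solution k \<Omega> (repr Q) (\<lambda>_. 0) v"
      unfolding homogeneous_solution_iff[OF op bd meas[OF QL]] by (rule exI[of _ H], rule H)
    then have "Q \<in> resonant k \<Omega>"
      using QL v by (auto simp: resonant_def)
    then show False
      using Q by (simp add: NtD_domain_def)
  qed
  then show ?thesis
    unfolding Linf_topology_def openin_mtopology by (auto simp: NtD_domain_def)
qed

end
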